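(* Let $n\geq 3$ and $\frac{1-3n^2}{2n}\leq p<-n$. Suppose $K\in\mathcal{K}_+^2$ is $S_2$-isotropic and its support function $h_K$ solves $$h_K^{1-p}\det(\nabla^2 h_K+h_K I)=1\quad\text{on }\mathbb{S}^{n-1}.$$ If moreover $\lambda_2(-L_K)\geq \frac{n-1}{2n-1+p}$, then $K$ is the unit ball.
   Context: For a convex body $K\subset\mathbb{R}^n$ with the origin in its interior, $h_K(x)=\max_{y\in K}\langle x,y\rangle$, $x\in\mathbb{S}^{n-1}$, is its support function. $\mathcal{K}_+^2$ denotes the class of convex bodies in $\mathbb{R}^n$ containing the origin in their interior, with $C^2$ boundary and strictly positive Gauss curvature. Notation on the sphere: - $\nabla$ is the Levi-Civita connection of the round metric on $\mathbb{S}^{n-1}$ and $\mu$ is the spherical Lebesgue measure. - For $h\in C^2(\mathbb{S}^{n-1})$, $D^2h=\nabla^2h+h\,I$. - The cone-volume measure is $dV_K=\frac1n h_K\det(D^2h_K)\,d\mu$. - The $L_2$-surface-area measure is $dS_2K=h_K^{-1}\det(D^2h_K)\,d\mu$. A finite measure $\mathbf m$ on $\mathbb{S}^{n-1}$ is isotropic if $\int\langle x,w\rangle^2 d\mathbf m(x)=\frac{\mathbf m(\mathbb{S}^{n-1})}{n}|w|^2$ for all $w\in\mathbb{R}^n$. $K$ is $S_2$-isotropic if $S_2K$ is isotropic. The Hilbert–Brunn–Minkowski operator is $L_Kz=\frac{1}{n-1}\mathrm{tr}\big((D^2h_K)^{-1}D^2(zh_K)\big)-z$ for $z\in C^2(\mathbb{S}^{n-1})$.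 Set $\ell_v^K(x)=\langle x,v\rangle/h_K(x)$. Then $$\lambda_2(-L_K)=\inf\Big\{\tfrac{\int z(-L_Kz)\,dV_K}{\int z^2\,dV_K}:\ z\in C^2(\mathbb{S}^{n-1}),\ z\not\equiv0,\ \int z\,dV_K=0,\ \int z\,\ell_v^K\,dV_K=0\ \forall v\in\mathbb{R}^n\Big\}.$$ This is the second nonzero eigenvalue of $-L_K$ on $L^2(V_K)$. *)

theory Defs
  imports "HOL-Analysis.Analysis"
begin


definition grad :: "(real ^ 'n::finite \<Rightarrow> real) \<Rightarrow> real ^ 'n \<Rightarrow> real ^ 'n" where
  "grad f x = (\<chi> i. frechet_derivative f (at x) (axis i 1))"

definition hess :: "(real ^ 'n::finite \<Rightarrow> real) \<Rightarrow> real ^ 'n \<Rightarrow> real ^ 'n ^ 'n" where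
  "hess f x = (\<chi> i j. frechet_derivative (\<lambda>y. grad f y $ j) (at x) (axis i 1))"

definition C2_on :: "(real ^ 'n::finite) set \<Rightarrow> (real ^ 'n \<Rightarrow> real) \<Rightarrow> bool" where
  "C2_on U f \<longleftrightarrow> open U \<and> (\<forall>x\<in>U. f differentiable (at x)) \<and>
     (\<forall>x\<in>U. (\<lambda>y. grad f y) differentiable (at x)) \<and> continuous_on U (hess f)"

definition outer :: "real ^ 'n::finite \<Rightarrow> real ^ 'n \<Rightarrow> real ^ 'n ^ 'n" where
  "outer u v = (\<chi> i j. u $ i * v $ j)"

definition convex_body0 :: "(real ^ 'n::finite) set \<Rightarrow> bool" where
  "convex_body0 K \<longleftrightarrow> compact K \<and> convex K \<and> 0 \<in> interior K"

definition support_fun :: "(real ^ 'n::finite) set \<Rightarrow> real ^ 'n \<Rightarrow> real" where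
  "support_fun K x = (SUP y\<in>K. x \<bullet> y)"

text \<open>Gauss curvature at p of the hypersurface {F = 0} (with outer normal grad F / |grad F|):
  the determinant of the shape operator  P (Hess F) P / |grad F|  on the tangent space
  (grad F)^perp; it is computed as a full determinant after adding the identity on the
  normal line.\<close>
definition gauss_curv :: "(real ^ 'n::finite \<Rightarrow> real) \<Rightarrow> real ^ 'n \<Rightarrow> real" where
  "gauss_curv F p =
     (let g = grad F p; \<nu> = g /\<^sub>R norm g; P = mat 1 - outer \<nu> \<nu>
      in det ((P ** hess F p ** P) /\<^sub>R norm g + outer \<nu> \<nu>))"

text \<open>The class K^2_+: convex bodies with the origin in their interior, C^2 boundary and
  strictly positive Gauss curvature.  The boundary is C^2 if near every boundary point p it
  is the regular level set of a C^2 function F with K locally equal to {F \<le> 0}.\<close>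
definition K2plus :: "(real ^ 'n::finite) set \<Rightarrow> bool" where
  "K2plus K \<longleftrightarrow> convex_body0 K \<and>
     (\<forall>p\<in>frontier K. \<exists>U F. p \<in> U \<and> C2_on U F \<and> grad F p \<noteq> 0 \<and>
         K \<inter> U = {x\<in>U. F x \<le> 0} \<and> gauss_curv F p > 0)"

definition ext1 :: "(real ^ 'n::finite \<Rightarrow> real) \<Rightarrow> real ^ 'n \<Rightarrow> real" where
  "ext1 z x = norm x * z (x /\<^sub>R norm x)"

definition C2_sphere :: "(real ^ 'n::finite \<Rightarrow> real) \<Rightarrow> bool" where
  "C2_sphere z \<longleftrightarrow> C2_on (- {0}) (ext1 z)"

text \<open>D^2 z = \<nabla>^2 z + z I at x \<in> S^{n-1}, realised as an endomorphism of R^n: on the tangent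
  space x^perp it is the Euclidean Hessian of the 1-homogeneous extension (which equals
  \<nabla>^2 z + z I there), and on the normal line it is the identity.  Hence
  det (D2 z x) = det(D^2 z) on the tangent space, and traces of products pick up an extra 1.\<close>
definition D2 :: "(real ^ 'n::finite \<Rightarrow> real) \<Rightarrow> real ^ 'n \<Rightarrow> real ^ 'n ^ 'n" where
  "D2 z x = hess (ext1 z) x + outer x x"

text \<open>Integral over S^{n-1} w.r.t. spherical Lebesgue measure, via the cone formula
  \<integral>_S f d\<mu> = n \<integral>_{B^n} f(x/|x|) dx.\<close>
definition sph_int :: "(real ^ 'n::finite \<Rightarrow> real) \<Rightarrow> real" where
  "sph_int f = real CARD('n) * integral (ball 0 1) (\<lambda>x. f (x /\<^sub>R norm x))"

definition cone_vol_dens :: "(real ^ 'n::finite) set \<Rightarrow> real ^ 'n \<Rightarrow> real" where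
  "cone_vol_dens K x = (1 / real CARD('n)) * support_fun K x * det (D2 (support_fun K) x)"

definition S2_dens :: "(real ^ 'n::finite) set \<Rightarrow> real ^ 'n \<Rightarrow> real" where
  "S2_dens K x = det (D2 (support_fun K) x) / support_fun K x"

definition isotropic_dens :: "(real ^ 'n::finite \<Rightarrow> real) \<Rightarrow> bool" where
  "isotropic_dens m \<longleftrightarrow>
     (\<forall>w. sph_int (\<lambda>x. (x \<bullet> w)\<^sup>2 * m x) = sph_int m / real CARD('n) * (norm w)\<^sup>2)"

definition S2_isotropic :: "(real ^ 'n::finite) set \<Rightarrow> bool" where
  "S2_isotropic K \<longleftrightarrow> isotropic_dens (S2_dens K)"

text \<open>Hilbert-Brunn-Minkowski operator
  L_K z = tr((D^2 h)^{-1} D^2(z h))/(n-1) - z; the trace over R^n of our extended matrices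
  exceeds the tangential trace by exactly 1.\<close>
definition HBM_op :: "(real ^ 'n::finite) set \<Rightarrow> (real ^ 'n \<Rightarrow> real) \<Rightarrow> real ^ 'n \<Rightarrow> real" where
  "HBM_op K z x =
     (trace (matrix_inv (D2 (support_fun K) x) ** D2 (\<lambda>y. z y * support_fun K y) x) - 1)
       / (real CARD('n) - 1) - z x"

definition ell :: "(real ^ 'n::finite) set \<Rightarrow> real ^ 'n \<Rightarrow> real ^ 'n \<Rightarrow> real" where
  "ell K v x = (x \<bullet> v) / support_fun K x"

definition lambda2_admissible :: "(real ^ 'n::finite) set \<Rightarrow> (real ^ 'n \<Rightarrow> real) \<Rightarrow> bool" where
  "lambda2_admissible K z \<longleftrightarrow> C2_sphere z \<and> (\<exists>x\<in>sphere 0 1. z x \<noteq> 0) \<and>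
     sph_int (\<lambda>x. z x * cone_vol_dens K x) = 0 \<and>
     (\<forall>v. sph_int (\<lambda>x. z x * ell K v x * cone_vol_dens K x) = 0)"

definition lambda2 :: "(real ^ 'n::finite) set \<Rightarrow> ereal" where
  "lambda2 K = (INF z \<in> {z. lambda2_admissible K z}.
      ereal (sph_int (\<lambda>x. z x * (- HBM_op K z x) * cone_vol_dens K x) /
             sph_int (\<lambda>x. (z x)\<^sup>2 * cone_vol_dens K x)))"

end

theory Submission
  imports Defs
begin

text \<open>Write \<open>h\<close> for the support function, \<open>X = \<nabla>h + h x\<close> for its Euclidean gradient and \<open>T = X - h x\<close>.
  If \<open>h\<close> is smooth, the coordinates of \<open>X\<close>, made orthogonal to the constants and to the functions \<open>\<langle>x, v\<rangle> / h\<close>, are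
  admissible in the variational problem for \<open>\<lambda>\<^sub>2\<close>.  The equation makes \<open>L\<^sub>K X\<close> a combination of \<open>X\<close> and
  \<open>h x\<close>, isotropy makes the projection onto the \<open>\<langle>x, v\<rangle> / h\<close> explicit, and summing over the
  coordinates gives \<open>\<integral> \<bar>T\<bar>\<^sup>2 dV\<^sub>K \<le> \<bar>\<integral> T dV\<^sub>K\<bar>\<^sup>2 / V(K)\<close>: for the threshold in the hypothesis all
  constants match.  Equality in Cauchy-Schwarz makes \<open>T\<close> constant; being tangential, it vanishes,
  so \<open>h\<close> is constant.

  Since \<open>h\<close> is only known to be \<open>C\<^sup>2\<close>, \<open>X\<close> is not an admissible test function itself.  No elliptic
  regularity is used: \<open>L\<^sub>K\<close> is written in divergence form by means of the Piola identity, and \<open>X\<close> is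
  approximated in \<open>C\<^sup>1\<close> by difference quotients of \<open>h\<close>.\<close>

section \<open>Integration over the sphere\<close>

text \<open>Write \<open>s = 2n - 1 + p\<close>. The lower bound on p says exactly
  \<open>2 n s \<ge> (n-1)^2\<close>, so s is positive. For \<open>\<Lambda> = (n-1)^2 / s\<close>
  one has \<open>(p + 1 + \<Lambda>) s = (p + n)^2\<close>, and the divergence theorem shows that (p
  + n) times the integral of T is (n - 1) times the integral of X; this is how the constants meet.
  The condition \<open>p < -n\<close> gives \<open>\<Lambda> \<ge> n - 1\<close>, the sign under
  which the term left by the projection onto the \<langle>x, v\<rangle> / h can be estimated by
  Cauchy-Schwarz. Two obstacles shape the rest. The body is given by local defining functions, each
  with positive curvature at its own base point only, so that h is twice differentiable has to be
  derived, by implicit differentiation of the Gauss map equation. And D^2 h lives on tangent spaces,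
  its Euclidean counterpart being degenerate in the radial direction; it is replaced by the
  nondegenerate Hessian of h^2 / 2, and functions on the sphere by homogeneous functions off the
  origin. The calculus is then Euclidean, and a divergence theorem for the sphere is the only
  geometric input.\<close>

lemma normalize_in_sphere [simp]: "(x::'a::real_normed_vector) \<noteq> 0 \<Longrightarrow> norm (x /\<^sub>R norm x) = 1"
  by simp

lemma continuous_on_normalize: "continuous_on (- {0}) (\<lambda>x::'a::real_normed_vector. x /\<^sub>R norm x)"
  by (intro continuous_intros) auto

lemma continuous_on_homogenize:
  fixes f :: "'a::real_normed_vector \<Rightarrow> real"
  assumes "continuous_on (sphere 0 1) f"
  shows "continuous_on (- {0}) (\<lambda>x. f (x /\<^sub>R norm x))"
proof (rule continuous_on_compose2[OF assms continuous_on_normalize])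
  show "(\<lambda>x::'a. x /\<^sub>R norm x) ` (- {0}) \<subseteq> sphere 0 1"
    by (intro image_subsetI) simp
qed

lemma continuous_sphere_bounded:
  fixes f :: "'a::euclidean_space \<Rightarrow> 'b::real_normed_vector"
  assumes "continuous_on (sphere 0 1) f"
  obtains B where "\<And>x. norm x = 1 \<Longrightarrow> norm (f x) \<le> B"
proof -
  obtain B where "\<forall>y\<in>f ` sphere 0 1. norm y \<le> B"
    using compact_imp_bounded[OF compact_continuous_image[OF assms compact_sphere]]
    unfolding bounded_iff by blast
  then show thesis by (intro that[of B]) simp
qed

lemma set_integrable_homogenize:
  fixes f :: "real^'n::finite \<Rightarrow> real"
  assumes "continuous_on (sphere 0 1) f"
  shows "set_integrable lborel (ball 0 1 - {0}) (\<lambda>x. f (x /\<^sub>R norm x))"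
proof -
  obtain B where B: "\<And>x. norm x = 1 \<Longrightarrow> norm (f x) \<le> B"
    using continuous_sphere_bounded[OF assms] by blast
  have meas: "set_borel_measurable lborel (ball 0 1 - {0}) (\<lambda>x. f (x /\<^sub>R norm x))"
    using borel_measurable_continuous_on_indicator[of "ball 0 1 - {0}" "\<lambda>x. f (x /\<^sub>R norm x)"]
      continuous_on_subset[OF continuous_on_homogenize[OF assms], of "ball 0 1 - {0}"]
    by (auto simp: set_borel_measurable_def)
  have "emeasure lborel (ball 0 1 - {0::real^'n}) < \<infinity>"
    by (rule emeasure_bounded_finite) (rule bounded_subset[OF bounded_ball Diff_subset])
  then have int: "set_integrable lborel (ball 0 1 - {0}) (\<lambda>x::real^'n. B)"
    unfolding set_integrable_def
    by (intro integrable_scaleR_left integrable_real_indicator) simp_all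
  show ?thesis
    unfolding set_integrable_def
  proof (rule Bochner_Integration.integrable_bound)
    show "integrable lborel (\<lambda>x. indicat_real (ball 0 1 - {0::real^'n}) x *\<^sub>R B :: real)"
      using int by (simp add: set_integrable_def)
    show "(\<lambda>x. indicat_real (ball 0 1 - {0}) x *\<^sub>R f (x /\<^sub>R norm x)) \<in> borel_measurable lborel"
      using meas by (simp add: set_borel_measurable_def)
    show "AE x in lborel. norm (indicat_real (ball 0 1 - {0}) x *\<^sub>R f (x /\<^sub>R norm x))
        \<le> norm (indicat_real (ball 0 1 - {0}) x *\<^sub>R B)"
    proof (intro always_eventually allI)
      fix x :: "real^'n"
      show "norm (indicat_real (ball 0 1 - {0}) x *\<^sub>R f (x /\<^sub>R norm x))
        \<le> norm (indicat_real (ball 0 1 - {0}) x *\<^sub>R B)"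
      proof (cases "x \<in> ball 0 1 - {0}")
        case True
        then have "norm (f (x /\<^sub>R norm x)) \<le> B" by (intro B) simp
        then show ?thesis using True by (simp add: indicator_def)
      qed simp
    qed
  qed
qed

lemma sph_int_eq_punctured:
  "sph_int f = real CARD('n) * integral (ball 0 1 - {0}) (\<lambda>x::real^'n::finite. f (x /\<^sub>R norm x))"
  unfolding sph_int_def
  by (subst integral_spike_set[of "ball 0 1" "ball 0 1 - {0}"])
     (auto intro: negligible_subset[of "{0}"])

lemma sph_int_eq_lborel:
  fixes f :: "real^'n::finite \<Rightarrow> real"
  assumes "continuous_on (sphere 0 1) f"
  shows "sph_int f = real CARD('n) *
    (\<integral>x. indicat_real (ball 0 1 - {0}) x *\<^sub>R f (x /\<^sub>R norm x) \<partial>lborel)"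
  using set_borel_integral_eq_integral(2)[OF set_integrable_homogenize[OF assms]]
  by (simp add: sph_int_eq_punctured set_lebesgue_integral_def)

lemma integrable_homogenize:
  fixes f :: "real^'n::finite \<Rightarrow> real"
  assumes "continuous_on (sphere 0 1) f"
  shows "(\<lambda>x. f (x /\<^sub>R norm x)) integrable_on (ball 0 1 - {0})"
  using set_borel_integral_eq_integral(1)[OF set_integrable_homogenize[OF assms]] .

lemma sph_int_cong:
  fixes f g :: "real^'n::finite \<Rightarrow> real"
  assumes "\<And>x. norm x = 1 \<Longrightarrow> f x = g x"
  shows "sph_int f = sph_int g"
  unfolding sph_int_eq_punctured
  by (rule arg_cong[where f = "\<lambda>t. real CARD('n) * t"], rule Henstock_Kurzweil_Integration.integral_cong)
     (use assms in auto)

lemma sph_int_add: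
  assumes "continuous_on (sphere 0 1) f" "continuous_on (sphere 0 1) g"
  shows "sph_int (\<lambda>x. f x + g x) = sph_int f + sph_int g"
  unfolding sph_int_eq_punctured
  using integral_add[OF assms[THEN integrable_homogenize]] by (simp add: distrib_left)

lemma sph_int_diff:
  assumes "continuous_on (sphere 0 1) f" "continuous_on (sphere 0 1) g"
  shows "sph_int (\<lambda>x. f x - g x) = sph_int f - sph_int g"
  unfolding sph_int_eq_punctured
  using integral_diff[OF assms[THEN integrable_homogenize]] by (simp add: right_diff_distrib)

lemma sph_int_mult_left: "sph_int (\<lambda>x. c * f x) = c * sph_int f"
  unfolding sph_int_eq_punctured by simp

lemma sph_int_mult_right: "sph_int (\<lambda>x. f x * c) = sph_int f * c"
  unfolding sph_int_eq_punctured by simp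

lemma sph_int_zero [simp]: "sph_int (\<lambda>x. 0) = 0"
  using sph_int_mult_left[of 0 "\<lambda>x. 0"] by simp

lemma sph_int_sum:
  assumes "finite I" "\<And>i. i \<in> I \<Longrightarrow> continuous_on (sphere 0 1) (f i)"
  shows "sph_int (\<lambda>x. \<Sum>i\<in>I. f i x) = (\<Sum>i\<in>I. sph_int (f i))"
  using assms
proof (induction I rule: finite_induct)
  case (insert i I)
  then show ?case
    by (simp add: sph_int_add continuous_on_sum)
qed auto

lemma sph_int_nonneg:
  assumes "continuous_on (sphere 0 1) f" "\<And>x. norm x = 1 \<Longrightarrow> f x \<ge> 0"
  shows "sph_int f \<ge> 0"
  unfolding sph_int_eq_punctured
  by (intro mult_nonneg_nonneg integral_nonneg integrable_homogenize assms) auto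

lemma sph_int_eq_0_imp:
  fixes f :: "real^'n::finite \<Rightarrow> real"
  assumes cont: "continuous_on (sphere 0 1) f" and nn: "\<And>x. norm x = 1 \<Longrightarrow> f x \<ge> 0"
    and 0: "sph_int f = 0" and u: "norm u = 1"
  shows "f u = 0"
proof (rule ccontr)
  let ?F = "\<lambda>x. f (x /\<^sub>R norm x)"
  let ?S = "ball 0 1 - {0} :: (real^'n) set"
  assume "f u \<noteq> 0"
  then have pos: "f u > 0" using nn[OF u] by simp
  \<comment> \<open>The unit sphere lies outside the open ball; u/2 is an interior point where the
    radial extension takes the same value, so positivity spreads to a box of positive
    volume.\<close>
  have "isCont ?F (u /\<^sub>R 2)"
    using continuous_on_homogenize[OF cont] u
    by (subst (asm) continuous_on_eq_continuous_at) auto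
  then have "(?F \<longlongrightarrow> ?F (u /\<^sub>R 2)) (nhds (u /\<^sub>R 2))"
    unfolding isCont_def by (subst (asm) tendsto_at_iff_tendsto_nhds)
  moreover have Fu: "?F (u /\<^sub>R 2) = f u" using u by simp
  ultimately have "(?F \<longlongrightarrow> f u) (nhds (u /\<^sub>R 2))" by (simp only:)
  then have "\<forall>\<^sub>F x in nhds (u /\<^sub>R 2). ?F x > f u / 2"
    by (rule order_tendstoD(1)) (use pos in linarith)
  moreover have "\<forall>\<^sub>F x in nhds (u /\<^sub>R 2). x \<in> ?S"
    using u by (intro eventually_nhds_in_open) auto
  ultimately have "\<forall>\<^sub>F x in nhds (u /\<^sub>R 2). ?F x > f u / 2 \<and> x \<in> ?S" by (rule eventually_conj)
  then obtain T where T: "open T" "u /\<^sub>R 2 \<in> T" "\<And>x. x \<in> T \<Longrightarrow> ?F x > f u / 2 \<and> x \<in> ?S"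
    unfolding eventually_nhds by blast
  then obtain a b where ab: "u /\<^sub>R 2 \<in> box a b" "cbox a b \<subseteq> T"
    using open_contains_cbox[of T "u /\<^sub>R 2"] by metis
  have ne: "box a b \<noteq> {}" using ab by auto
  have sub: "cbox a b \<subseteq> ?S" using T ab by blast
  have "(f u / 2) * measure lborel (cbox a b) = integral (cbox a b) (\<lambda>x. f u / 2)" by simp
  also have "\<dots> \<le> integral (cbox a b) ?F"
  proof (rule integral_le)
    show "?F integrable_on cbox a b"
      using sub by (intro integrable_continuous
          continuous_on_subset[OF continuous_on_homogenize[OF cont]]) auto
  qed (use T ab in \<open>auto intro: less_imp_le\<close>)
  also have "\<dots> \<le> integral ?S ?F"
  proof (rule integral_subset_le[OF sub _ integrable_homogenize[OF cont]])
    show "?F integrable_on cbox a b"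
      using sub by (intro integrable_continuous
          continuous_on_subset[OF continuous_on_homogenize[OF cont]]) auto
    show "\<forall>x\<in>?S. 0 \<le> ?F x" using nn by (metis Diff_iff insertI1 normalize_in_sphere)
  qed
  also have "\<dots> = 0" using 0 by (simp add: sph_int_eq_punctured)
  finally show False using pos content_pos_lt_eq[of a b] ne
    by (simp add: box_ne_empty mult_le_0_iff)
qed

lemma sph_int_tendsto:
  fixes f :: "nat \<Rightarrow> real^'n::finite \<Rightarrow> real"
  assumes cont: "\<And>m. continuous_on (sphere 0 1) (f m)"
    and bd: "\<And>m x. norm x = 1 \<Longrightarrow> \<bar>f m x\<bar> \<le> B"
    and lim: "\<And>x. norm x = 1 \<Longrightarrow> (\<lambda>m. f m x) \<longlonglongrightarrow> g x"
  shows "(\<lambda>m. sph_int (f m)) \<longlonglongrightarrow> sph_int g"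
  unfolding sph_int_eq_punctured
proof (intro tendsto_intros dominated_convergence(2)[where h = "\<lambda>x. B"])
  show "(\<lambda>x::real^'n. B) integrable_on ball 0 1 - {0}"
    using integrable_homogenize[of "\<lambda>x::real^'n. B"] by simp
qed (use assms in \<open>auto intro!: integrable_homogenize\<close>)

text \<open>Translation invariance makes the integral of every difference quotient zero. The
  quotients vanish outside \<open>cball 0 2\<close> and are uniformly bounded by the mean value
  inequality, so dominated convergence carries the zero over to the partial derivative.\<close>

lemma integral_partial_deriv_eq_0:
  fixes F :: "real^'n::finite \<Rightarrow> real"
  assumes der: "\<And>x. (F has_derivative (\<lambda>v. g x \<bullet> v)) (at x)"
    and cont: "continuous_on UNIV g" and supp: "\<And>x. norm x \<ge> 1 \<Longrightarrow> F x = 0"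
  shows "has_bochner_integral lborel (\<lambda>x. g x $ j) 0"
proof -
  let ?e = "axis j 1 :: real^'n"
  have contF: "continuous_on UNIV F"
    using der by (meson continuous_at_imp_continuous_on has_derivative_continuous)
  have supp0: "F x = 0" if "x \<notin> cball 0 1" for x using supp that by (auto simp: not_le less_imp_le)
  obtain C where C: "\<And>x. x \<in> cball 0 3 \<Longrightarrow> norm (g x) \<le> C"
    using compact_imp_bounded[OF compact_continuous_image[OF continuous_on_subset[OF cont subset_UNIV] compact_cball[of 0 3]]]
    unfolding bounded_iff by blast
  have intF: "integrable lborel F"
  proof -
    have "integrable lborel (\<lambda>x. indicator (cball 0 1) x *\<^sub>R F x)"
      by (intro borel_integrable_compact continuous_on_subset[OF contF]) auto
    also have "(\<lambda>x. indicator (cball 0 1) x *\<^sub>R F x) = F"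
      using supp0 by (auto simp: indicator_def fun_eq_iff)
    finally show ?thesis .
  qed
  have trans: "(\<integral>x. F (c + x) \<partial>lborel) = (\<integral>x. F x \<partial>lborel)" "integrable lborel (\<lambda>x. F (c + x))" for c
  proof -
    have d: "distr lborel borel ((+) c) = (lborel :: (real^'n) measure)"
      using lborel_distr_plus[of c] by simp
    have F: "F \<in> borel_measurable borel" using contF by (simp add: borel_measurable_continuous_onI)
    show "(\<integral>x. F (c + x) \<partial>lborel) = (\<integral>x. F x \<partial>lborel)"
      using integral_distr[of "(+) c" lborel borel F] F d by simp
    show "integrable lborel (\<lambda>x. F (c + x))"
      using integrable_distr_eq[of "(+) c" lborel borel F] F d intF by simp
  qed
  define q where "q m x = (F (inverse (real (Suc m)) *\<^sub>R ?e + x) - F x) / inverse (real (Suc m))" for m x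
  have q0: "(\<integral>x. q m x \<partial>lborel) = 0" for m
    unfolding q_def using trans intF by (simp del: of_nat_Suc)
  have lim: "(\<lambda>m. q m x) \<longlonglongrightarrow> g x $ j" for x
  proof -
    have "((\<lambda>t. F (x + t *\<^sub>R ?e)) has_derivative (\<lambda>t. g x \<bullet> (t *\<^sub>R ?e))) (at 0)"
      by (rule has_derivative_compose[of "\<lambda>t. x + t *\<^sub>R ?e" "\<lambda>t. t *\<^sub>R ?e", simplified])
         (auto intro!: derivative_eq_intros der)
    then have "((\<lambda>t. F (x + t *\<^sub>R ?e)) has_field_derivative g x $ j) (at 0)"
      by (simp add: has_field_derivative_def inner_axis mult.commute[of _ "g x $ j"])
    then have "((\<lambda>t. (F (x + t *\<^sub>R ?e) - F x) / t) \<longlongrightarrow> g x $ j) (at 0)"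
      by (simp add: DERIV_def)
    moreover have "filterlim (\<lambda>m. inverse (real (Suc m))) (at 0) sequentially"
      using LIMSEQ_inverse_real_of_nat by (auto simp: filterlim_at simp del: of_nat_Suc)
    ultimately show ?thesis
      unfolding q_def add.commute[of _ x] by (rule filterlim_compose)
  qed
  have bd: "norm (q m x) \<le> indicat_real (cball 0 2) x * C" for m x
  proof (cases "x \<in> cball 0 2")
    case False
    have "norm x \<le> norm (inverse (real (Suc m)) *\<^sub>R ?e + x) + norm (inverse (real (Suc m)) *\<^sub>R ?e)"
      by (metis add_diff_cancel_left' norm_triangle_ineq4)
    also have "norm (inverse (real (Suc m)) *\<^sub>R ?e) \<le> 1"
      by (simp add: norm_axis_1 field_simps)
    finally have "F (inverse (real (Suc m)) *\<^sub>R ?e + x) = 0" using False by (intro supp) auto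
    moreover have "F x = 0" using False by (intro supp) auto
    ultimately show ?thesis using False by (simp add: q_def)
  next
    case True
    let ?d = "inverse (real (Suc m)) *\<^sub>R ?e"
    have d: "norm ?d \<le> 1" by (simp add: norm_axis_1 field_simps)
    have "norm (F (?d + x) - F x) \<le> C * norm (?d + x - x)"
    proof (rule differentiable_bound[where S = "cball x 1"])
      fix y assume "y \<in> cball x 1"
      then have "norm y \<le> 3" using True norm_triangle_ineq[of x "y - x"] by (auto simp: dist_norm norm_minus_commute)
      then have "norm (g y) \<le> C" using C by auto
      then show "onorm ((\<bullet>) (g y)) \<le> C"
        by (intro onorm_bound) (auto intro: order_trans[OF norm_cauchy_schwarz] order_trans[OF Cauchy_Schwarz_ineq2] mult_right_mono order_trans[OF norm_ge_zero])
      show "(F has_derivative (\<bullet>) (g y)) (at y within cball x 1)"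
        using der by (rule has_derivative_at_withinI)
    qed (use d in \<open>auto simp: dist_norm\<close>)
    then have "\<bar>F (?d + x) - F x\<bar> \<le> C * inverse (real (Suc m))"
      by (simp add: norm_axis_1 del: of_nat_Suc)
    then show ?thesis using True
      by (simp add: q_def divide_simps abs_mult del: of_nat_Suc)
  qed
  have meas_g: "(\<lambda>x. g x $ j) \<in> borel_measurable lborel"
    using cont by (auto intro!: borel_measurable_continuous_onI continuous_intros)
  have int_w: "integrable lborel (\<lambda>x::real^'n. indicat_real (cball 0 2) x * C)"
    using emeasure_bounded_finite[OF bounded_cball[of "0::real^'n" 2]]
    by (intro integrable_mult_left integrable_real_indicator) simp_all
  have meas_q: "q m \<in> borel_measurable lborel" for m
    unfolding q_def using contF
    by (auto intro!: borel_measurable_continuous_onI continuous_intros intro: continuous_on_compose2)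
  have "integrable lborel (\<lambda>x. g x $ j)"
    by (rule integrable_dominated_convergence[where s = q, OF meas_g meas_q int_w]) (use lim bd in auto)
  moreover have "(\<lambda>m. \<integral>x. q m x \<partial>lborel) \<longlonglongrightarrow> (\<integral>x. g x $ j \<partial>lborel)"
    by (rule integral_dominated_convergence[where s = q, OF meas_g meas_q int_w]) (use lim bd in auto)
  ultimately show ?thesis using q0 by (simp add: LIMSEQ_const_iff has_bochner_integral_iff)
qed

section \<open>Functions with continuous gradient\<close>

text \<open>Functions on the sphere are treated through extensions to the space without the origin.
  Gradients are carried as explicit data rather than through \<open>grad\<close>, so that the rules
  below compose; in \<open>has_C2_grad\<close>, row j of \<open>G\<close> is the gradient of entry j
  of \<open>g\<close>.\<close>

definition has_C1_grad :: "(real^'n::finite \<Rightarrow> real) \<Rightarrow> (real^'n \<Rightarrow> real^'n) \<Rightarrow> bool" where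
  "has_C1_grad f g \<longleftrightarrow>
     (\<forall>x. x \<noteq> 0 \<longrightarrow> (f has_derivative (\<lambda>v. g x \<bullet> v)) (at x)) \<and> continuous_on (- {0}) g"

definition has_C2_grad ::
  "(real^'n::finite \<Rightarrow> real) \<Rightarrow> (real^'n \<Rightarrow> real^'n) \<Rightarrow> (real^'n \<Rightarrow> real^'n^'n) \<Rightarrow> bool" where
  "has_C2_grad f g G \<longleftrightarrow> has_C1_grad f g \<and> (\<forall>j. has_C1_grad (\<lambda>x. g x $ j) (\<lambda>x. G x $ j))"

lemma has_C1_gradD: "has_C1_grad f g \<Longrightarrow> x \<noteq> 0 \<Longrightarrow> (f has_derivative (\<lambda>v. g x \<bullet> v)) (at x)"
  and has_C1_grad_continuous_grad: "has_C1_grad f g \<Longrightarrow> continuous_on (- {0}) g"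
  by (auto simp: has_C1_grad_def)

lemma has_C1_gradI:
  "(\<And>x. x \<noteq> 0 \<Longrightarrow> (f has_derivative (\<lambda>v. g x \<bullet> v)) (at x)) \<Longrightarrow> continuous_on (- {0}) g \<Longrightarrow> has_C1_grad f g"
  by (auto simp: has_C1_grad_def)

lemma has_C2_gradD1: "has_C2_grad f g G \<Longrightarrow> has_C1_grad f g"
  and has_C2_gradD2: "has_C2_grad f g G \<Longrightarrow> has_C1_grad (\<lambda>x. g x $ j) (\<lambda>x. G x $ j)"
  by (auto simp: has_C2_grad_def)

lemma has_C1_grad_continuous: "has_C1_grad f g \<Longrightarrow> continuous_on (- {0}) f"
  by (intro continuous_at_imp_continuous_on ballI has_derivative_continuous[OF has_C1_gradD]) auto

lemma punctured_sphere_subset: "sphere 0 1 \<subseteq> - {0::'a::real_normed_vector}"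
  by auto

lemma has_C1_grad_continuous_sphere:
  "has_C1_grad f g \<Longrightarrow> continuous_on (sphere 0 1) f"
  "has_C1_grad f g \<Longrightarrow> continuous_on (sphere 0 1) g"
  using has_C1_grad_continuous has_C1_grad_continuous_grad punctured_sphere_subset
  by (blast intro: continuous_on_subset)+

lemma has_C1_grad_cong:
  assumes "has_C1_grad f g" "\<And>x. x \<noteq> 0 \<Longrightarrow> f' x = f x" "\<And>x. x \<noteq> 0 \<Longrightarrow> g' x = g x"
  shows "has_C1_grad f' g'"
proof (rule has_C1_gradI)
  fix x :: "real^'a" assume x: "x \<noteq> 0"
  have "(f' has_derivative (\<lambda>v. g x \<bullet> v)) (at x)"
    by (rule has_derivative_transform_within_open[OF has_C1_gradD[OF assms(1) x], of "- {0}"])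
       (use x assms(2) in auto)
  then show "(f' has_derivative (\<lambda>v. g' x \<bullet> v)) (at x)" using assms(3)[OF x] by simp
next
  show "continuous_on (- {0}) g'"
    using has_C1_grad_continuous_grad[OF assms(1)] assms(3) by (subst continuous_on_cong) auto
qed

lemma has_C1_grad_unique:
  assumes "has_C1_grad f g" "has_C1_grad f' g'" "\<And>y. y \<noteq> 0 \<Longrightarrow> f y = f' y" "x \<noteq> 0"
  shows "g x = g' x"
proof -
  have "has_C1_grad f' g" using assms(1) by (rule has_C1_grad_cong) (use assms(3) in auto)
  then have "(\<lambda>v. g x \<bullet> v) = (\<lambda>v. g' x \<bullet> v)"
    using has_derivative_unique has_C1_gradD assms(2,4) by blast
  then show ?thesis by (metis inner_commute vector_eq_rdot)
qed

lemma has_C1_grad_const [simp, intro]: "has_C1_grad (\<lambda>x. c) (\<lambda>x. 0)"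
  by (rule has_C1_gradI) auto

lemma has_C1_grad_component: "has_C1_grad (\<lambda>x. x $ i) (\<lambda>x. axis i 1)"
  by (rule has_C1_gradI) (auto simp: inner_axis' intro!: bounded_linear_imp_has_derivative bounded_linear_vec_nth)

lemma has_C1_grad_inner: "has_C1_grad (\<lambda>x. x \<bullet> v) (\<lambda>x. v)"
  by (rule has_C1_gradI) (auto simp: inner_commute intro!: derivative_eq_intros)

lemma has_C1_grad_add:
  assumes "has_C1_grad f g" "has_C1_grad f' g'"
  shows "has_C1_grad (\<lambda>x. f x + f' x) (\<lambda>x. g x + g' x)"
  using assms by (auto simp: has_C1_grad_def inner_add_left intro!: has_derivative_add continuous_on_add)

lemma has_C1_grad_mult:
  assumes "has_C1_grad f g" "has_C1_grad f' g'"
  shows "has_C1_grad (\<lambda>x. f x * f' x) (\<lambda>x. f x *\<^sub>R g' x + f' x *\<^sub>R g x)"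
proof (rule has_C1_gradI)
  fix x :: "real^'a" assume "x \<noteq> 0"
  then show "((\<lambda>x. f x * f' x) has_derivative (\<lambda>v. (f x *\<^sub>R g' x + f' x *\<^sub>R g x) \<bullet> v)) (at x)"
    by (auto intro!: derivative_eq_intros has_C1_gradD[OF assms(1)] has_C1_gradD[OF assms(2)]
        simp: inner_add_left algebra_simps)
qed (use assms in \<open>intro continuous_intros; auto dest: has_C1_grad_continuous has_C1_grad_continuous_grad\<close>)

lemma has_C1_grad_cmult:
  assumes "has_C1_grad f g"
  shows "has_C1_grad (\<lambda>x. c * f x) (\<lambda>x. c *\<^sub>R g x)"
  using has_C1_grad_mult[OF has_C1_grad_const[of c] assms] by simp

lemma has_C1_grad_diff:
  assumes "has_C1_grad f g" "has_C1_grad f' g'"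
  shows "has_C1_grad (\<lambda>x. f x - f' x) (\<lambda>x. g x - g' x)"
  using has_C1_grad_add[OF assms(1) has_C1_grad_cmult[OF assms(2), of "-1"]] by simp

lemma has_C1_grad_sum:
  assumes "finite I" "\<And>i. i \<in> I \<Longrightarrow> has_C1_grad (f i) (g i)"
  shows "has_C1_grad (\<lambda>x. \<Sum>i\<in>I. f i x) (\<lambda>x. \<Sum>i\<in>I. g i x)"
  using assms
proof (induction I rule: finite_induct)
  case (insert i I)
  then show ?case by (simp add: has_C1_grad_add)
qed auto

lemma has_C1_grad_compose_real:
  assumes "has_C1_grad f g"
    and "\<And>x. x \<noteq> 0 \<Longrightarrow> (\<phi> has_real_derivative \<phi>' (f x)) (at (f x))"
    and "continuous_on (- {0}) (\<lambda>x. \<phi>' (f x))"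
  shows "has_C1_grad (\<lambda>x. \<phi> (f x)) (\<lambda>x. \<phi>' (f x) *\<^sub>R g x)"
proof (rule has_C1_gradI)
  fix x :: "real^'a" assume x: "x \<noteq> 0"
  show "((\<lambda>x. \<phi> (f x)) has_derivative (\<lambda>v. (\<phi>' (f x) *\<^sub>R g x) \<bullet> v)) (at x)"
    using has_derivative_compose[OF has_C1_gradD[OF assms(1) x] assms(2)[OF x, unfolded has_field_derivative_def]]
    by simp
qed (use assms in \<open>intro continuous_intros; auto dest: has_C1_grad_continuous_grad\<close>)

lemma has_C1_grad_norm: "has_C1_grad norm (\<lambda>x. x /\<^sub>R norm x)"
proof (rule has_C1_gradI)
  fix x :: "real^'a" assume x: "x \<noteq> 0"
  have "(\<lambda>v. sgn x \<bullet> v) = (\<lambda>v. (x /\<^sub>R norm x) \<bullet> v)" by (simp add: sgn_div_norm)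
  then show "(norm has_derivative (\<lambda>v. (x /\<^sub>R norm x) \<bullet> v)) (at x)"
    using has_derivative_norm[OF x] by (simp add: inner_commute)
qed (rule continuous_on_normalize)

lemma has_C1_grad_powr:
  assumes "has_C1_grad f g" "\<And>x. x \<noteq> 0 \<Longrightarrow> f x > 0"
  shows "has_C1_grad (\<lambda>x. f x powr a) (\<lambda>x. (a * f x powr (a - 1)) *\<^sub>R g x)"
proof (rule has_C1_grad_compose_real[OF assms(1)])
  show "((\<lambda>t. t powr a) has_real_derivative a * f x powr (a - 1)) (at (f x))" if "x \<noteq> 0" for x
    using has_real_derivative_powr[OF assms(2)[OF that]] by simp
  show "continuous_on (- {0}) (\<lambda>x. a * f x powr (a - 1))"
    using has_C1_grad_continuous[OF assms(1)] assms(2)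
    by (intro continuous_intros) (auto simp: less_imp_neq[symmetric])
qed

lemma has_C1_grad_inverse:
  assumes "has_C1_grad f g" "\<And>x. x \<noteq> 0 \<Longrightarrow> f x > 0"
  shows "has_C1_grad (\<lambda>x. inverse (f x)) (\<lambda>x. (- inverse ((f x)\<^sup>2)) *\<^sub>R g x)"
proof (rule has_C1_grad_compose_real[OF assms(1)])
  show "(inverse has_real_derivative - inverse ((f x)\<^sup>2)) (at (f x))" if "x \<noteq> 0" for x
    using DERIV_inverse[of "f x"] assms(2)[OF that] by (simp add: power2_eq_square)
  show "continuous_on (- {0}) (\<lambda>x. - inverse ((f x)\<^sup>2))"
    using has_C1_grad_continuous[OF assms(1)] assms(2)
    by (intro continuous_intros) (auto simp: less_imp_neq[symmetric])
qed

text \<open>The derivative of x / |x| is 1 / |x| times the orthogonal projection along x, so only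
  the tangential part of the gradient survives.\<close>

lemma has_C1_grad_homogenize:
  assumes "has_C1_grad f g"
  shows "has_C1_grad (\<lambda>x. f (x /\<^sub>R norm x))
    (\<lambda>x. inverse (norm x) *\<^sub>R (g (x /\<^sub>R norm x) - ((x /\<^sub>R norm x) \<bullet> g (x /\<^sub>R norm x)) *\<^sub>R (x /\<^sub>R norm x)))"
proof (rule has_C1_gradI)
  fix x :: "real^'a" assume x: "x \<noteq> 0"
  let ?u = "x /\<^sub>R norm x"
  have 1: "((\<lambda>x. inverse (norm x)) has_derivative (\<lambda>v. (- inverse ((norm x)\<^sup>2) *\<^sub>R ?u) \<bullet> v)) (at x)"
    using has_C1_gradD[OF has_C1_grad_inverse[OF has_C1_grad_norm]] x by simp
  have "((\<lambda>x. x /\<^sub>R norm x) has_derivative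
      (\<lambda>v. inverse (norm x) *\<^sub>R v + ((- inverse ((norm x)\<^sup>2) *\<^sub>R ?u) \<bullet> v) *\<^sub>R x)) (at x)"
    by (rule has_derivative_scaleR[OF 1 has_derivative_ident])
  from has_derivative_compose[OF this has_C1_gradD[OF assms]] x
  have "((\<lambda>x. f (x /\<^sub>R norm x)) has_derivative
     (\<lambda>v. g ?u \<bullet> (inverse (norm x) *\<^sub>R v + ((- inverse ((norm x)\<^sup>2) *\<^sub>R ?u) \<bullet> v) *\<^sub>R x))) (at x)"
    by simp
  also have "(\<lambda>v. g ?u \<bullet> (inverse (norm x) *\<^sub>R v + ((- inverse ((norm x)\<^sup>2) *\<^sub>R ?u) \<bullet> v) *\<^sub>R x)) =
     (\<lambda>v. (inverse (norm x) *\<^sub>R (g ?u - (?u \<bullet> g ?u) *\<^sub>R ?u)) \<bullet> v)"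
    using x by (simp add: fun_eq_iff inner_add_right inner_diff_left inner_commute[of x "g _"] divide_simps power2_eq_square)
      (simp add: algebra_simps)
  finally show "((\<lambda>x. f (x /\<^sub>R norm x)) has_derivative
     (\<lambda>v. (inverse (norm x) *\<^sub>R (g ?u - (?u \<bullet> g ?u) *\<^sub>R ?u)) \<bullet> v)) (at x)" .
next
  have "continuous_on (- {0}) (\<lambda>x. g (x /\<^sub>R norm x))"
    by (rule continuous_on_compose2[OF has_C1_grad_continuous_grad[OF assms] continuous_on_normalize]) auto
  then show "continuous_on (- {0}) (\<lambda>x. inverse (norm x) *\<^sub>R
      (g (x /\<^sub>R norm x) - ((x /\<^sub>R norm x) \<bullet> g (x /\<^sub>R norm x)) *\<^sub>R (x /\<^sub>R norm x)))"
    by (intro continuous_intros continuous_on_normalize) auto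
qed

text \<open>A function that vanishes near the origin has a gradient that vanishes there too, so
  extending the gradient by 0 keeps it continuous on the whole space.\<close>

lemma integral_partial_deriv_eq_0_punctured:
  fixes F :: "real^'n::finite \<Rightarrow> real"
  assumes F: "has_C1_grad F g" and supp: "\<And>x. norm x \<ge> 1 \<Longrightarrow> F x = 0"
    and "e > 0" and near: "\<And>x. norm x < e \<Longrightarrow> F x = 0"
  shows "has_bochner_integral lborel (\<lambda>x. (if x = 0 then 0 else g x) $ j) 0"
proof (rule integral_partial_deriv_eq_0)
  let ?g = "\<lambda>x. if x = 0 then 0 else g x"
  have 0: "?g x = 0" if "norm x < e" for x
  proof (cases "x = 0")
    case False
    have "(F has_derivative (\<lambda>v. 0)) (at x)"
      by (rule has_derivative_transform_within_open[of "\<lambda>x. 0" _ _ _ "ball 0 e"])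
         (use that near in auto)
    from has_derivative_unique[OF this has_C1_gradD[OF F False]]
    have "g x \<bullet> g x = 0" by metis
    then show ?thesis by simp
  qed simp
  show "(F has_derivative (\<lambda>v. ?g x \<bullet> v)) (at x)" for x
  proof (cases "x = 0")
    case True
    have "(F has_derivative (\<lambda>v. 0)) (at x)"
      by (rule has_derivative_transform_within_open[of "\<lambda>x. 0" _ _ _ "ball 0 e"])
         (use \<open>e > 0\<close> True near in auto)
    then show ?thesis using True by simp
  qed (use has_C1_gradD[OF F] in simp)
  have "continuous_on (- {0} \<union> ball 0 e) ?g"
  proof (rule continuous_on_open_Un)
    show "continuous_on (- {0}) ?g"
      using has_C1_grad_continuous_grad[OF F] by (subst continuous_on_cong) auto
    show "continuous_on (ball 0 e) ?g"
      by (subst continuous_on_cong[OF refl, of _ _ "\<lambda>x. 0"]) (use 0 in auto)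
  qed auto
  moreover have "- {0} \<union> ball 0 e = (UNIV :: (real^'n) set)" using \<open>e > 0\<close> by auto
  ultimately show "continuous_on UNIV ?g" by simp
qed (use supp in auto)

text \<open>The squared positive part is a C^1 function with an elementary derivative; it is the
  building block of the radial cutoffs below.\<close>

lemma DERIV_max_0_power2: "((\<lambda>y. (max 0 y)\<^sup>2) has_real_derivative 2 * max 0 y) (at y)"
  unfolding DERIV_def
proof (rule Lim_null_comparison[where g = "\<lambda>h. \<bar>h\<bar>", THEN LIM_zero_cancel])
  show "\<forall>\<^sub>F h in at 0. norm (((max 0 (y + h))\<^sup>2 - (max 0 y)\<^sup>2) / h - 2 * max 0 y) \<le> \<bar>h\<bar>"
    unfolding eventually_at_filter
  proof (intro always_eventually allI impI)
    fix h :: real assume h: "h \<noteq> 0"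
    have "\<bar>(max 0 (y + h))\<^sup>2 - (max 0 y)\<^sup>2 - 2 * max 0 y * h\<bar> \<le> h\<^sup>2"
    proof -
      consider "y \<ge> 0" "y + h \<ge> 0" | "y \<ge> 0" "y + h < 0" | "y < 0" "y + h \<ge> 0" | "y < 0" "y + h < 0"
        by linarith
      then show ?thesis
      proof cases
        case 2
        have "(y + h) * (y + h) \<ge> 0" by simp
        moreover have "0 \<le> y * (- (y + 2 * h))" using 2 by (intro mult_nonneg_nonneg) linarith+
        ultimately show ?thesis using 2 by (simp add: max_def power2_eq_square algebra_simps abs_if)
      next
        case 3
        have "(y + h)\<^sup>2 \<le> h\<^sup>2" using 3 by (intro power_mono) auto
        then show ?thesis using 3 by (simp add: max_def)
      qed (auto simp: max_def power2_eq_square algebra_simps)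
    qed
    then have "\<bar>(max 0 (y + h))\<^sup>2 - (max 0 y)\<^sup>2 - 2 * max 0 y * h\<bar> / \<bar>h\<bar> \<le> h\<^sup>2 / \<bar>h\<bar>"
      by (intro divide_right_mono) auto
    also have "h\<^sup>2 / \<bar>h\<bar> = \<bar>h\<bar>" using h by (simp add: power2_eq_square abs_if)
    also have "\<bar>(max 0 (y + h))\<^sup>2 - (max 0 y)\<^sup>2 - 2 * max 0 y * h\<bar> / \<bar>h\<bar> =
      norm (((max 0 (y + h))\<^sup>2 - (max 0 y)\<^sup>2) / h - 2 * max 0 y)"
      using h by (simp add: abs_divide[symmetric] diff_divide_distrib)
    finally show "norm (((max 0 (y + h))\<^sup>2 - (max 0 y)\<^sup>2) / h - 2 * max 0 y) \<le> \<bar>h\<bar>" .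
  qed
qed (auto intro!: tendsto_eq_intros)

text \<open>A radial cutoff is annihilated by the rotation field \<open>x\<^sub>i \<partial>\<^sub>j - x\<^sub>j \<partial>\<^sub>i\<close>, so the
  divergence theorem in the full space can be applied to cutoffs that exhaust the punctured ball.\<close>

lemma sph_int_rotation_field:
  fixes f :: "real^'n::finite \<Rightarrow> real"
  assumes f: "has_C1_grad f g"
  shows "sph_int (\<lambda>x. x $ i * g x $ j - x $ j * g x $ i) = 0"
proof -
  let ?q = "\<lambda>x. x $ i * g x $ j - x $ j * g x $ i"
  let ?S = "ball 0 1 - {0::real^'n}"
  have contq: "continuous_on (sphere 0 1) ?q"
    using has_C1_grad_continuous_sphere(2)[OF f] by (intro continuous_intros)
  define a where "a m = 1 / real (m + 2)" for m :: nat
  have a: "0 < a m" "a m < 1" for m by (auto simp: a_def)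
  \<comment> \<open>The variable s stands for |x|^2. For s \<ge> 0 the function
    \<open>\<sigma> m\<close> takes values in [0, 1], and it vanishes unless a m < s < 1. Raising 1
    - \<sigma> to the power m sends it to 0 wherever \<sigma> stays bounded below, so the C^1
    cutoffs \<open>\<psi> m\<close> tend to 1 on (0, 1).\<close>
  define \<sigma> where "\<sigma> m s = (max 0 ((s - a m) * (1 - s)))\<^sup>2" for m s
  define \<psi> where "\<psi> m s = 1 - (1 - \<sigma> m s) ^ m" for m :: nat and s
  have \<sigma>_range: "0 \<le> \<sigma> m s" "\<sigma> m s \<le> 1" if "0 \<le> s" for m s
  proof -
    have "(s - a m) * (1 - s) \<le> 1"
    proof (cases "s \<le> 1")
      case True
      have "(s - a m) * (1 - s) \<le> 1 * (1 - s)"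
        using True a[of m] that by (intro mult_right_mono) linarith+
      then show ?thesis using that by simp
    next
      case False
      then have "(s - a m) * (1 - s) \<le> 0" using a[of m] by (intro mult_nonneg_nonpos) linarith+
      then show ?thesis by simp
    qed
    then have "max 0 ((s - a m) * (1 - s)) \<le> 1" by simp
    then show "\<sigma> m s \<le> 1" unfolding \<sigma>_def by (intro power_le_one) auto
  qed (simp add: \<sigma>_def)
  have \<psi>_range: "\<bar>\<psi> m s\<bar> \<le> 1" if "0 \<le> s" for m s
    using \<sigma>_range[OF that, of m] power_le_one[of "1 - \<sigma> m s" m] zero_le_power[of "1 - \<sigma> m s" m]
    unfolding \<psi>_def abs_le_iff by linarith
  have \<psi>_0: "\<psi> m s = 0" if "s \<le> a m \<or> s \<ge> 1" for m s
  proof -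
    have "(s - a m) * (1 - s) \<le> 0"
      using that a[of m] by (auto simp: mult_le_0_iff)
    then show ?thesis by (simp add: \<psi>_def \<sigma>_def max_def)
  qed
  have \<psi>_lim: "(\<lambda>m. \<psi> m s) \<longlonglongrightarrow> 1" if "0 < s" "s < 1" for s
  proof -
    define c where "c = (s / 2 * (1 - s))\<^sup>2"
    have c: "0 < c" using that by (simp add: c_def)
    have "\<forall>\<^sub>F m in sequentially. a m < s / 2"
    proof -
      have "a \<longlonglongrightarrow> 0" unfolding a_def
        using LIMSEQ_ignore_initial_segment[OF lim_inverse_n', of 2] by simp
      then show ?thesis using that by (intro order_tendstoD) auto
    qed
    then have ev: "\<forall>\<^sub>F m in sequentially. norm ((1 - \<sigma> m s) ^ m) \<le> (1 - c) ^ m"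
    proof eventually_elim
      case (elim m)
      have "s / 2 * (1 - s) \<le> (s - a m) * (1 - s)"
        using that elim by (intro mult_right_mono) linarith+
      then have "c \<le> \<sigma> m s" unfolding c_def \<sigma>_def
        using that by (intro power_mono) auto
      then show ?case using \<sigma>_range[of s m] that
        by (simp add: power_mono)
    qed
    have "c \<le> 1"
    proof -
      have "s / 2 * (1 - s) \<le> 1 * 1" using that by (intro mult_mono) linarith+
      then show ?thesis unfolding c_def using that by (intro power_le_one) auto
    qed
    then have "(\<lambda>m. (1 - c) ^ m) \<longlonglongrightarrow> 0" using c by (intro LIMSEQ_realpow_zero) auto
    then have "(\<lambda>m. (1 - \<sigma> m s) ^ m) \<longlonglongrightarrow> 0" by (rule Lim_null_comparison[OF ev])
    then show ?thesis unfolding \<psi>_def by (auto intro!: tendsto_eq_intros)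
  qed
  define \<psi>' where "\<psi>' m s = real m * (1 - \<sigma> m s) ^ (m - 1) *
      (2 * max 0 ((s - a m) * (1 - s)) * ((1 - s) - (s - a m)))" for m s
  have der\<psi>: "(\<psi> m has_real_derivative \<psi>' m s) (at s)" for m s
  proof -
    have "((\<lambda>s. (s - a m) * (1 - s)) has_real_derivative ((1 - s) - (s - a m))) (at s)"
      by (auto intro!: derivative_eq_intros)
    from DERIV_chain2[OF DERIV_max_0_power2 this]
    have "(\<sigma> m has_real_derivative 2 * max 0 ((s - a m) * (1 - s)) * ((1 - s) - (s - a m))) (at s)"
      unfolding \<sigma>_def .
    then show ?thesis unfolding \<psi>_def \<psi>'_def
      by (auto intro!: derivative_eq_intros)
  qed
  have cont\<psi>: "continuous_on UNIV (\<psi> m)" for m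
    using der\<psi> by (meson DERIV_isCont continuous_at_imp_continuous_on)
  have cont\<psi>': "continuous_on UNIV (\<psi>' m)" for m
    unfolding \<psi>'_def \<sigma>_def by (intro continuous_intros)
  have key: "(\<integral>x. indicat_real ?S x *\<^sub>R (\<psi> m (x \<bullet> x) * ?q (x /\<^sub>R norm x)) \<partial>lborel) = 0" for m
  proof -
    let ?h = "\<lambda>x. inverse (norm x) *\<^sub>R (g (x /\<^sub>R norm x) - ((x /\<^sub>R norm x) \<bullet> g (x /\<^sub>R norm x)) *\<^sub>R (x /\<^sub>R norm x))"
    define F where "F = (\<lambda>x::real^'n. \<psi> m (x \<bullet> x) * f (x /\<^sub>R norm x))"
    define G where "G = (\<lambda>x::real^'n. \<psi> m (x \<bullet> x) *\<^sub>R ?h x + f (x /\<^sub>R norm x) *\<^sub>R (\<psi>' m (x \<bullet> x) *\<^sub>R (2 *\<^sub>R x)))"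
    have 1: "has_C1_grad (\<lambda>x::real^'n. x \<bullet> x) (\<lambda>x. 2 *\<^sub>R x)"
      by (rule has_C1_gradI) (auto intro!: derivative_eq_intros continuous_intros simp: inner_commute)
    have 2: "has_C1_grad (\<lambda>x::real^'n. \<psi> m (x \<bullet> x)) (\<lambda>x. \<psi>' m (x \<bullet> x) *\<^sub>R (2 *\<^sub>R x))"
      by (rule has_C1_grad_compose_real[OF 1 der\<psi>])
         (intro continuous_on_compose2[OF cont\<psi>'] continuous_intros, auto)
    have F: "has_C1_grad F G"
      unfolding F_def G_def by (rule has_C1_grad_mult[OF 2 has_C1_grad_homogenize[OF f]])
    have F0: "F x = 0" if "norm x \<ge> 1 \<or> norm x < sqrt (a m)" for x
    proof -
      have "x \<bullet> x \<le> a m \<or> x \<bullet> x \<ge> 1"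
        using that a[of m] by (auto simp: dot_square_norm real_less_rsqrt less_imp_le abs_square_less_1
            not_le[symmetric] power_mono_iff) (metis less_eq_real_def norm_ge_zero real_less_rsqrt real_sqrt_less_iff real_sqrt_abs abs_of_nonneg not_le)+
      then show ?thesis by (simp add: F_def \<psi>_0)
    qed
    \<comment> \<open>The partial derivative of x_k F in direction l. In the difference of the cases
      (i, j) and (j, i) the Kronecker terms cancel, and so do all parts of G proportional to x, that
      is, those from the cutoff and from the radial projection.\<close>
    have xF: "has_bochner_integral lborel (\<lambda>x. (if x = 0 then 0 else x $ k *\<^sub>R G x + F x *\<^sub>R axis k 1) $ l) 0" for k l
      by (rule integral_partial_deriv_eq_0_punctured[OF has_C1_grad_mult[OF has_C1_grad_component F], where e = "sqrt (a m)"])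
         (use F0 a in auto)
    let ?I = "\<lambda>k l x. (if x = 0 then 0 else x $ k *\<^sub>R G x + F x *\<^sub>R axis k 1) $ l"
    have "(\<integral>x. indicat_real ?S x *\<^sub>R (\<psi> m (x \<bullet> x) * ?q (x /\<^sub>R norm x)) \<partial>lborel) =
      (\<integral>x. ?I i j x - ?I j i x \<partial>lborel)"
    proof (rule Bochner_Integration.integral_cong[OF refl])
      fix x :: "real^'n"
      have d: "axis i (1::real) $ j = axis j 1 $ i" by (auto simp: axis_def)
      show "indicat_real ?S x *\<^sub>R (\<psi> m (x \<bullet> x) * ?q (x /\<^sub>R norm x)) = ?I i j x - ?I j i x"
      proof (cases "x = 0")
        case False
        have "x \<notin> ?S \<Longrightarrow> \<psi> m (x \<bullet> x) = 0"
          using False by (intro \<psi>_0) (simp add: dot_square_norm)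
        then have "indicat_real ?S x *\<^sub>R (\<psi> m (x \<bullet> x) * ?q (x /\<^sub>R norm x)) = \<psi> m (x \<bullet> x) * ?q (x /\<^sub>R norm x)"
          by (auto simp: indicator_def)
        also have "\<dots> = ?I i j x - ?I j i x"
          using False d by (simp add: G_def algebra_simps)
        finally show ?thesis .
      qed simp
    qed
    also have "\<dots> = 0"
      using has_bochner_integral_diff[OF xF[of i j] xF[of j i]] by (simp add: has_bochner_integral_iff)
    finally show ?thesis .
  qed
  have "(\<lambda>m. \<integral>x. indicat_real ?S x *\<^sub>R (\<psi> m (x \<bullet> x) * ?q (x /\<^sub>R norm x)) \<partial>lborel)
      \<longlonglongrightarrow> (\<integral>x. indicat_real ?S x *\<^sub>R ?q (x /\<^sub>R norm x) \<partial>lborel)"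
  proof (rule integral_dominated_convergence[where w = "\<lambda>x. \<bar>indicat_real ?S x *\<^sub>R ?q (x /\<^sub>R norm x)\<bar>"])
    have i: "integrable lborel (\<lambda>x. indicat_real ?S x *\<^sub>R ?q (x /\<^sub>R norm x))"
      using set_integrable_homogenize[OF contq] by (simp add: set_integrable_def)
    then show "integrable lborel (\<lambda>x. \<bar>indicat_real ?S x *\<^sub>R ?q (x /\<^sub>R norm x)\<bar>)" by simp
    show m: "(\<lambda>x. indicat_real ?S x *\<^sub>R ?q (x /\<^sub>R norm x)) \<in> borel_measurable lborel"
      using i by auto
    show "(\<lambda>x. indicat_real ?S x *\<^sub>R (\<psi> m (x \<bullet> x) * ?q (x /\<^sub>R norm x))) \<in> borel_measurable lborel" for m
    proof -
      have "(\<lambda>x. \<psi> m (x \<bullet> x)) \<in> borel_measurable lborel"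
        using cont\<psi>[of m]
        by (auto intro!: borel_measurable_continuous_onI continuous_on_compose2[OF cont\<psi>] continuous_intros)
      from borel_measurable_times[OF this m] show ?thesis by (simp add: mult_ac)
    qed
    show "AE x in lborel. (\<lambda>m. indicat_real ?S x *\<^sub>R (\<psi> m (x \<bullet> x) * ?q (x /\<^sub>R norm x)))
        \<longlonglongrightarrow> indicat_real ?S x *\<^sub>R ?q (x /\<^sub>R norm x)"
    proof (intro always_eventually allI)
      fix x :: "real^'n"
      show "(\<lambda>m. indicat_real ?S x *\<^sub>R (\<psi> m (x \<bullet> x) * ?q (x /\<^sub>R norm x)))
        \<longlonglongrightarrow> indicat_real ?S x *\<^sub>R ?q (x /\<^sub>R norm x)"
      proof (cases "x \<in> ?S")
        case True
        then have "(\<lambda>m. \<psi> m (x \<bullet> x)) \<longlonglongrightarrow> 1"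
          by (intro \<psi>_lim) (auto simp: dot_square_norm abs_square_less_1)
        from tendsto_mult[OF this tendsto_const[of "?q (x /\<^sub>R norm x)"]] show ?thesis
          using True by simp
      qed simp
    qed
    show "AE x in lborel. norm (indicat_real ?S x *\<^sub>R (\<psi> m (x \<bullet> x) * ?q (x /\<^sub>R norm x)))
        \<le> \<bar>indicat_real ?S x *\<^sub>R ?q (x /\<^sub>R norm x)\<bar>" for m
    proof (intro always_eventually allI)
      fix x :: "real^'n"
      have "\<bar>\<psi> m (x \<bullet> x)\<bar> * \<bar>?q (x /\<^sub>R norm x)\<bar> \<le> 1 * \<bar>?q (x /\<^sub>R norm x)\<bar>"
        by (intro mult_right_mono \<psi>_range) auto
      then show "norm (indicat_real ?S x *\<^sub>R (\<psi> m (x \<bullet> x) * ?q (x /\<^sub>R norm x)))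
        \<le> \<bar>indicat_real ?S x *\<^sub>R ?q (x /\<^sub>R norm x)\<bar>"
        by (simp only: real_norm_def real_scaleR_def abs_mult mult_1) (auto simp: indicator_def)
    qed
  qed
  then have "(\<integral>x. indicat_real ?S x *\<^sub>R ?q (x /\<^sub>R norm x) \<partial>lborel) = 0"
    unfolding key by (simp add: LIMSEQ_const_iff)
  then show ?thesis by (simp add: sph_int_eq_lborel[OF contq])
qed

text \<open>The divergence theorem for the tangential gradient, n - 1 being the mean curvature of
  the sphere. It is the sum over i of the rotation identities in the (i, k) planes, applied to x_i
  f.\<close>

lemma sph_int_divergence:
  fixes f :: "real^'n::finite \<Rightarrow> real"
  assumes f: "has_C1_grad f g"
  shows "sph_int (\<lambda>x. g x $ k - x $ k * (x \<bullet> g x)) = (real CARD('n) - 1) * sph_int (\<lambda>x. x $ k * f x)"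
proof -
  note cf = has_C1_grad_continuous_sphere[OF f]
  let ?D = "\<lambda>i x. x $ i * (x $ i *\<^sub>R g x + f x *\<^sub>R axis i 1) $ k - x $ k * (x $ i *\<^sub>R g x + f x *\<^sub>R axis i 1) $ i"
  have "sph_int (?D i) = 0" for i
    by (rule sph_int_rotation_field[OF has_C1_grad_mult[OF has_C1_grad_component f]])
  then have "0 = (\<Sum>i\<in>UNIV. sph_int (?D i))"
    by (simp only: sum.neutral_const)
  also have "\<dots> = sph_int (\<lambda>x. \<Sum>i\<in>UNIV. ?D i x)"
    using cf by (intro sph_int_sum[symmetric] continuous_intros) auto
  also have "\<dots> = sph_int (\<lambda>x. (g x $ k - x $ k * (x \<bullet> g x)) - (real CARD('n) - 1) * (x $ k * f x))"
  proof (rule sph_int_cong)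
    fix x :: "real^'n" assume x: "norm x = 1"
    have 1: "(\<Sum>i\<in>UNIV. x $ i * x $ i) = 1"
      using x by (simp add: norm_eq_1 inner_vec_def)
    have "(\<Sum>i\<in>UNIV. ?D i x) = (\<Sum>i\<in>UNIV. (x $ i * x $ i) * g x $ k + (if i = k then x $ i * f x else 0)
        - x $ k * (x $ i * g x $ i) - x $ k * f x)"
      by (intro sum.cong) (auto simp: axis_def algebra_simps)
    also have "\<dots> = g x $ k + x $ k * f x - x $ k * (x \<bullet> g x) - real CARD('n) * (x $ k * f x)"
      by (simp add: sum.distrib sum_subtractf sum_distrib_right[symmetric] sum_distrib_left[symmetric] 1 inner_vec_def)
    finally show "(\<Sum>i\<in>UNIV. ?D i x) = (g x $ k - x $ k * (x \<bullet> g x)) - (real CARD('n) - 1) * (x $ k * f x)"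
      by (simp add: algebra_simps)
  qed
  also have "\<dots> = sph_int (\<lambda>x. g x $ k - x $ k * (x \<bullet> g x)) - (real CARD('n) - 1) * sph_int (\<lambda>x. x $ k * f x)"
    using cf by (subst sph_int_diff) (auto intro!: continuous_intros simp: sph_int_mult_left)
  finally show ?thesis by simp
qed

section \<open>Homogeneous functions and the Piola identity\<close>

definition homogeneous :: "real \<Rightarrow> (real^'n::finite \<Rightarrow> real) \<Rightarrow> bool" where
  "homogeneous d f \<longleftrightarrow> (\<forall>x t. x \<noteq> 0 \<longrightarrow> t > 0 \<longrightarrow> f (t *\<^sub>R x) = t powr d * f x)"

lemma homogeneousD: "homogeneous d f \<Longrightarrow> x \<noteq> 0 \<Longrightarrow> t > 0 \<Longrightarrow> f (t *\<^sub>R x) = t powr d * f x"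
  by (simp add: homogeneous_def)

lemma homogeneous_euler:
  assumes f: "has_C1_grad f g" and hom: "homogeneous d f" and x: "x \<noteq> 0"
  shows "x \<bullet> g x = d * f x"
proof -
  have "((\<lambda>t::real. t *\<^sub>R x) has_derivative (\<lambda>t. t *\<^sub>R x)) (at 1)"
    by (auto intro!: derivative_eq_intros)
  from has_derivative_compose[OF this, of f "\<lambda>v. g x \<bullet> v"] has_C1_gradD[OF f x]
  have 1: "((\<lambda>t. f (t *\<^sub>R x)) has_real_derivative g x \<bullet> x) (at 1)"
    by (simp add: has_field_derivative_def mult.commute[of _ "g x \<bullet> x"])
  have "((\<lambda>t. t powr d * f x) has_real_derivative d * f x) (at 1)"
    by (auto intro!: derivative_eq_intros)
  then have 2: "((\<lambda>t. f (t *\<^sub>R x)) has_real_derivative d * f x) (at 1)"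
    by (rule has_field_derivative_transform_within_open[of _ _ _ "{0<..}"])
       (use homogeneousD[OF hom x] in auto)
  show ?thesis using DERIV_unique[OF 1 2] by (simp add: inner_commute)
qed

lemma homogeneous_grad:
  assumes f: "has_C1_grad f g" and hom: "homogeneous d f"
  shows "homogeneous (d - 1) (\<lambda>x. g x $ j)"
  unfolding homogeneous_def
proof (intro allI impI)
  fix x :: "real^'a" and t :: real assume x: "x \<noteq> 0" and t: "t > 0"
  have tx: "t *\<^sub>R x \<noteq> 0" using x t by simp
  have "((\<lambda>y. t *\<^sub>R y) has_derivative (\<lambda>v. t *\<^sub>R v)) (at x)"
    by (auto intro!: derivative_eq_intros)
  from has_derivative_compose[OF this has_C1_gradD[OF f tx]]
  have 1: "((\<lambda>y. f (t *\<^sub>R y)) has_derivative (\<lambda>v. g (t *\<^sub>R x) \<bullet> (t *\<^sub>R v))) (at x)" .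
  have "((\<lambda>y. t powr d * f y) has_derivative (\<lambda>v. t powr d * (g x \<bullet> v))) (at x)"
    using has_C1_gradD[OF f x] by (auto intro!: derivative_eq_intros)
  then have 2: "((\<lambda>y. f (t *\<^sub>R y)) has_derivative (\<lambda>v. t powr d * (g x \<bullet> v))) (at x)"
    by (rule has_derivative_transform_within_open[of _ _ _ _ "- {0}"])
       (use homogeneousD[OF hom _ t] x in auto)
  have "g (t *\<^sub>R x) \<bullet> (t *\<^sub>R axis j 1) = t powr d * (g x \<bullet> axis j 1)"
    using has_derivative_unique[OF 1 2] by metis
  then show "g (t *\<^sub>R x) $ j = t powr (d - 1) * g x $ j"
    using t by (simp add: inner_axis powr_diff field_simps)
qed

lemma homogeneous_mult:
  "homogeneous d f \<Longrightarrow> homogeneous e f' \<Longrightarrow> homogeneous (d + e) (\<lambda>x. f x * f' x)"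
  by (simp add: homogeneous_def powr_add)

lemma homogeneous_powr:
  "homogeneous d f \<Longrightarrow> (\<And>x. x \<noteq> 0 \<Longrightarrow> f x > 0) \<Longrightarrow> homogeneous (d * e) (\<lambda>x. f x powr e)"
  by (simp add: homogeneous_def powr_mult powr_powr)

lemma homogeneous_const: "homogeneous 0 (\<lambda>x. c)"
  by (simp add: homogeneous_def)

lemma homogeneous_sum:
  "(\<And>i. i \<in> I \<Longrightarrow> homogeneous d (f i)) \<Longrightarrow> homogeneous d (\<lambda>x. \<Sum>i\<in>I. f i x)"
  by (simp add: homogeneous_def sum_distrib_left)

text \<open>The mean value theorem in direction u turns the mixed second difference into an
  increment of g, and g is linearized at the single point x. As the quotient is symmetric in u and
  v, its limit yields the symmetry of the Hessian.\<close>

lemma second_derivative_quotient_aux: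
  fixes f :: "real^'n::finite \<Rightarrow> real"
  assumes U: "open U" "x \<in> U"
    and f: "\<And>y. y \<in> U \<Longrightarrow> (f has_derivative (\<lambda>v. g y \<bullet> v)) (at y)"
    and g: "(g has_derivative A) (at x)"
  shows "((\<lambda>t. (f (x + t *\<^sub>R u + t *\<^sub>R v) - f (x + t *\<^sub>R u) - f (x + t *\<^sub>R v) + f x) / t\<^sup>2) \<longlongrightarrow> A v \<bullet> u)
           (at_right 0)"
proof (rule tendstoI)
  fix \<epsilon> :: real assume \<epsilon>: "\<epsilon> > 0"
  define C where "C = (2 * norm u + norm v) * norm u + 1"
  have C: "C > 0" unfolding C_def by (simp add: add_nonneg_pos)
  define e where "e = \<epsilon> / (2 * C)"
  have e: "e > 0" using \<epsilon> C by (simp add: e_def)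
  interpret A: bounded_linear A using g by (rule has_derivative_bounded_linear)
  obtain \<delta> where \<delta>: "\<delta> > 0" "\<And>y. norm (y - x) < \<delta> \<Longrightarrow> norm (g y - g x - A (y - x)) \<le> e * norm (y - x)"
    using g e unfolding has_derivative_at_alt by metis
  obtain r where r: "r > 0" "ball x r \<subseteq> U" using U open_contains_ball by blast
  define D where "D = norm u + norm v + 1"
  have D: "D > 0" unfolding D_def by (simp add: add_nonneg_pos)
  show "\<forall>\<^sub>F t in at_right 0. dist ((f (x + t *\<^sub>R u + t *\<^sub>R v) - f (x + t *\<^sub>R u) - f (x + t *\<^sub>R v) + f x) / t\<^sup>2) (A v \<bullet> u) < \<epsilon>"
    unfolding eventually_at_right_field
  proof (intro exI conjI allI impI)
    show "0 < min \<delta> r / D" using \<delta> r D by simp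
    fix t assume t: "0 < t" "t < min \<delta> r / D"
    then have tD: "t * D < \<delta>" "t * D < r" using D by (auto simp: field_simps)
    have small: "norm (s *\<^sub>R u + c *\<^sub>R v) < \<delta>" "norm (s *\<^sub>R u + c *\<^sub>R v) < r"
      if "0 \<le> s" "s \<le> t" "0 \<le> c" "c \<le> t" for s c
    proof -
      have "norm (s *\<^sub>R u + c *\<^sub>R v) \<le> s * norm u + c * norm v"
        using that norm_triangle_ineq[of "s *\<^sub>R u" "c *\<^sub>R v"] by simp
      also have "\<dots> \<le> t * norm u + t * norm v"
        using that by (intro add_mono mult_right_mono) auto
      also have "\<dots> \<le> t * D" using t by (simp add: D_def algebra_simps)
      finally show "norm (s *\<^sub>R u + c *\<^sub>R v) < \<delta>" "norm (s *\<^sub>R u + c *\<^sub>R v) < r" using tD by auto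
    qed
    \<comment> \<open>The mixed second difference is \<open>\<phi> t - \<phi> 0\<close>.\<close>
    define \<phi> where "\<phi> s = f (x + s *\<^sub>R u + t *\<^sub>R v) - f (x + s *\<^sub>R u)" for s
    have der: "(\<phi> has_real_derivative (g (x + s *\<^sub>R u + t *\<^sub>R v) - g (x + s *\<^sub>R u)) \<bullet> u) (at s)"
      if "0 \<le> s" "s \<le> t" for s
    proof -
      have "x + s *\<^sub>R u + c *\<^sub>R v \<in> U" if "0 \<le> c" "c \<le> t" for c
      proof -
        have "x + (s *\<^sub>R u + c *\<^sub>R v) \<in> ball x r"
          using small(2)[of s c] \<open>0 \<le> s\<close> \<open>s \<le> t\<close> that
          by (metis mem_ball dist_norm norm_minus_commute add_diff_cancel_left')
        then show ?thesis using r(2) by (auto simp: add.assoc)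
      qed
      then have *: "((\<lambda>s. f (x + s *\<^sub>R u + c *\<^sub>R v)) has_derivative (\<lambda>h. g (x + s *\<^sub>R u + c *\<^sub>R v) \<bullet> (h *\<^sub>R u))) (at s)"
        if "0 \<le> c" "c \<le> t" for c
        using that by (intro has_derivative_compose[OF _ f]) (auto intro!: derivative_eq_intros)
      have "((\<lambda>s. f (x + s *\<^sub>R u + t *\<^sub>R v) - f (x + s *\<^sub>R u)) has_derivative
          (\<lambda>h. g (x + s *\<^sub>R u + t *\<^sub>R v) \<bullet> (h *\<^sub>R u) - g (x + s *\<^sub>R u) \<bullet> (h *\<^sub>R u))) (at s)"
        using has_derivative_diff[OF *[of t] *[of 0]] t by simp
      then show ?thesis unfolding \<phi>_def has_field_derivative_def
        by (rule has_derivative_eq_rhs) (simp add: fun_eq_iff inner_diff_left algebra_simps)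
    qed
    obtain \<xi> where \<xi>: "0 < \<xi>" "\<xi> < t"
      "\<phi> t - \<phi> 0 = (t - 0) * ((g (x + \<xi> *\<^sub>R u + t *\<^sub>R v) - g (x + \<xi> *\<^sub>R u)) \<bullet> u)"
      using MVT2[of 0 t \<phi> "\<lambda>s. (g (x + s *\<^sub>R u + t *\<^sub>R v) - g (x + s *\<^sub>R u)) \<bullet> u"] t der by auto
    define R where "R = g (x + \<xi> *\<^sub>R u + t *\<^sub>R v) - g x - A (\<xi> *\<^sub>R u + t *\<^sub>R v)"
    define R' where "R' = g (x + \<xi> *\<^sub>R u) - g x - A (\<xi> *\<^sub>R u)"
    have "norm R \<le> e * norm (\<xi> *\<^sub>R u + t *\<^sub>R v)"
      using \<delta>(2)[of "x + \<xi> *\<^sub>R u + t *\<^sub>R v"] small(1)[of \<xi> t] \<xi> t by (simp add: R_def add.assoc)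
    also have "\<dots> \<le> e * (t * norm u + t * norm v)"
      using e \<xi> t norm_triangle_ineq[of "\<xi> *\<^sub>R u" "t *\<^sub>R v"]
      by (intro mult_left_mono order_trans[OF norm_triangle_ineq] add_mono) (auto intro: mult_right_mono)
    finally have nR: "norm R \<le> e * (t * norm u + t * norm v)" .
    have "norm R' \<le> e * norm (\<xi> *\<^sub>R u)"
      using \<delta>(2)[of "x + \<xi> *\<^sub>R u"] small(1)[of \<xi> 0] \<xi> t by (simp add: R'_def)
    also have "\<dots> \<le> e * (t * norm u)"
      using e \<xi> t by (intro mult_left_mono) (auto intro: mult_right_mono)
    finally have nR': "norm R' \<le> e * (t * norm u)" .
    have "g (x + \<xi> *\<^sub>R u + t *\<^sub>R v) - g (x + \<xi> *\<^sub>R u) = t *\<^sub>R A v + (R - R')"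
      by (simp add: R_def R'_def A.add A.scaleR)
    then have "f (x + t *\<^sub>R u + t *\<^sub>R v) - f (x + t *\<^sub>R u) - f (x + t *\<^sub>R v) + f x
      = t * (t * (A v \<bullet> u) + (R - R') \<bullet> u)"
      using \<xi>(3) by (simp add: \<phi>_def inner_add_left)
    then have "(f (x + t *\<^sub>R u + t *\<^sub>R v) - f (x + t *\<^sub>R u) - f (x + t *\<^sub>R v) + f x) / t\<^sup>2 - A v \<bullet> u
      = (t * (t * (A v \<bullet> u) + (R - R') \<bullet> u)) / t\<^sup>2 - A v \<bullet> u"
      by (simp only:)
    also have "\<dots> = ((R - R') \<bullet> u) / t"
      using t by (simp add: power2_eq_square divide_simps)
    also have "\<bar>\<dots>\<bar> \<le> (norm (R - R') * norm u) / t"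
      using t Cauchy_Schwarz_ineq2[of "R - R'" u] by (simp add: divide_right_mono)
    also have "\<dots> \<le> ((e * (t * norm u + t * norm v) + e * (t * norm u)) * norm u) / t"
      using t nR nR' norm_triangle_ineq4[of R R'] by (intro divide_right_mono mult_right_mono) auto
    also have "\<dots> = e * ((2 * norm u + norm v) * norm u)" using t by (simp add: field_simps)
    also have "\<dots> < e * (2 * C)"
    proof (rule mult_strict_left_mono[OF _ e])
      have "q < 2 * (q + 1)" if "0 \<le> q" for q :: real using that by simp
      from this[of "(2 * norm u + norm v) * norm u"]
      show "(2 * norm u + norm v) * norm u < 2 * C" unfolding C_def by simp
    qed
    also have "\<dots> = \<epsilon>" using C by (simp add: e_def)
    finally show "dist ((f (x + t *\<^sub>R u + t *\<^sub>R v) - f (x + t *\<^sub>R u) - f (x + t *\<^sub>R v) + f x) / t\<^sup>2) (A v \<bullet> u) < \<epsilon>"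
      by (simp add: dist_norm)
  qed
qed

lemma second_derivative_symmetric:
  fixes f :: "real^'n::finite \<Rightarrow> real"
  assumes "open U" "x \<in> U"
    and "\<And>y. y \<in> U \<Longrightarrow> (f has_derivative (\<lambda>v. g y \<bullet> v)) (at y)"
    and "(g has_derivative A) (at x)"
  shows "A v \<bullet> u = A u \<bullet> v"
proof -
  have "((\<lambda>t. (f (x + t *\<^sub>R u + t *\<^sub>R v) - f (x + t *\<^sub>R u) - f (x + t *\<^sub>R v) + f x) / t\<^sup>2) \<longlongrightarrow> A u \<bullet> v)
           (at_right 0)"
  proof -
    have eq: "x + t *\<^sub>R v + t *\<^sub>R u = x + t *\<^sub>R u + t *\<^sub>R v" for t by simp
    have "f (x + t *\<^sub>R v + t *\<^sub>R u) - f (x + t *\<^sub>R v) - f (x + t *\<^sub>R u) + f x =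
       f (x + t *\<^sub>R u + t *\<^sub>R v) - f (x + t *\<^sub>R u) - f (x + t *\<^sub>R v) + f x" for t
      unfolding eq by linarith
    then show ?thesis using second_derivative_quotient_aux[OF assms, of v u] by (simp only:)
  qed
  with second_derivative_quotient_aux[OF assms, of u v] show ?thesis
    using tendsto_unique trivial_limit_at_right_real by blast
qed

lemma has_derivative_vec_components:
  fixes g :: "'a::real_normed_vector \<Rightarrow> real^'n::finite"
  assumes "\<And>j. ((\<lambda>x. g x $ j) has_derivative (\<lambda>v. A v $ j)) (at x within S)"
  shows "(g has_derivative A) (at x within S)"
  using assms by (subst has_derivative_componentwise_within)
    (auto simp: Basis_vec_def inner_axis)

lemma has_C2_grad_derivative_grad:
  assumes "has_C2_grad f g G" "x \<noteq> 0"
  shows "(g has_derivative (\<lambda>v. G x *v v)) (at x)"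
  using has_C1_gradD[OF has_C2_gradD2[OF assms(1)] assms(2)]
  by (intro has_derivative_vec_components) (simp add: matrix_vector_mul_component)

lemma has_C2_grad_symmetric:
  assumes f: "has_C2_grad f g G" and x: "x \<noteq> 0"
  shows "G x $ i $ j = G x $ j $ i"
proof -
  have "(G x *v axis j 1) \<bullet> axis i 1 = (G x *v axis i 1) \<bullet> axis j 1"
    by (rule second_derivative_symmetric[of "- {0}" x f g])
       (use x has_C1_gradD[OF has_C2_gradD1[OF f]] has_C2_grad_derivative_grad[OF f x] in auto)
  then show ?thesis by (simp add: inner_axis matrix_vector_mul_component)
qed

section \<open>Derivatives of determinants and the divergence of cofactors\<close>

lemma has_C1_grad_prod:
  assumes "finite I" "\<And>i. i \<in> I \<Longrightarrow> has_C1_grad (f i) (g i)"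
  shows "has_C1_grad (\<lambda>x. \<Prod>i\<in>I. f i x) (\<lambda>x. \<Sum>i\<in>I. (\<Prod>k\<in>I - {i}. f k x) *\<^sub>R g i x)"
  using assms
proof (induction I rule: finite_induct)
  case (insert a I)
  have "has_C1_grad (\<lambda>x. f a x * (\<Prod>i\<in>I. f i x))
     (\<lambda>x. f a x *\<^sub>R (\<Sum>i\<in>I. (\<Prod>k\<in>I - {i}. f k x) *\<^sub>R g i x) + (\<Prod>i\<in>I. f i x) *\<^sub>R g a x)"
    using insert by (intro has_C1_grad_mult) auto
  moreover have "f a x *\<^sub>R (\<Sum>i\<in>I. (\<Prod>k\<in>I - {i}. f k x) *\<^sub>R g i x) + (\<Prod>i\<in>I. f i x) *\<^sub>R g a x
      = (\<Sum>i\<in>insert a I. (\<Prod>k\<in>insert a I - {i}. f k x) *\<^sub>R g i x)" for x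
  proof -
    have "(\<Sum>i\<in>I. (\<Prod>k\<in>insert a I - {i}. f k x) *\<^sub>R g i x) = (\<Sum>i\<in>I. f a x *\<^sub>R ((\<Prod>k\<in>I - {i}. f k x) *\<^sub>R g i x))"
    proof (intro sum.cong refl)
      fix i assume "i \<in> I"
      then have "insert a I - {i} = insert a (I - {i})" using insert.hyps by auto
      then show "(\<Prod>k\<in>insert a I - {i}. f k x) *\<^sub>R g i x = f a x *\<^sub>R ((\<Prod>k\<in>I - {i}. f k x) *\<^sub>R g i x)"
        using insert.hyps by simp
    qed
    then show ?thesis using insert.hyps by (simp add: scaleR_sum_right)
  qed
  ultimately show ?case using insert.hyps by simp
qed auto

text \<open>Jacobi's formula in row form: the Leibniz expansion is differentiated factor by factor,
  and the terms are collected by the row that was differentiated.\<close>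

lemma has_C1_grad_det:
  fixes R :: "real^'n::finite \<Rightarrow> real^'m::finite^'m"
  assumes "\<And>a b. has_C1_grad (\<lambda>x. R x $ a $ b) (R' a b)"
  shows "has_C1_grad (\<lambda>x. det (R x))
    (\<lambda>x. \<chi> j. \<Sum>k\<in>UNIV. det (\<chi> a. if a = k then (\<chi> b. R' k b x $ j) else R x $ a))"
proof -
  let ?P = "{p. p permutes (UNIV :: 'm set)}"
  have "has_C1_grad (\<lambda>x. \<Sum>p\<in>?P. of_int (sign p) * (\<Prod>i\<in>UNIV. R x $ i $ p i))
    (\<lambda>x. \<Sum>p\<in>?P. of_int (sign p) *\<^sub>R (\<Sum>k\<in>UNIV. (\<Prod>i\<in>UNIV - {k}. R x $ i $ p i) *\<^sub>R R' k (p k) x))"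
    by (intro has_C1_grad_sum has_C1_grad_cmult has_C1_grad_prod assms finite_permutations) auto
  then show ?thesis
  proof (rule has_C1_grad_cong)
    fix x :: "real^'n"
    show "(\<chi> j. \<Sum>k\<in>UNIV. det (\<chi> a. if a = k then (\<chi> b. R' k b x $ j) else R x $ a)) =
      (\<Sum>p\<in>?P. of_int (sign p) *\<^sub>R (\<Sum>k\<in>UNIV. (\<Prod>i\<in>UNIV - {k}. R x $ i $ p i) *\<^sub>R R' k (p k) x))"
      (is "?L = ?R")
    proof (rule vec_eq_iff[THEN iffD2, rule_format])
      fix j
      have "det (\<chi> a. if a = k then (\<chi> b. R' k b x $ j) else R x $ a) =
         (\<Sum>p\<in>?P. of_int (sign p) * ((\<Prod>i\<in>UNIV - {k}. R x $ i $ p i) * R' k (p k) x $ j))" for k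
        unfolding det_def
      proof (intro sum.cong refl arg_cong2[where f = "(*)"])
        fix p
        let ?h = "\<lambda>i. (\<chi> a. if a = k then (\<chi> b. R' k b x $ j) else R x $ a) $ i $ p i"
        have "(\<Prod>i\<in>UNIV. ?h i) = ?h k * (\<Prod>i\<in>UNIV - {k}. ?h i)"
          by (rule prod.remove) auto
        also have "(\<Prod>i\<in>UNIV - {k}. ?h i) = (\<Prod>i\<in>UNIV - {k}. R x $ i $ p i)"
          by (intro prod.cong) auto
        finally show "(\<Prod>i\<in>UNIV. ?h i) = (\<Prod>i\<in>UNIV - {k}. R x $ i $ p i) * R' k (p k) x $ j"
          by simp
      qed
      then show "?L $ j = ?R $ j"
        by (simp add: sum_distrib_left) (rule sum.swap)
    qed
  qed (simp add: det_def)
qed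

text \<open>Writing the cofactor as a determinant of full size, with a unit vector as row i, keeps
  multilinearity and antisymmetry in the rows directly available.\<close>

definition cofactor :: "real^'n::finite^'n \<Rightarrow> 'n \<Rightarrow> 'n \<Rightarrow> real" where
  "cofactor M i j = det (\<chi> a. if a = i then axis j 1 else M $ a)"

lemma det_row_expand:
  fixes c :: "'n::finite \<Rightarrow> real^'n"
  shows "det (\<chi> a. if a = i then v else c a) =
    (\<Sum>j\<in>UNIV. v $ j * det (\<chi> a. if a = i then axis j 1 else c a))"
proof -
  have v: "v = (\<Sum>j\<in>UNIV. v $ j *s axis j 1)"
    by (simp add: basis_expansion)
  have "det (\<chi> a. if a = i then v else c a) = det (\<chi> a. if a = i then (\<Sum>j\<in>UNIV. v $ j *s axis j 1) else c a)"
    by (simp only: v[symmetric])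
  also have "\<dots> = (\<Sum>j\<in>UNIV. det (\<chi> a. if a = i then v $ j *s axis j 1 else c a))"
    by (rule det_linear_row_sum) simp
  also have "\<dots> = (\<Sum>j\<in>UNIV. v $ j * det (\<chi> a. if a = i then axis j 1 else c a))"
    by (simp add: det_row_mul)
  finally show ?thesis .
qed

lemma cofactor_expansion:
  "(\<Sum>j\<in>UNIV. M $ k $ j * cofactor M i j) = (if k = i then det M else 0)"
proof -
  have "(\<Sum>j\<in>UNIV. M $ k $ j * cofactor M i j) = det (\<chi> a. if a = i then M $ k else M $ a)"
    unfolding cofactor_def by (rule det_row_expand[symmetric])
  also have "\<dots> = (if k = i then det M else 0)"
  proof (cases "k = i")
    case True
    then have "(\<chi> a. if a = i then M $ k else M $ a) = M" by (auto simp: vec_eq_iff)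
    then show ?thesis using True by simp
  next
    case False
    then show ?thesis by (simp add: det_identical_rows[of i k] row_def)
  qed
  finally show ?thesis .
qed

lemma det_two_rows_antisymmetric:
  fixes c :: "'n::finite \<Rightarrow> real^'n"
  assumes "k \<noteq> i"
  shows "det (\<chi> a. if a = k then u else if a = i then v else c a) =
    - det (\<chi> a. if a = k then v else if a = i then u else c a)"
proof -
  define W where "W u v = det (\<chi> a. if a = k then u else if a = i then v else c a)" for u v
  have sw: "(\<chi> a. if a = k then u else if a = i then v else c a) =
     (\<chi> a. if a = i then v else if a = k then u else c a)" for u v
    using assms by (auto simp: vec_eq_iff)
  have 1: "W (u + u') v = W u v + W u' v" for u u' v
    unfolding W_def by (rule det_row_add)
  have 2: "W u (v + v') = W u v + W u v'" for u v v'
    unfolding W_def sw by (rule det_row_add)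
  have 3: "W u u = 0" for u
    unfolding W_def using assms by (intro det_identical_rows[of k i]) (auto simp: row_def)
  have "W (u + v) (u + v) = W u u + W v u + (W u v + W v v)" by (simp only: 1 2)
  then have "W u v = - W v u" using 3[of u] 3[of v] 3[of "u + v"] by linarith
  then show ?thesis unfolding W_def .
qed

text \<open>Differentiating row k of the cofactor in direction j produces second derivatives of Y k
  with indices b and j, multiplied by a determinant that has the unit vectors b and j in rows k and
  i. The first factor is symmetric in b and j, the second antisymmetric, so the sum over both
  indices vanishes. Row i itself is constant.\<close>

lemma piola_identity:
  fixes Y :: "'n::finite \<Rightarrow> real^'n \<Rightarrow> real"
  assumes Y: "\<And>k. has_C2_grad (Y k) (dY k) (ddY k)"
  obtains gc where "\<And>i j. has_C1_grad (\<lambda>x. cofactor (\<chi> k. dY k x) i j) (gc i j)"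
    and "\<And>x i. x \<noteq> 0 \<Longrightarrow> (\<Sum>j\<in>UNIV. gc i j x $ j) = 0"
proof -
  define R where "R i j x = (\<chi> a. if a = i then axis j 1 else dY a x)" for i j x
  define R' where "R' i a b x = (if a = i then 0 else ddY a x $ b)" for i a b x
  define gc where "gc i j x = (\<chi> l. \<Sum>k\<in>UNIV. det (\<chi> a. if a = k then (\<chi> b. R' i k b x $ l) else R i j x $ a))" for i j x
  have *: "has_C1_grad (\<lambda>x. R i j x $ a $ b) (R' i a b)" for i j a b
  proof -
    have "R' i a b = (\<lambda>x. if a = i then 0 else ddY a x $ b)" by (simp add: R'_def fun_eq_iff)
    then show ?thesis using has_C2_gradD2[OF Y] by (cases "a = i") (simp_all add: R_def)
  qed
  then have 1: "has_C1_grad (\<lambda>x. cofactor (\<chi> k. dY k x) i j) (gc i j)" for i j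
  proof -
    have "(\<chi> a. if a = i then axis j 1 else (\<chi> k. dY k x) $ a) = R i j x" for x
      by (simp only: R_def vec_lambda_beta)
    then show ?thesis
      unfolding gc_def cofactor_def using has_C1_grad_det[of "R i j" "R' i"] * by simp
  qed
  have 2: "(\<Sum>j\<in>UNIV. gc i j x $ j) = 0" if x: "x \<noteq> 0" for x i
  proof -
    define W where "W k b j = det (\<chi> a. if a = k then axis b 1 else if a = i then axis j 1 else dY a x)" for k b j
    have "det (\<chi> a. if a = k then (\<chi> b. R' i k b x $ j) else R i j x $ a) =
        (if k = i then 0 else \<Sum>b\<in>UNIV. ddY k x $ b $ j * W k b j)" for k j
    proof (cases "k = i")
      case True
      then show ?thesis
        by (intro trans[OF det_zero_row(2)[of i]]) (auto simp: R'_def row_def vec_eq_iff)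
    next
      case False
      have "(\<chi> a. if a = k then axis b 1 else R i j x $ a) =
          (\<chi> a. if a = k then axis b 1 else if a = i then axis j 1 else dY a x)" for b
        by (simp only: R_def vec_lambda_beta)
      then show ?thesis
        unfolding W_def using False det_row_expand[of k "\<chi> b. R' i k b x $ j" "\<lambda>a. R i j x $ a"]
        by (simp add: R'_def)
    qed
    then have "(\<Sum>j\<in>UNIV. gc i j x $ j) =
      (\<Sum>j\<in>UNIV. \<Sum>k\<in>UNIV. if k = i then 0 else \<Sum>b\<in>UNIV. ddY k x $ b $ j * W k b j)"
      unfolding gc_def vec_lambda_beta by (simp only:)
    also have "\<dots> = (\<Sum>k\<in>UNIV. \<Sum>j\<in>UNIV. if k = i then 0 else \<Sum>b\<in>UNIV. ddY k x $ b $ j * W k b j)"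
      by (rule sum.swap)
    also have "\<dots> = 0"
    proof (rule sum.neutral, rule ballI)
      fix k
      have "(\<Sum>j\<in>UNIV. \<Sum>b\<in>UNIV. ddY k x $ b $ j * W k b j) = 0" if "k \<noteq> i"
      proof -
        let ?T = "\<Sum>j\<in>UNIV. \<Sum>b\<in>UNIV. ddY k x $ b $ j * W k b j"
        have "?T = (\<Sum>j\<in>UNIV. \<Sum>b\<in>UNIV. - (ddY k x $ j $ b * W k j b))"
        proof (intro sum.cong refl)
          fix j b
          have "W k b j = - W k j b" unfolding W_def by (rule det_two_rows_antisymmetric[OF that])
          then show "ddY k x $ b $ j * W k b j = - (ddY k x $ j $ b * W k j b)"
            using has_C2_grad_symmetric[OF Y x, of k b j] by simp
        qed
        also have "\<dots> = - (\<Sum>j\<in>UNIV. \<Sum>b\<in>UNIV. ddY k x $ j $ b * W k j b)"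
          by (simp only: sum_negf)
        finally have "?T = - (\<Sum>j\<in>UNIV. \<Sum>b\<in>UNIV. ddY k x $ j $ b * W k j b)" .
        moreover have "(\<Sum>j\<in>UNIV. \<Sum>b\<in>UNIV. ddY k x $ j $ b * W k j b) = ?T"
          using sum.swap[of "\<lambda>j b. ddY k x $ j $ b * W k j b" UNIV UNIV] .
        ultimately show ?thesis by linarith
      qed
      then show "(\<Sum>j\<in>UNIV. if k = i then 0 else \<Sum>b\<in>UNIV. ddY k x $ b $ j * W k b j) = 0"
        by (cases "k = i") auto
    qed
    finally show ?thesis .
  qed
  show thesis using that[of gc] 1 2 by blast
qed

section \<open>Regularity of the support function\<close>

lemma outer_mult_vec: "outer u v *v w = (v \<bullet> w) *\<^sub>R u"
  by (simp add: vec_eq_iff matrix_vector_mult_def outer_def inner_vec_def sum_distrib_left mult_ac)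

lemma matrix_inv_works:
  fixes M :: "real^'n::finite^'n"
  assumes "det M \<noteq> 0"
  shows "M ** matrix_inv M = mat 1" "matrix_inv M ** M = mat 1"
proof -
  have "invertible M" using assms by (simp add: invertible_det_nz)
  then have "\<exists>A'. M ** A' = mat 1 \<and> A' ** M = mat 1" by (simp add: invertible_def)
  from someI_ex[OF this] show "M ** matrix_inv M = mat 1" "matrix_inv M ** M = mat 1"
    by (auto simp: matrix_inv_def)
qed

lemma matrix_inv_mult_vec:
  fixes M :: "real^'n::finite^'n"
  assumes "det M \<noteq> 0"
  shows "M *v (matrix_inv M *v v) = v" "matrix_inv M *v (M *v v) = v"
  using matrix_inv_works[OF assms] by (simp_all add: matrix_vector_mul_assoc)

lemma det_nonzero_if_ker_trivial:
  fixes M :: "real^'n::finite^'n"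
  assumes "\<And>v. M *v v = 0 \<Longrightarrow> v = 0"
  shows "det M \<noteq> 0"
  using assms matrix_left_invertible_ker[of M] invertible_det_nz[of M] invertible_left_inverse[of M] by blast

lemma continuous_on_det:
  fixes M :: "'a::topological_space \<Rightarrow> real^'n::finite^'n"
  assumes "\<And>i j. continuous_on S (\<lambda>x. M x $ i $ j)"
  shows "continuous_on S (\<lambda>x. det (M x))"
  unfolding det_def by (intro continuous_intros assms)

lemma continuous_on_matrix:
  fixes M :: "'a::topological_space \<Rightarrow> real^'n::finite^'m::finite"
  assumes "\<And>i j. continuous_on S (\<lambda>x. M x $ i $ j)"
  shows "continuous_on S M"
proof -
  have "continuous_on S (\<lambda>x. \<chi> i j. M x $ i $ j)"
    using assms by (intro continuous_on_vec_lambda)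
  then show ?thesis by simp
qed

text \<open>Cramer's rule expresses the entries of the inverse as quotients of determinants, whose
  continuity is evident.\<close>

lemma continuous_on_matrix_inv:
  fixes M :: "'a::topological_space \<Rightarrow> real^'n::finite^'n"
  assumes M: "continuous_on S M" and d: "\<And>x. x \<in> S \<Longrightarrow> det (M x) \<noteq> 0"
  shows "continuous_on S (\<lambda>x. matrix_inv (M x))"
proof (rule continuous_on_matrix)
  fix k l
  have c: "continuous_on S (\<lambda>x. M x $ i $ j)" for i j
    using M by (intro continuous_intros)
  have "matrix_inv (M x) $ k $ l = det (\<chi> i j. if j = k then (axis l 1 :: real^'n) $ i else M x $ i $ j) / det (M x)"
    if "x \<in> S" for x
  proof -
    have "M x *v (matrix_inv (M x) *v axis l 1) = axis l 1" by (rule matrix_inv_mult_vec[OF d[OF that]])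
    then have "matrix_inv (M x) *v axis l 1 = (\<chi> k. det (\<chi> i j. if j = k then (axis l 1 :: real^'n) $ i else M x $ i $ j) / det (M x))"
      using cramer[OF d[OF that]] by blast
    then have "(matrix_inv (M x) *v axis l 1) $ k = det (\<chi> i j. if j = k then (axis l 1 :: real^'n) $ i else M x $ i $ j) / det (M x)"
      by simp
    then show ?thesis by (simp add: matrix_vector_mul_component inner_axis)
  qed
  moreover have "continuous_on S (\<lambda>x. det (\<chi> i j. if j = k then (axis l 1 :: real^'n) $ i else M x $ i $ j) / det (M x))"
  proof (intro continuous_on_divide continuous_on_det c)
    show "continuous_on S (\<lambda>x. (\<chi> i j. if j = k then (axis l 1 :: real^'n) $ i else M x $ i $ j) $ i $ j)" for i j
      using c[of i j] by (cases "j = k") auto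
  qed (use d in auto)
  ultimately show "continuous_on S (\<lambda>x. matrix_inv (M x) $ k $ l)"
    by (simp cong: continuous_on_cong)
qed

text \<open>In \<open>hess\<close> the direction of differentiation is the row index, so the
  derivative of the gradient is at first the transpose of \<open>hess\<close>; the symmetry of
  second derivatives removes the difference.\<close>

lemma C2_onD:
  fixes F :: "real^'n::finite \<Rightarrow> real"
  assumes "C2_on U F" "y \<in> U"
  shows C2_on_has_derivative: "(F has_derivative (\<lambda>v. grad F y \<bullet> v)) (at y)"
    and C2_on_grad_has_derivative: "(grad F has_derivative (\<lambda>v. hess F y *v v)) (at y)"
    and C2_on_hess_symmetric: "v \<bullet> (hess F y *v w) = w \<bullet> (hess F y *v v)"
proof -
  have gen: "(f has_derivative (\<lambda>v. (\<chi> i. frechet_derivative f (at z) (axis i 1)) \<bullet> v)) (at z)"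
    if "f differentiable (at z)" for f :: "real^'n \<Rightarrow> real" and z
  proof -
    interpret D: bounded_linear "frechet_derivative f (at z)"
      using that by (simp add: frechet_derivative_works has_derivative_bounded_linear)
    have "frechet_derivative f (at z) v = (\<chi> i. frechet_derivative f (at z) (axis i 1)) \<bullet> v" for v
    proof -
      have "(\<Sum>i\<in>UNIV. v $ i *\<^sub>R axis i 1) = v"
        using basis_expansion[of v] by (simp only: scalar_mult_eq_scaleR)
      then have "frechet_derivative f (at z) v = frechet_derivative f (at z) (\<Sum>i\<in>UNIV. v $ i *\<^sub>R axis i 1)"
        by (simp only:)
      also have "\<dots> = (\<chi> i. frechet_derivative f (at z) (axis i 1)) \<bullet> v"
        by (simp add: D.sum D.scaleR inner_vec_def mult.commute)
      finally show ?thesis .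
    qed
    with that[unfolded frechet_derivative_works] show ?thesis
      by (rule has_derivative_eq_rhs[OF _ ext])
  qed
  have U: "open U" and dF: "\<And>z. z \<in> U \<Longrightarrow> F differentiable (at z)"
    and dg: "grad F differentiable (at y)"
    using assms by (auto simp: C2_on_def)
  have 1: "(F has_derivative (\<lambda>v. grad F z \<bullet> v)) (at z)" if "z \<in> U" for z
    using gen[OF dF[OF that]] by (simp add: grad_def)
  then show "(F has_derivative (\<lambda>v. grad F y \<bullet> v)) (at y)" using assms(2) by blast
  have "(\<lambda>z. grad F z $ j) differentiable (at y)" for j
    using dg by (auto simp: differentiable_def intro: bounded_linear.has_derivative[OF bounded_linear_vec_nth])
  from gen[OF this]
  have 2: "(grad F has_derivative (\<lambda>v. transpose (hess F y) *v v)) (at y)"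
    by (intro has_derivative_vec_components)
       (simp add: matrix_vector_mul_component hess_def transpose_def)
  have 3: "hess F y $ i $ j = hess F y $ j $ i" for i j
    using second_derivative_symmetric[OF U assms(2) 1 2, of "axis i 1" "axis j 1"]
    by (simp add: inner_axis matrix_vector_mul_component transpose_def)
  then have t: "transpose (hess F y) = hess F y" by (simp add: vec_eq_iff transpose_def)
  then show "(grad F has_derivative (\<lambda>v. hess F y *v v)) (at y)" using 2 by simp
  show "v \<bullet> (hess F y *v w) = w \<bullet> (hess F y *v v)"
    using t by (metis dot_lmul_matrix inner_commute vector_transpose_matrix)
qed

text \<open>Along the curve the first derivative of F at 0 vanishes and the second is A v \<bullet>
  v + 2 (g p \<bullet> w). The quadratic term in w makes it possible to leave the tangent hyperplane
  while v stays in it.\<close>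

lemma negative_along_parabola:
  fixes F :: "real^'n::finite \<Rightarrow> real"
  assumes U: "open U" "p \<in> U" and F: "\<And>y. y \<in> U \<Longrightarrow> (F has_derivative (\<lambda>v. g y \<bullet> v)) (at y)"
    and g: "(g has_derivative A) (at p)"
    and 0: "F p = 0" "g p \<bullet> v = 0" and neg: "A v \<bullet> v + 2 * (g p \<bullet> w) < 0"
  shows "\<forall>\<^sub>F t in at_right 0. F (p + t *\<^sub>R v + t\<^sup>2 *\<^sub>R w) < 0"
proof -
  define c where "c t = p + t *\<^sub>R v + t\<^sup>2 *\<^sub>R w" for t :: real
  have c': "(c has_derivative (\<lambda>h. h *\<^sub>R (v + (2 * t) *\<^sub>R w))) (at t)" for t
    unfolding c_def by (auto intro!: derivative_eq_intros simp: algebra_simps)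
  have "continuous (at 0) c" using c' has_derivative_continuous by blast
  moreover have "c 0 = p" by (simp add: c_def)
  ultimately have "\<forall>\<^sub>F t in nhds 0. c t \<in> U"
    using U by (metis continuous_within tendsto_at_iff_tendsto_nhds topological_tendstoD)
  then obtain d1 where d1: "d1 > 0" "\<And>t. \<bar>t\<bar> < d1 \<Longrightarrow> c t \<in> U"
    by (auto simp: eventually_nhds_metric dist_real_def)
  define \<phi>' where "\<phi>' t = g (c t) \<bullet> (v + (2 * t) *\<^sub>R w)" for t
  have \<phi>: "((\<lambda>t. F (c t)) has_real_derivative \<phi>' t) (at t)" if "\<bar>t\<bar> < d1" for t
    using has_derivative_compose[OF c' F[OF d1(2)[OF that]]]
    by (simp add: has_field_derivative_def \<phi>'_def mult_commute_abs mult.commute[of _ "g (c t) \<bullet> _"])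
  have gA: "((\<lambda>t. g (c t)) has_derivative (\<lambda>h. A (h *\<^sub>R v))) (at 0)"
    using has_derivative_compose[OF c'[of 0], of g A] g \<open>c 0 = p\<close> by simp
  interpret A: bounded_linear A using g by (rule has_derivative_bounded_linear)
  have "(\<phi>' has_derivative (\<lambda>h. h * (A v \<bullet> v + 2 * (g p \<bullet> w)))) (at 0)"
    unfolding \<phi>'_def using \<open>c 0 = p\<close>
    by (auto intro!: derivative_eq_intros gA simp: A.scaleR algebra_simps)
  then have "(\<phi>' has_real_derivative (A v \<bullet> v + 2 * (g p \<bullet> w))) (at 0)"
    by (simp add: has_field_derivative_def mult.commute[of _ "A v \<bullet> v + _"])
  from DERIV_neg_dec_right[OF this neg] obtain d2
    where d2: "d2 > 0" "\<And>h. 0 < h \<Longrightarrow> h < d2 \<Longrightarrow> \<phi>' h < \<phi>' 0" by auto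
  have "\<phi>' 0 = 0" using 0 \<open>c 0 = p\<close> by (simp add: \<phi>'_def)
  show ?thesis
    unfolding eventually_at_right_field
  proof (intro exI conjI allI impI)
    show "0 < min d1 d2" using d1 d2 by simp
    fix t assume t: "0 < t" "t < min d1 d2"
    obtain \<xi> where "0 < \<xi>" "\<xi> < t" "F (c t) - F (c 0) = (t - 0) * \<phi>' \<xi>"
      using MVT2[of 0 t "\<lambda>t. F (c t)" \<phi>'] t \<phi> by auto
    moreover have "\<phi>' \<xi> < 0" using d2(2)[of \<xi>] \<open>\<phi>' 0 = 0\<close> t calculation by auto
    ultimately have "F (c t) < 0" using 0 \<open>c 0 = p\<close> t by (simp add: mult_pos_neg)
    then show "F (p + t *\<^sub>R v + t\<^sup>2 *\<^sub>R w) < 0" by (simp add: c_def)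
  qed
qed

lemma eventually_in_open_line:
  fixes p :: "'a::real_normed_vector"
  assumes "open U" "p \<in> U"
  shows "\<forall>\<^sub>F t in at_right (0::real). p + t *\<^sub>R v + t\<^sup>2 *\<^sub>R w \<in> U"
proof -
  have "((\<lambda>t::real. p + t *\<^sub>R v + t\<^sup>2 *\<^sub>R w) \<longlongrightarrow> p + 0 *\<^sub>R v + 0\<^sup>2 *\<^sub>R w) (at_right 0)"
    by (intro tendsto_intros)
  then show ?thesis using assms by (auto intro: topological_tendstoD)
qed

section \<open>First and second order conditions at a point where a linear functional is maximal on
  K\<close>

locale boundary_chart =
  fixes K U :: "(real^'n::finite) set" and F :: "real^'n \<Rightarrow> real" and p x :: "real^'n"
  assumes pK: "p \<in> K" and pU: "p \<in> U" and F: "C2_on U F" and KU: "K \<inter> U = {y \<in> U. F y \<le> 0}"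
    and x0: "x \<noteq> 0" and max: "\<And>y. y \<in> K \<Longrightarrow> x \<bullet> y \<le> x \<bullet> p"
begin

lemma open_U: "open U" using F by (simp add: C2_on_def)

lemma F_zero: "F p = 0"
proof (rule ccontr)
  assume "F p \<noteq> 0"
  then have neg: "F p < 0" using pK pU KU by force
  have "isCont F p"
    using C2_on_has_derivative[OF F pU] has_derivative_continuous by blast
  then have "((\<lambda>t::real. F (p + t *\<^sub>R x)) \<longlongrightarrow> F (p + 0 *\<^sub>R x)) (at_right 0)"
    by (intro isCont_tendsto_compose[of _ F] tendsto_intros) simp
  then have "\<forall>\<^sub>F t in at_right (0::real). F (p + t *\<^sub>R x) < 0"
    using neg by (auto intro: order_tendstoD)
  moreover have "\<forall>\<^sub>F t in at_right (0::real). p + t *\<^sub>R x \<in> U"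
    using eventually_in_open_line[OF open_U pU, of x 0] by simp
  moreover have "\<forall>\<^sub>F t in at_right (0::real). 0 < t"
    by (rule eventually_at_right_less)
  ultimately have "\<forall>\<^sub>F t in at_right (0::real). False"
  proof eventually_elim
    case (elim t)
    then have "p + t *\<^sub>R x \<in> K" using KU by (auto intro: less_imp_le)
    then have "t * (x \<bullet> x) \<le> 0" using max[of "p + t *\<^sub>R x"] by (simp add: inner_add_right)
    then have "x \<bullet> x \<le> 0" using elim by (simp add: mult_le_0_iff)
    moreover have "x \<bullet> x > 0" using x0 by simp
    ultimately show False by linarith
  qed
  then show False by simp
qed

lemma decreasing_imp_inner_le:
  assumes "grad F p \<bullet> v < 0"
  shows "x \<bullet> v \<le> 0"
proof (rule ccontr)
  assume v: "\<not> x \<bullet> v \<le> 0"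
  have "((\<lambda>t::real. p + t *\<^sub>R v) has_derivative (\<lambda>t. t *\<^sub>R v)) (at 0)"
    by (auto intro!: derivative_eq_intros)
  from has_derivative_compose[OF this, of F "\<lambda>v. grad F p \<bullet> v"] C2_on_has_derivative[OF F pU]
  have "((\<lambda>t. F (p + t *\<^sub>R v)) has_real_derivative grad F p \<bullet> v) (at 0)"
    by (simp add: has_field_derivative_def mult.commute[of _ "grad F p \<bullet> v"])
  from DERIV_neg_dec_right[OF this assms] obtain d
    where "d > 0" "\<And>h. 0 < h \<Longrightarrow> h < d \<Longrightarrow> F (p + h *\<^sub>R v) < F p" by auto
  then have "\<forall>\<^sub>F t in at_right (0::real). F (p + t *\<^sub>R v) < 0"
    unfolding eventually_at_right_field F_zero by auto
  moreover have "\<forall>\<^sub>F t in at_right (0::real). p + t *\<^sub>R v \<in> U"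
    using eventually_in_open_line[OF open_U pU, of v 0] by simp
  moreover have "\<forall>\<^sub>F t in at_right (0::real). 0 < t"
    by (rule eventually_at_right_less)
  ultimately have "\<forall>\<^sub>F t in at_right (0::real). False"
  proof eventually_elim
    case (elim t)
    then have "p + t *\<^sub>R v \<in> K" using KU by (auto intro: less_imp_le)
    then have "t * (x \<bullet> v) \<le> 0" using max[of "p + t *\<^sub>R v"] by (simp add: inner_add_right)
    then show False using elim v by (simp add: mult_le_0_iff)
  qed
  then show False by simp
qed

text \<open>A Lagrange multiplier. Let q be the part of x orthogonal to the gradient. For every e >
  0 the direction q - e grad F decreases F to first order, hence points into K and has nonpositive
  inner product with x; letting e tend to 0 gives q = 0.\<close>

lemma normal_direction:
  assumes g: "grad F p \<noteq> 0"
  obtains l where "l > 0" "x = l *\<^sub>R grad F p"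
proof -
  let ?g = "grad F p"
  define l where "l = (x \<bullet> ?g) / (?g \<bullet> ?g)"
  define q where "q = x - l *\<^sub>R ?g"
  have gg: "?g \<bullet> ?g > 0" using g by simp
  have qg: "?g \<bullet> q = 0" using gg by (simp add: q_def l_def inner_diff_right inner_commute)
  have xl: "x = q + l *\<^sub>R ?g" by (simp add: q_def)
  have ineq: "q \<bullet> q \<le> e * (l * (?g \<bullet> ?g))" if "e > 0" for e
  proof -
    have "x \<bullet> (q - e *\<^sub>R ?g) \<le> 0"
      using that gg qg by (intro decreasing_imp_inner_le) (simp add: inner_diff_right)
    then show ?thesis using qg unfolding xl by (simp add: inner_simps inner_commute mult.left_commute)
  qed
  have "((\<lambda>e. e * (l * (?g \<bullet> ?g))) \<longlongrightarrow> 0 * (l * (?g \<bullet> ?g))) (at_right 0)"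
    by (intro tendsto_intros)
  then have "q \<bullet> q \<le> 0 * (l * (?g \<bullet> ?g))"
    by (rule tendsto_lowerbound) (auto simp: eventually_at_right_field intro!: exI[of _ 1] ineq)
  then have "q \<bullet> q \<le> 0" by simp
  then have "q = 0" by (metis inner_gt_zero_iff not_le)
  then have x: "x = l *\<^sub>R ?g" using xl by simp
  have "0 \<le> l * (?g \<bullet> ?g)" using ineq[of 1] \<open>q = 0\<close> by simp
  then have "0 \<le> l" using gg by (simp add: zero_le_mult_iff)
  moreover have "l \<noteq> 0" using x x0 by auto
  ultimately show thesis using that[of l] x by simp
qed

text \<open>If the form were negative at v, a parabola tangent to v and bent along the outward
  gradient would remain in K and yet raise the functional x above its maximum.\<close>

lemma hess_tangential_nonneg:
  assumes g: "grad F p \<noteq> 0" and v: "x \<bullet> v = 0"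
  shows "v \<bullet> (hess F p *v v) \<ge> 0"
proof (rule ccontr)
  assume neg: "\<not> v \<bullet> (hess F p *v v) \<ge> 0"
  obtain l where l: "l > 0" "x = l *\<^sub>R grad F p" using normal_direction[OF g] .
  let ?g = "grad F p"
  have gg: "?g \<bullet> ?g > 0" using g by simp
  \<comment> \<open>With this bend the gradient term makes up for half of the negative second
    derivative, which therefore stays negative.\<close>
  define e where "e = - (v \<bullet> (hess F p *v v)) / (4 * (?g \<bullet> ?g))"
  have e: "e > 0" unfolding e_def using neg gg by (intro divide_pos_pos) linarith+
  have gv: "?g \<bullet> v = 0" using v l by simp
  have "\<forall>\<^sub>F t in at_right 0. F (p + t *\<^sub>R v + t\<^sup>2 *\<^sub>R (e *\<^sub>R ?g)) < 0"
  proof (rule negative_along_parabola[OF open_U pU C2_on_has_derivative[OF F] C2_on_grad_has_derivative[OF F pU] F_zero gv])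
    show "(hess F p *v v) \<bullet> v + 2 * (?g \<bullet> (e *\<^sub>R ?g)) < 0"
      using neg gg by (simp add: e_def inner_commute[of "_ *v _"])
  qed
  moreover have "\<forall>\<^sub>F t in at_right (0::real). p + t *\<^sub>R v + t\<^sup>2 *\<^sub>R (e *\<^sub>R ?g) \<in> U"
    by (rule eventually_in_open_line[OF open_U pU])
  moreover have "\<forall>\<^sub>F t in at_right (0::real). 0 < t"
    by (rule eventually_at_right_less)
  ultimately have "\<forall>\<^sub>F t in at_right (0::real). False"
  proof eventually_elim
    case (elim t)
    then have "p + t *\<^sub>R v + t\<^sup>2 *\<^sub>R (e *\<^sub>R ?g) \<in> K" using KU by (auto intro: less_imp_le)
    then have "t\<^sup>2 * (e * (x \<bullet> ?g)) \<le> 0" using max v by (force simp: inner_add_right)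
    moreover have "x \<bullet> ?g > 0" using l gg by simp
    ultimately show False using elim e by (simp add: mult_le_0_iff)
  qed
  then show False by simp
qed

text \<open>A null vector v of a nonnegative form is orthogonal, with respect to the form, to all
  tangent vectors. So the projected Hessian annihilates v, and v lies in the kernel of the matrix
  whose determinant is the Gauss curvature.\<close>

lemma hess_tangential_pos:
  assumes g: "grad F p \<noteq> 0" and curv: "gauss_curv F p > 0" and v: "x \<bullet> v = 0" "v \<noteq> 0"
  shows "v \<bullet> (hess F p *v v) > 0"
proof (rule ccontr)
  assume "\<not> v \<bullet> (hess F p *v v) > 0"
  then have 0: "v \<bullet> (hess F p *v v) = 0" using hess_tangential_nonneg[OF g v(1)] by simp
  obtain l where l: "l > 0" "x = l *\<^sub>R grad F p" using normal_direction[OF g] .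
  let ?g = "grad F p" and ?H = "hess F p"
  define \<nu> where "\<nu> = ?g /\<^sub>R norm ?g"
  define P where "P = mat 1 - outer \<nu> \<nu>"
  have P: "P *v w = w - (\<nu> \<bullet> w) *\<^sub>R \<nu>" for w
    by (simp add: P_def matrix_vector_mult_diff_rdistrib outer_mult_vec)
  have \<nu>x: "\<nu> = (1 / (l * norm ?g)) *\<^sub>R x" using l by (simp add: \<nu>_def divide_simps)
  have \<nu>v: "\<nu> \<bullet> v = 0" using v by (simp add: \<nu>x)
  have orth: "w \<bullet> (?H *v v) = 0" if w: "x \<bullet> w = 0" for w
  proof -
    have *: "0 \<le> 2 * t * (w \<bullet> (?H *v v)) + t\<^sup>2 * (w \<bullet> (?H *v w))" for t
    proof -
      have "0 \<le> (v + t *\<^sub>R w) \<bullet> (?H *v (v + t *\<^sub>R w))"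
        using v w by (intro hess_tangential_nonneg[OF g]) (simp add: inner_add_right)
      also have "\<dots> = 2 * t * (w \<bullet> (?H *v v)) + t\<^sup>2 * (w \<bullet> (?H *v w))"
        using 0 C2_on_hess_symmetric[OF F pU, of v w]
        by (simp add: matrix_vector_right_distrib matrix_vector_mult_scaleR inner_add_left inner_add_right power2_eq_square algebra_simps)
      finally show ?thesis .
    qed
    define a b where "a = w \<bullet> (?H *v v)" and "b = w \<bullet> (?H *v w)"
    have b: "b \<ge> 0" unfolding b_def by (rule hess_tangential_nonneg[OF g w])
    \<comment> \<open>This value of t makes 2 t a + t^2 b negative unless a = 0; the summand 1 in
      the denominator covers the case b = 0.\<close>
    have "0 \<le> 2 * (- a / (b + 1)) * a + (- a / (b + 1))\<^sup>2 * b"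
      using *[of "- a / (b + 1)"] by (simp add: a_def b_def)
    then have "0 \<le> (2 * (- a / (b + 1)) * a + (- a / (b + 1))\<^sup>2 * b) * (b + 1)\<^sup>2" by simp
    also have "\<dots> = - (a\<^sup>2 * (b + 2))"
    proof -
      have "(2 * (- a / c) * a + (- a / c)\<^sup>2 * (c - 1)) * c\<^sup>2 = - (a\<^sup>2 * (c + 1))" if "c \<noteq> 0" for c
        using that by (simp add: field_simps power2_eq_square)
      from this[of "b + 1"] show ?thesis using b by simp
    qed
    finally have "a\<^sup>2 * (b + 2) \<le> 0" by simp
    then show ?thesis using b by (simp add: mult_le_0_iff a_def)
  qed
  have "P *v (?H *v v) = 0"
  proof -
    let ?w = "P *v (?H *v v)"
    have nn: "\<nu> \<bullet> \<nu> = 1" using g by (simp add: \<nu>_def dot_square_norm power2_eq_square)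
    have "\<nu> \<bullet> ?w = 0" using nn by (simp add: P inner_diff_right)
    then have "x \<bullet> ?w = 0" using l g by (simp add: \<nu>x)
    then have "?w \<bullet> (?H *v v) = 0" by (rule orth)
    moreover have "?w \<bullet> ?w = ?w \<bullet> (?H *v v)" using \<open>\<nu> \<bullet> ?w = 0\<close>
      by (subst (2) P) (simp add: inner_diff_right inner_commute)
    ultimately show ?thesis by simp
  qed
  then have "((P ** ?H ** P) /\<^sub>R norm ?g + outer \<nu> \<nu>) *v v = 0"
    using \<nu>v by (simp add: matrix_vector_mult_add_rdistrib outer_mult_vec scaleR_matrix_vector_assoc[symmetric]
        matrix_vector_mul_assoc[symmetric] P)
  then have "det ((P ** ?H ** P) /\<^sub>R norm ?g + outer \<nu> \<nu>) = 0"
    using v(2) matrix_inv_mult_vec(2) by (metis matrix_vector_mult_0_right)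
  then show False using curv by (simp add: gauss_curv_def Let_def \<nu>_def P_def)
qed

text \<open>The segment from p to q stays in K, so F is at most 0 on its beginning. In the tangent
  direction q - p, however, the first derivative of F vanishes and the second is positive, which
  forces F > 0 there.\<close>

lemma unique_maximizer:
  assumes g: "grad F p \<noteq> 0" and curv: "gauss_curv F p > 0" and "convex K"
    and q: "q \<in> K" "x \<bullet> q = x \<bullet> p"
  shows "q = p"
proof (rule ccontr)
  assume "q \<noteq> p"
  obtain l where l: "l > 0" "x = l *\<^sub>R grad F p" using normal_direction[OF g] .
  define v where "v = q - p"
  have v: "x \<bullet> v = 0" "v \<noteq> 0" using q \<open>q \<noteq> p\<close> by (auto simp: v_def inner_diff_right)
  have pos: "v \<bullet> (hess F p *v v) > 0" by (rule hess_tangential_pos[OF g curv v])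
  have gv: "grad F p \<bullet> v = 0" using v l by simp
  have "\<forall>\<^sub>F t in at_right 0. - F (p + t *\<^sub>R v + t\<^sup>2 *\<^sub>R 0) < 0"
  proof (rule negative_along_parabola[OF open_U pU, where g = "\<lambda>y. - grad F y" and A = "\<lambda>v. - (hess F p *v v)"])
    show "((\<lambda>y. - F y) has_derivative (\<lambda>v. - grad F y \<bullet> v)) (at y)" if "y \<in> U" for y
      using has_derivative_minus[OF C2_on_has_derivative[OF F that]] by simp
    show "((\<lambda>y. - grad F y) has_derivative (\<lambda>v. - (hess F p *v v))) (at p)"
      by (rule has_derivative_minus[OF C2_on_grad_has_derivative[OF F pU]])
  qed (use F_zero gv pos in \<open>simp_all add: inner_commute\<close>)
  moreover have "\<forall>\<^sub>F t in at_right (0::real). p + t *\<^sub>R v \<in> U"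
    using eventually_in_open_line[OF open_U pU, of v 0] by simp
  moreover have "\<forall>\<^sub>F t in at_right (0::real). 0 < t" "\<forall>\<^sub>F t in at_right (0::real). t < 1"
    by (rule eventually_at_right_less) (auto simp: eventually_at_right_field intro: exI[of _ 1])
  ultimately have "\<forall>\<^sub>F t in at_right (0::real). False"
  proof eventually_elim
    case (elim t)
    have "p + t *\<^sub>R v = (1 - t) *\<^sub>R p + t *\<^sub>R q" by (simp add: v_def algebra_simps)
    then have "p + t *\<^sub>R v \<in> K" using convexD[OF \<open>convex K\<close> pK q(1), of "1 - t" t] elim by simp
    then have "F (p + t *\<^sub>R v) \<le> 0" using elim KU by blast
    then show False using elim by simp
  qed
  then show False by simp
qed

end

text \<open>Implicit differentiation of a solution already known to be continuous. The expansions of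
  \<Theta> and r bound the error by a small multiple of |d| + |v|, where d and v are the increments
  of x and Y; as |v| is at most |E| plus a multiple of |d|, the part in |E| is absorbed on the
  left.\<close>

lemma has_derivative_implicit:
  fixes Y :: "'a::real_normed_vector \<Rightarrow> 'b::real_normed_vector" and \<Theta> :: "'b \<Rightarrow> 'c::real_normed_vector"
  assumes \<Theta>: "(\<Theta> has_derivative T) (at (Y x))" and Y: "isCont Y x"
    and eq: "\<forall>\<^sub>F x' in nhds x. \<Theta> (Y x') = r x'" and r: "(r has_derivative R) (at x)"
    and S: "bounded_linear S" "\<And>v. S (T v) = v"
  shows "(Y has_derivative (\<lambda>v. S (R v))) (at x)"
proof -
  interpret S: bounded_linear S by (rule S)
  interpret R: bounded_linear R using r by (rule has_derivative_bounded_linear)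
  interpret T: bounded_linear T using \<Theta> by (rule has_derivative_bounded_linear)
  obtain BS where BS: "BS > 0" "\<And>v. norm (S v) \<le> norm v * BS" using S.pos_bounded by auto
  obtain BR where BR: "BR > 0" "\<And>v. norm (R v) \<le> norm v * BR" using R.pos_bounded by auto
  show ?thesis
    unfolding has_derivative_at_alt
  proof (intro conjI allI impI)
    show "bounded_linear (\<lambda>v. S (R v))"
      by (rule bounded_linear_compose[OF S.bounded_linear_axioms R.bounded_linear_axioms])
    fix e :: real assume e: "e > 0"
    \<comment> \<open>The first bound makes the coefficient of |E| at most 1/2, so that it can be
      absorbed; the second makes what remains at most e |d|.\<close>
    define k where "k = min (1 / (2 * BS)) (e / (2 * BS * (1 + 2 * BR * BS + e)))"
    have den: "1 + 2 * BR * BS + e > 0" using BR BS e by (simp add: add_pos_pos)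
    have k: "k > 0" using e BS den by (simp add: k_def)
    have k1: "k * (2 * BS) \<le> 1" using BS by (simp add: k_def min_def field_simps)
    have k2: "k * (2 * BS * (1 + 2 * BR * BS + e)) \<le> e"
    proof -
      have "k \<le> e / (2 * BS * (1 + 2 * BR * BS + e))" by (simp add: k_def)
      then show ?thesis using BS den by (simp add: pos_le_divide_eq)
    qed
    obtain d1 where d1: "d1 > 0" "\<And>y. norm (y - Y x) < d1 \<Longrightarrow> norm (\<Theta> y - \<Theta> (Y x) - T (y - Y x)) \<le> k * norm (y - Y x)"
      using \<Theta> k unfolding has_derivative_at_alt by metis
    obtain d2 where d2: "d2 > 0" "\<And>y. norm (y - x) < d2 \<Longrightarrow> norm (r y - r x - R (y - x)) \<le> k * norm (y - x)"
      using r k unfolding has_derivative_at_alt by metis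
    obtain d3 where d3: "d3 > 0" "\<And>y. norm (y - x) < d3 \<Longrightarrow> norm (Y y - Y x) < d1"
      using Y d1(1) unfolding continuous_at_eps_delta by (metis dist_norm)
    obtain d4 where d4: "d4 > 0" "\<And>y. norm (y - x) < d4 \<Longrightarrow> \<Theta> (Y y) = r y"
      using eq unfolding eventually_nhds_metric by (metis dist_norm)
    show "\<exists>d>0. \<forall>y. norm (y - x) < d \<longrightarrow> norm (Y y - Y x - S (R (y - x))) \<le> e * norm (y - x)"
    proof (intro exI conjI allI impI)
      show "0 < min d2 (min d3 d4)" using d2 d3 d4 by simp
      fix y assume "norm (y - x) < min d2 (min d3 d4)"
      then have y: "norm (y - x) < d2" "norm (y - x) < d3" "norm (y - x) < d4" by auto
      define v where "v = Y y - Y x"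
      define d where "d = y - x"
      define E where "E = v - S (R d)"
      have "S (T v) = v" by (rule S(2))
      have eqs: "\<Theta> (Y y) = r y" "\<Theta> (Y x) = r x" using d4(2)[OF y(3)] d4(2)[of x] d4(1) by auto
      have 1: "norm (r y - r x - T v) \<le> k * norm v"
        using d1(2)[OF d3(2)[OF y(2)]] eqs by (simp add: v_def)
      have 2: "norm (r y - r x - R d) \<le> k * norm d" using d2(2)[OF y(1)] by (simp add: d_def)
      have "norm (T v - R d) \<le> k * norm d + k * norm v"
      proof -
        have "T v - R d = (r y - r x - R d) - (r y - r x - T v)" by simp
        then have "norm (T v - R d) \<le> norm (r y - r x - R d) + norm (r y - r x - T v)"
          by (metis norm_triangle_ineq4)
        then show ?thesis using 1 2 by linarith
      qed
      moreover have "E = S (T v - R d)" by (simp add: E_def S.diff S(2))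
      ultimately have "norm E \<le> (k * norm d + k * norm v) * BS"
        using BS(2)[of "T v - R d"] BS(1) by (metis mult_right_mono less_imp_le order_trans)
      also have "norm v \<le> norm E + norm d * BR * BS"
      proof -
        have "v = E + S (R d)" by (simp add: E_def)
        then have "norm v \<le> norm E + norm (S (R d))" by (metis norm_triangle_ineq)
        also have "norm (S (R d)) \<le> norm (R d) * BS" by (rule BS(2))
        also have "\<dots> \<le> norm d * BR * BS" using BR(2)[of d] BS(1) by (intro mult_right_mono) auto
        finally show ?thesis by simp
      qed
      finally have "norm E \<le> (k * norm d + k * (norm E + norm d * BR * BS)) * BS"
        using k BS by (simp add: mult_left_mono mult_right_mono)
      then have "norm E \<le> k * BS * (1 + BR * BS) * norm d + (k * BS) * norm E"
        by (simp add: algebra_simps)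
      moreover have "(k * BS) * norm E \<le> (1 / 2) * norm E" using k1 by (intro mult_right_mono) auto
      ultimately have "norm E \<le> k * (2 * BS * (1 + BR * BS)) * norm d" by (simp add: algebra_simps)
      also have "\<dots> \<le> e * norm d"
      proof (rule mult_right_mono)
        have "1 + BR * BS \<le> 1 + 2 * BR * BS + e" using BR BS e by simp
        then have "k * (2 * BS * (1 + BR * BS)) \<le> k * (2 * BS * (1 + 2 * BR * BS + e))"
          using k BS by (intro mult_left_mono) auto
        then show "k * (2 * BS * (1 + BR * BS)) \<le> e" using k2 by linarith
      qed simp
      finally show "norm (Y y - Y x - S (R (y - x))) \<le> e * norm (y - x)"
        by (simp add: E_def v_def d_def)
    qed
  qed
qed

text \<open>Any maximizer, taken by choice. For bodies of class \<open>K2plus\<close> it is the only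
  one, and as a function of x it is the gradient of the support function, on the unit sphere the
  inverse of the Gauss map.\<close>

definition support_pt :: "(real^'n::finite) set \<Rightarrow> real^'n \<Rightarrow> real^'n" where
  "support_pt K x = (SOME p. p \<in> K \<and> (\<forall>y\<in>K. x \<bullet> y \<le> x \<bullet> p))"

lemma convex_body0_nonempty: "convex_body0 K \<Longrightarrow> K \<noteq> {}"
  unfolding convex_body0_def by (metis empty_iff interior_subset subsetD)

lemma support_pt_in: "convex_body0 K \<Longrightarrow> support_pt K x \<in> K"
  and support_pt_max: "convex_body0 K \<Longrightarrow> y \<in> K \<Longrightarrow> x \<bullet> y \<le> x \<bullet> support_pt K x"
proof -
  assume K: "convex_body0 K"
  have "\<exists>p\<in>K. \<forall>y\<in>K. x \<bullet> y \<le> x \<bullet> p"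
    using K convex_body0_nonempty[OF K]
    by (intro continuous_attains_sup) (auto simp: convex_body0_def intro!: continuous_intros)
  then have ex: "\<exists>p. p \<in> K \<and> (\<forall>y\<in>K. x \<bullet> y \<le> x \<bullet> p)" by blast
  from someI_ex[OF ex] show "support_pt K x \<in> K" "y \<in> K \<Longrightarrow> x \<bullet> y \<le> x \<bullet> support_pt K x"
    by (auto simp: support_pt_def)
qed

lemma support_fun_eq: "convex_body0 K \<Longrightarrow> support_fun K x = x \<bullet> support_pt K x"
  unfolding support_fun_def
proof (rule cSup_eq_maximum)
  assume K: "convex_body0 K"
  show "x \<bullet> support_pt K x \<in> (\<bullet>) x ` K" by (rule imageI[OF support_pt_in[OF K]])
  show "y \<le> x \<bullet> support_pt K x" if "y \<in> (\<bullet>) x ` K" for y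
    using that support_pt_max[OF K] by auto
qed

lemma support_pt_frontier:
  assumes K: "convex_body0 K" and x: "x \<noteq> 0"
  shows "support_pt K x \<in> frontier K"
proof -
  let ?p = "support_pt K x"
  have "?p \<notin> interior K"
  proof
    assume "?p \<in> interior K"
    then obtain e where e: "e > 0" "ball ?p e \<subseteq> K" by (auto simp: mem_interior)
    define t where "t = e / (2 * norm x)"
    have t: "t > 0" using e x by (simp add: t_def)
    have "?p + t *\<^sub>R x \<in> ball ?p e" using e x t by (simp add: dist_norm t_def)
    then have "x \<bullet> (?p + t *\<^sub>R x) \<le> x \<bullet> ?p" using e K by (blast intro: support_pt_max)
    then have "t * (x \<bullet> x) \<le> 0" by (simp add: inner_add_right)
    moreover have "x \<bullet> x > 0" using x by simp
    ultimately show False using t by (simp add: mult_le_0_iff)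
  qed
  then show ?thesis
    using support_pt_in[OF K] closure_subset by (auto simp: frontier_def)
qed

lemma support_chart:
  assumes K: "K2plus K" and x: "x \<noteq> 0"
  obtains U F where "boundary_chart K U F (support_pt K x) x" "grad F (support_pt K x) \<noteq> 0"
    "gauss_curv F (support_pt K x) > 0"
proof -
  have K0: "convex_body0 K" using K by (simp add: K2plus_def)
  have "\<forall>p\<in>frontier K. \<exists>U F. p \<in> U \<and> C2_on U F \<and> grad F p \<noteq> 0 \<and>
         K \<inter> U = {x\<in>U. F x \<le> 0} \<and> gauss_curv F p > 0"
    using K unfolding K2plus_def by (rule conjunct2)
  from bspec[OF this support_pt_frontier[OF K0 x]]
  obtain U F where "support_pt K x \<in> U" "C2_on U F" "grad F (support_pt K x) \<noteq> 0"
    "K \<inter> U = {x\<in>U. F x \<le> 0}" "gauss_curv F (support_pt K x) > 0"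
    by (elim exE conjE)
  then show thesis
    using x by (intro that[of U F])
      (auto simp: boundary_chart_def intro: support_pt_in[OF K0] support_pt_max[OF K0])
qed

lemma support_pt_unique:
  assumes K: "K2plus K" and x: "x \<noteq> 0" and q: "q \<in> K" "\<And>y. y \<in> K \<Longrightarrow> x \<bullet> y \<le> x \<bullet> q"
  shows "q = support_pt K x"
proof -
  have K0: "convex_body0 K" using K by (simp add: K2plus_def)
  obtain U F where c: "boundary_chart K U F (support_pt K x) x" "grad F (support_pt K x) \<noteq> 0"
    "gauss_curv F (support_pt K x) > 0" using support_chart[OF K x] .
  show ?thesis
  proof (rule boundary_chart.unique_maximizer[OF c])
    show "convex K" using K0 by (simp add: convex_body0_def)
    show "x \<bullet> q = x \<bullet> support_pt K x"
      using q support_pt_in[OF K0] support_pt_max[OF K0] by (simp add: antisym)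
  qed (rule q)
qed

text \<open>A map into a compact set is continuous if its graph is closed. Maximality is a closed
  condition on pairs, and by uniqueness of the maximizer it cuts out precisely the graph.\<close>

lemma continuous_on_support_pt:
  assumes K: "K2plus K"
  shows "continuous_on (- {0}) (support_pt K)"
proof -
  have K0: "convex_body0 K" using K by (simp add: K2plus_def)
  have cK: "compact K" using K0 by (simp add: convex_body0_def)
  have "(\<lambda>x. (x, support_pt K x)) ` (- {0}) =
      ((- {0}) \<times> K) \<inter> (\<Inter>z\<in>K. {q. fst q \<bullet> z \<le> fst q \<bullet> snd q})"
    using support_pt_in[OF K0] support_pt_max[OF K0] support_pt_unique[OF K] by (force simp: image_iff)
  moreover have "closed (\<Inter>z\<in>K. {q :: (real^'a) \<times> (real^'a). fst q \<bullet> z \<le> fst q \<bullet> snd q})"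
    by (intro closed_INT ballI closed_Collect_le continuous_intros)
  ultimately have "closedin (top_of_set ((- {0}) \<times> K)) ((\<lambda>x. (x, support_pt K x)) ` (- {0}))"
    by (simp add: closedin_closed_Int)
  then show ?thesis
    using continuous_closed_graph_eq[OF cK, of "support_pt K" "- {0}"] support_pt_in[OF K0] by auto
qed

lemma isCont_support_pt:
  assumes "K2plus K" "x \<noteq> 0"
  shows "isCont (support_pt K) x"
proof -
  have "open (- {0 :: real^'a})" by auto
  then have "\<forall>x\<in>- {0}. isCont (support_pt K) x"
    using continuous_on_support_pt[OF assms(1)] continuous_on_eq_continuous_at by metis
  then show ?thesis using assms(2) by simp
qed

text \<open>Since each support point maximizes its own functional, the remainder of the linear
  approximation lies between 0 and the inner product of the increments of
  \<open>support_pt K\<close> and of x; continuity of the support point makes this small of first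
  order.\<close>

lemma has_C1_grad_support_fun:
  assumes K: "K2plus K"
  shows "has_C1_grad (support_fun K) (support_pt K)"
proof (rule has_C1_gradI)
  have K0: "convex_body0 K" using K by (simp add: K2plus_def)
  fix x :: "real^'a" assume x: "x \<noteq> 0"
  show "(support_fun K has_derivative (\<lambda>v. support_pt K x \<bullet> v)) (at x)"
    unfolding has_derivative_at_alt
  proof (intro conjI allI impI)
    fix e :: real assume e: "e > 0"
    then obtain d where d: "d > 0" "\<And>y. dist y x < d \<Longrightarrow> dist (support_pt K y) (support_pt K x) < e"
      using isCont_support_pt[OF K x] unfolding continuous_at_eps_delta by metis
    show "\<exists>d>0. \<forall>y. norm (y - x) < d \<longrightarrow>
        norm (support_fun K y - support_fun K x - support_pt K x \<bullet> (y - x)) \<le> e * norm (y - x)"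
    proof (intro exI conjI allI impI)
      fix y assume y: "norm (y - x) < d"
      let ?r = "support_fun K y - support_fun K x - support_pt K x \<bullet> (y - x)"
      have "?r = y \<bullet> support_pt K y - y \<bullet> support_pt K x"
        by (simp add: support_fun_eq[OF K0] inner_diff_right inner_commute[of "support_pt K x"] inner_diff_left)
      moreover have "y \<bullet> support_pt K x \<le> y \<bullet> support_pt K y" "x \<bullet> support_pt K y \<le> x \<bullet> support_pt K x"
        by (intro support_pt_max[OF K0] support_pt_in[OF K0])+
      ultimately have "0 \<le> ?r" "?r \<le> (support_pt K y - support_pt K x) \<bullet> (y - x)"
        by (simp_all add: inner_diff_right inner_diff_left inner_commute)
      moreover have "(support_pt K y - support_pt K x) \<bullet> (y - x) \<le> norm (support_pt K y - support_pt K x) * norm (y - x)"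
        by (rule norm_cauchy_schwarz)
      moreover have "\<dots> \<le> e * norm (y - x)"
        using d(2)[of y] y by (intro mult_right_mono) (auto simp: dist_norm)
      ultimately show "norm ?r \<le> e * norm (y - x)" by simp
    qed (rule d)
  qed (rule bounded_linear_inner_right)
qed (rule continuous_on_support_pt[OF K])

text \<open>The support point satisfies F = 0, and the unit normal of F there points along x. These
  n equations are differentiated by \<open>has_derivative_implicit\<close>; positive curvature makes
  the linear system regular, and the resulting formula also shows that the derivative is
  continuous.\<close>

lemma support_pt_derivative:
  assumes K: "K2plus K" and x0: "x0 \<noteq> 0"
  obtains N L where "open N" "x0 \<in> N" "0 \<notin> N" "continuous_on N L"
    "\<And>x. x \<in> N \<Longrightarrow> (support_pt K has_derivative (\<lambda>v. L x *v v)) (at x)"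
proof -
  let ?Y = "support_pt K"
  have K0: "convex_body0 K" using K by (simp add: K2plus_def)
  obtain U F where ch: "boundary_chart K U F (?Y x0) x0" and g0: "grad F (?Y x0) \<noteq> 0"
    and curv: "gauss_curv F (?Y x0) > 0" using support_chart[OF K x0] .
  interpret c0: boundary_chart K U F "?Y x0" x0 by (rule ch)
  note F = c0.F
  \<comment> \<open>\<open>P x\<close> projects orthogonally onto the complement of x.
    \<open>M x\<close> is the derivative, at the support point, of the map \<open>\<Theta>\<close>
    introduced below, and \<open>R x\<close> is the derivative at z = x of the right-hand side, the
    projected direction of z.\<close>
  define P where "P x = mat 1 - inverse ((norm x)\<^sup>2) *\<^sub>R outer x x" for x :: "real^'a"
  define M where "M x = inverse (norm (grad F (?Y x))) *\<^sub>R (P x ** hess F (?Y x)) + outer x (grad F (?Y x))" for x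
  define R where "R x = inverse (norm x) *\<^sub>R P x" for x
  have P: "P x *v w = w - (inverse ((norm x)\<^sup>2) * (x \<bullet> w)) *\<^sub>R x" for x w
    by (simp add: P_def matrix_vector_mult_diff_rdistrib outer_mult_vec scaleR_matrix_vector_assoc[symmetric])
  have xP: "x \<bullet> (P x *v w) = 0" if "x \<noteq> 0" for x w
    using that by (simp add: P inner_diff_right dot_square_norm)
  have Px: "P x *v (c *\<^sub>R x) = 0" if "x \<noteq> 0" for x c
    using that by (simp add: P dot_square_norm)
  have Mv: "M x *v v = inverse (norm (grad F (?Y x))) *\<^sub>R (P x *v (hess F (?Y x) *v v)) + (grad F (?Y x) \<bullet> v) *\<^sub>R x" for x v
    by (simp add: M_def matrix_vector_mult_add_rdistrib outer_mult_vec scaleR_matrix_vector_assoc[symmetric] matrix_vector_mul_assoc)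
  have contY: "continuous_on (- {0}) ?Y" by (rule continuous_on_support_pt[OF K])
  define N1 where "N1 = {x \<in> - {0}. ?Y x \<in> U}"
  have "open N1"
    using continuous_open_preimage[OF contY _ c0.open_U] by (auto simp: N1_def vimage_def Int_def)
  have contY1: "continuous_on N1 ?Y" using contY by (rule continuous_on_subset) (auto simp: N1_def)
  have cg: "continuous_on U (grad F)"
    using C2_on_grad_has_derivative[OF F] has_derivative_continuous continuous_at_imp_continuous_on by blast
  have ch: "continuous_on U (hess F)" using F by (simp add: C2_on_def)
  have cg1: "continuous_on N1 (\<lambda>x. grad F (?Y x))"
    by (rule continuous_on_compose2[OF cg contY1]) (auto simp: N1_def)
  have ch1: "continuous_on N1 (\<lambda>x. hess F (?Y x))"
    by (rule continuous_on_compose2[OF ch contY1]) (auto simp: N1_def)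
  define N2 where "N2 = {x \<in> N1. grad F (?Y x) \<noteq> 0}"
  have "open N2"
    using continuous_open_preimage[OF cg1 \<open>open N1\<close>, of "- {0}"] by (auto simp: N2_def vimage_def Int_def)
  have sub: "N2 \<subseteq> N1" "N1 \<subseteq> - {0}" by (auto simp: N1_def N2_def)
  have cP: "continuous_on (- {0}) P"
    unfolding P_def outer_def by (intro continuous_intros continuous_on_matrix) auto
  have cM: "continuous_on N2 M"
  proof (rule continuous_on_matrix)
    fix i j
    have "continuous_on N2 P" "continuous_on N2 (\<lambda>x. hess F (?Y x))" "continuous_on N2 (\<lambda>x. grad F (?Y x))"
      using continuous_on_subset[OF cP] continuous_on_subset[OF ch1 sub(1)] continuous_on_subset[OF cg1 sub(1)] sub
      by auto
    moreover have "grad F (?Y x) \<noteq> 0" if "x \<in> N2" for x using that by (simp add: N2_def)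
    ultimately show "continuous_on N2 (\<lambda>x. M x $ i $ j)"
      unfolding M_def outer_def matrix_matrix_mult_def
      by (auto intro!: continuous_intros)
  qed
  have cMij: "continuous_on N2 (\<lambda>x. M x $ i $ j)" for i j
    using cM by (intro continuous_intros)
  define N where "N = {x \<in> N2. det (M x) \<noteq> 0}"
  have "continuous_on N2 (\<lambda>x. det (M x))"
    by (rule continuous_on_det[OF cMij])
  from continuous_open_preimage[OF this \<open>open N2\<close>, of "- {0}"]
  have "open N" by (auto simp: N_def vimage_def Int_def)
  have "x0 \<in> N2" using x0 c0.pU g0 by (simp add: N1_def N2_def)
  \<comment> \<open>The curvature of this chart is known to be positive only at the base point.
    Invertibility is shown there, and the continuity of the determinant spreads it over the open set
    \<open>N\<close>.\<close>
  have "det (M x0) \<noteq> 0"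
  proof (rule det_nonzero_if_ker_trivial)
    fix v assume Mv0: "M x0 *v v = 0"
    have "x0 \<bullet> (M x0 *v v) = (grad F (?Y x0) \<bullet> v) * (x0 \<bullet> x0)"
      using xP[OF x0] by (simp add: Mv inner_add_right)
    then have gv: "grad F (?Y x0) \<bullet> v = 0" using Mv0 x0 by simp
    obtain l where l: "l > 0" "x0 = l *\<^sub>R grad F (?Y x0)" using c0.normal_direction[OF g0] .
    have xv: "x0 \<bullet> v = 0" using gv l(2) by (metis inner_scaleR_left mult_zero_right)
    have "P x0 *v (hess F (?Y x0) *v v) = 0" using Mv0 gv g0 by (simp add: Mv)
    then have "v \<bullet> (P x0 *v (hess F (?Y x0) *v v)) = 0" by simp
    then have "v \<bullet> (hess F (?Y x0) *v v) = 0"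
      using xv by (simp add: P inner_diff_right inner_commute[of v x0])
    then show "v = 0" using c0.hess_tangential_pos[OF g0 curv xv] by force
  qed
  then have "x0 \<in> N" using \<open>x0 \<in> N2\<close> by (simp add: N_def)
  have der: "(?Y has_derivative (\<lambda>v. matrix_inv (M x) *v (R x *v v))) (at x)" if xN: "x \<in> N" for x
  proof (rule has_derivative_implicit[where S = "(*v) (matrix_inv (M x))" and R = "(*v) (R x)"])
    have x: "x \<noteq> 0" and YU: "?Y x \<in> U" and g: "grad F (?Y x) \<noteq> 0" and d: "det (M x) \<noteq> 0"
      using xN by (auto simp: N_def N2_def N1_def)
    \<comment> \<open>The equations for the normal take values in the complement of x; the scalar
      equation F = 0 is placed on the remaining direction x, so that the combined system has full
      rank.\<close>
    define \<Theta> where "\<Theta> y = P x *v (grad F y /\<^sub>R norm (grad F y)) + F y *\<^sub>R x" for y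
    have lagr: "F (?Y z) = 0" "\<exists>l>0. z = l *\<^sub>R grad F (?Y z)" if "z \<in> N2" for z
    proof -
      have "boundary_chart K U F (?Y z) z"
        using that F c0.KU support_pt_in[OF K0] support_pt_max[OF K0]
        by (auto simp: boundary_chart_def N2_def N1_def)
      then interpret c: boundary_chart K U F "?Y z" z .
      show "F (?Y z) = 0" by (rule c.F_zero)
      show "\<exists>l>0. z = l *\<^sub>R grad F (?Y z)" using c.normal_direction that by (auto simp: N2_def)
    qed
    obtain l where l: "l > 0" "x = l *\<^sub>R grad F (?Y x)" using lagr(2)[of x] xN by (auto simp: N_def)
    let ?g = "grad F (?Y x)" and ?H = "hess F (?Y x)"
    have "((\<lambda>y. inverse (norm (grad F y))) has_derivative
        (\<lambda>v. (- inverse ((norm ?g)\<^sup>2) *\<^sub>R (?g /\<^sub>R norm ?g)) \<bullet> (?H *v v))) (at (?Y x))"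
      using has_derivative_compose[OF C2_on_grad_has_derivative[OF F YU]
          has_C1_gradD[OF has_C1_grad_inverse[OF has_C1_grad_norm] g]] by simp
    from has_derivative_scaleR[OF this C2_on_grad_has_derivative[OF F YU]]
    have nd: "((\<lambda>y. grad F y /\<^sub>R norm (grad F y)) has_derivative
        (\<lambda>v. inverse (norm ?g) *\<^sub>R (?H *v v) + ((- inverse ((norm ?g)\<^sup>2) *\<^sub>R (?g /\<^sub>R norm ?g)) \<bullet> (?H *v v)) *\<^sub>R ?g)) (at (?Y x))" .
    have "(\<Theta> has_derivative (\<lambda>v. P x *v (inverse (norm ?g) *\<^sub>R (?H *v v) + ((- inverse ((norm ?g)\<^sup>2) *\<^sub>R (?g /\<^sub>R norm ?g)) \<bullet> (?H *v v)) *\<^sub>R ?g)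
        + (?g \<bullet> v) *\<^sub>R x)) (at (?Y x))"
      unfolding \<Theta>_def
      by (intro has_derivative_add has_derivative_scaleR_left C2_on_has_derivative[OF F YU]
          bounded_linear.has_derivative[OF matrix_vector_mul_bounded_linear] nd)
    moreover have "P x *v (inverse (norm ?g) *\<^sub>R (?H *v v) + c *\<^sub>R ?g) + (?g \<bullet> v) *\<^sub>R x = M x *v v" for v c
    proof -
      have "?g = inverse l *\<^sub>R x" using l by (metis divideR_right less_irrefl)
      then have "P x *v (c *\<^sub>R ?g) = 0" for c using Px[OF x] by (metis scaleR_scaleR)
      then show ?thesis by (simp add: matrix_vector_right_distrib matrix_vector_mult_scaleR Mv)
    qed
    ultimately show "(\<Theta> has_derivative (\<lambda>v. M x *v v)) (at (?Y x))" by (simp only:)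
    show "isCont ?Y x" by (rule isCont_support_pt[OF K x])
    show "\<forall>\<^sub>F z in nhds x. \<Theta> (?Y z) = P x *v (z /\<^sub>R norm z)"
    proof -
      have "\<forall>\<^sub>F z in nhds x. z \<in> N2"
        using \<open>open N2\<close> xN by (intro eventually_nhds_in_open) (auto simp: N_def)
      then show ?thesis
      proof eventually_elim
        case (elim z)
        obtain l where l: "l > 0" "z = l *\<^sub>R grad F (?Y z)" using lagr(2)[OF elim] by auto
        have "(l *\<^sub>R w) /\<^sub>R norm (l *\<^sub>R w) = w /\<^sub>R norm w" for w :: "real^'a" using l(1) by simp
        from this[of "grad F (?Y z)"] have "z /\<^sub>R norm z = grad F (?Y z) /\<^sub>R norm (grad F (?Y z))"
          unfolding l(2)[symmetric] .
        then show ?case using lagr(1)[OF elim] by (simp add: \<Theta>_def)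
      qed
    qed
    show "((\<lambda>z. P x *v (z /\<^sub>R norm z)) has_derivative (\<lambda>v. R x *v v)) (at x)"
    proof -
      have 1: "((\<lambda>z. inverse (norm z)) has_derivative (\<lambda>v. (- inverse ((norm x)\<^sup>2) *\<^sub>R (x /\<^sub>R norm x)) \<bullet> v)) (at x)"
        using has_C1_gradD[OF has_C1_grad_inverse[OF has_C1_grad_norm] x] by simp
      have "((\<lambda>z. P x *v (z /\<^sub>R norm z)) has_derivative (\<lambda>v. P x *v (inverse (norm x) *\<^sub>R v + ((- inverse ((norm x)\<^sup>2) *\<^sub>R (x /\<^sub>R norm x)) \<bullet> v) *\<^sub>R x))) (at x)"
        by (intro bounded_linear.has_derivative[OF matrix_vector_mul_bounded_linear]
            has_derivative_scaleR[OF 1 has_derivative_ident])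
      moreover have "P x *v (inverse (norm x) *\<^sub>R v + c *\<^sub>R x) = R x *v v" for v c
        unfolding matrix_vector_right_distrib Px[OF x]
        by (simp only: matrix_vector_mult_scaleR R_def scaleR_matrix_vector_assoc[symmetric] add_0_right)
      ultimately show ?thesis by (simp only:)
    qed
    show "bounded_linear ((*v) (matrix_inv (M x)))" by (rule matrix_vector_mul_bounded_linear)
    show "matrix_inv (M x) *v (M x *v v) = v" for v by (rule matrix_inv_mult_vec[OF d])
  qed
  have cont: "continuous_on N (\<lambda>x. matrix_inv (M x) ** R x)"
  proof (rule continuous_on_matrix)
    fix i j
    have 1: "continuous_on N (\<lambda>x. matrix_inv (M x))"
      by (rule continuous_on_matrix_inv[OF continuous_on_subset[OF cM]]) (auto simp: N_def)
    have 2: "continuous_on N R"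
      unfolding R_def using sub
      by (intro continuous_intros continuous_on_subset[OF cP]) (auto simp: N_def)
    show "continuous_on N (\<lambda>x. (matrix_inv (M x) ** R x) $ i $ j)"
      unfolding matrix_matrix_mult_def using 1 2 by (auto intro!: continuous_intros)
  qed
  show thesis
  proof (rule that[OF \<open>open N\<close> \<open>x0 \<in> N\<close> _ cont])
    show "0 \<notin> N" by (auto simp: N_def N2_def N1_def)
    show "(?Y has_derivative (\<lambda>v. (matrix_inv (M x) ** R x) *v v)) (at x)" if "x \<in> N" for x
      using der[OF that] by (simp only: matrix_vector_mul_assoc)
  qed
qed

lemma support_fun_C2:
  assumes K: "K2plus K"
  obtains H where "has_C2_grad (support_fun K) (support_pt K) H"
proof -
  define H where "H x = matrix (frechet_derivative (support_pt K) (at x))" for x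
  have H: "(support_pt K has_derivative (\<lambda>v. H x *v v)) (at x)" "isCont H x" if x: "x \<noteq> 0" for x
  proof -
    obtain N L where N: "open N" "x \<in> N" "0 \<notin> N" "continuous_on N L"
      "\<And>z. z \<in> N \<Longrightarrow> (support_pt K has_derivative (\<lambda>v. L z *v v)) (at z)"
      using support_pt_derivative[OF K x] by blast
    have HL: "H z = L z" if "z \<in> N" for z
      unfolding H_def frechet_derivative_at[OF N(5)[OF that], symmetric]
      by (rule matrix_of_matrix_vector_mul)
    then show "(support_pt K has_derivative (\<lambda>v. H x *v v)) (at x)" using N by simp
    have "continuous_on N H" using N(4) HL by (simp cong: continuous_on_cong)
    then show "isCont H x" using N by (simp add: continuous_on_eq_continuous_at)
  qed
  have cH: "continuous_on (- {0}) H" using H(2) by (simp add: continuous_at_imp_continuous_on)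
  have "has_C1_grad (\<lambda>x. support_pt K x $ j) (\<lambda>x. H x $ j)" for j
  proof (rule has_C1_gradI)
    fix x :: "real^'a" assume "x \<noteq> 0"
    from bounded_linear.has_derivative[OF bounded_linear_vec_nth H(1)[OF this], of j]
    show "((\<lambda>x. support_pt K x $ j) has_derivative (\<lambda>v. H x $ j \<bullet> v)) (at x)"
      by (simp add: matrix_vector_mul_component)
  qed (use cH in \<open>intro continuous_intros\<close>)
  then have "has_C2_grad (support_fun K) (support_pt K) H"
    using has_C1_grad_support_fun[OF K] by (simp add: has_C2_grad_def)
  then show thesis by (rule that)
qed

section \<open>Approximation by difference quotients\<close>

lemma grad_eq:
  assumes "has_C1_grad f g" "x \<noteq> 0"
  shows "grad f x = g x"
proof -
  have "frechet_derivative f (at x) = (\<lambda>v. g x \<bullet> v)"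
    using frechet_derivative_at[OF has_C1_gradD[OF assms]] by simp
  then show ?thesis by (simp add: grad_def vec_eq_iff inner_axis)
qed

lemma hess_eq:
  assumes f: "has_C2_grad f g G" and x: "x \<noteq> 0"
  shows "hess f x = G x"
proof -
  have "frechet_derivative (\<lambda>y. grad f y $ j) (at x) (axis i 1) = G x $ j $ i" for i j
  proof -
    have "has_C1_grad (\<lambda>y. grad f y $ j) (\<lambda>y. G y $ j)"
      using has_C2_gradD2[OF f] by (rule has_C1_grad_cong) (simp_all add: grad_eq[OF has_C2_gradD1[OF f]])
    from frechet_derivative_at[OF has_C1_gradD[OF this x]]
    show ?thesis by (metis inner_axis real_inner_1_right)
  qed
  then show ?thesis using has_C2_grad_symmetric[OF f x] by (simp add: hess_def vec_eq_iff)
qed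

lemma has_C2_grad_continuous_hess:
  assumes "has_C2_grad f g G"
  shows "continuous_on (- {0}) G"
proof (rule continuous_on_matrix)
  show "continuous_on (- {0}) (\<lambda>x. G x $ i $ j)" for i j
    by (rule continuous_on_component[OF has_C1_grad_continuous_grad[OF has_C2_gradD2[OF assms]]])
qed

lemma has_C2_grad_imp_C2_on:
  assumes f: "has_C2_grad f g G"
  shows "C2_on (- {0}) f"
  unfolding C2_on_def
proof (intro conjI ballI)
  show "open (- {0::real^'a})" by auto
  fix x :: "real^'a" assume "x \<in> - {0}"
  then have x: "x \<noteq> 0" by simp
  show "f differentiable (at x)"
    using has_C1_gradD[OF has_C2_gradD1[OF f] x] by (auto simp: differentiable_def)
  have "(grad f has_derivative (\<lambda>v. G x *v v)) (at x)"
    by (rule has_derivative_transform_within_open[OF has_C2_grad_derivative_grad[OF f x], of "- {0}"])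
       (use x grad_eq[OF has_C2_gradD1[OF f]] in auto)
  then show "grad f differentiable (at x)" by (auto simp: differentiable_def)
next
  show "continuous_on (- {0}) (hess f)"
    by (rule continuous_on_eq[OF has_C2_grad_continuous_hess[OF f]]) (simp add: hess_eq[OF f])
qed

lemma has_C2_grad_cong:
  assumes "has_C2_grad f g G" "\<And>x. x \<noteq> 0 \<Longrightarrow> f' x = f x"
  shows "has_C2_grad f' g G"
  using assms has_C1_grad_cong unfolding has_C2_grad_def by blast

lemma has_C2_gradI:
  assumes "has_C1_grad f g" "\<And>j. \<exists>g'. has_C1_grad (\<lambda>x. g x $ j) g'"
  shows "\<exists>G. has_C2_grad f g G"
proof -
  obtain g' where g': "\<And>j. has_C1_grad (\<lambda>x. g x $ j) (g' j)" using assms(2) by metis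
  then have "has_C2_grad f g (\<lambda>x. \<chi> j. g' j x)" using assms(1) by (simp add: has_C2_grad_def)
  then show ?thesis by blast
qed

lemma has_C2_grad_mult:
  assumes f: "has_C2_grad f g G" and f': "has_C2_grad f' g' G'"
  shows "has_C2_grad (\<lambda>x. f x * f' x) (\<lambda>x. f x *\<^sub>R g' x + f' x *\<^sub>R g x)
    (\<lambda>x. f x *\<^sub>R G' x + outer (g' x) (g x) + (f' x *\<^sub>R G x + outer (g x) (g' x)))"
proof -
  note 1 = has_C2_gradD1[OF f] has_C2_gradD1[OF f']
  note 2 = has_C2_gradD2[OF f] has_C2_gradD2[OF f']
  have "has_C1_grad (\<lambda>x. (f x *\<^sub>R g' x + f' x *\<^sub>R g x) $ j)
    (\<lambda>x. (f x *\<^sub>R G' x + outer (g' x) (g x) + (f' x *\<^sub>R G x + outer (g x) (g' x))) $ j)" for j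
    by (rule has_C1_grad_cong[OF has_C1_grad_add[OF has_C1_grad_mult[OF 1(1) 2(2)[of j]] has_C1_grad_mult[OF 1(2) 2(1)[of j]]]])
       (auto simp: outer_def vec_eq_iff)
  then show ?thesis using has_C1_grad_mult[OF 1] by (simp add: has_C2_grad_def)
qed

lemma has_C2_grad_diff:
  assumes "has_C2_grad f g G" "has_C2_grad f' g' G'"
  shows "has_C2_grad (\<lambda>x. f x - f' x) (\<lambda>x. g x - g' x) (\<lambda>x. G x - G' x)"
  using assms by (simp add: has_C2_grad_def has_C1_grad_diff)

lemma has_C2_grad_const: "has_C2_grad (\<lambda>x. c) (\<lambda>x. 0) (\<lambda>x. 0)"
  by (simp add: has_C2_grad_def)

lemma has_C2_grad_inner: "has_C2_grad (\<lambda>x. x \<bullet> v) (\<lambda>x. v) (\<lambda>x. 0)"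
  by (simp add: has_C2_grad_def has_C1_grad_inner)

lemma has_C2_grad_inverse_ex:
  assumes f: "has_C2_grad f g G" and pos: "\<And>x. x \<noteq> 0 \<Longrightarrow> f x > 0"
  shows "\<exists>G'. has_C2_grad (\<lambda>x. inverse (f x)) (\<lambda>x. (- inverse ((f x)\<^sup>2)) *\<^sub>R g x) G'"
proof (rule has_C2_gradI)
  note f1 = has_C2_gradD1[OF f]
  note i = has_C1_grad_inverse[OF f1 pos]
  show "has_C1_grad (\<lambda>x. inverse (f x)) (\<lambda>x. (- inverse ((f x)\<^sup>2)) *\<^sub>R g x)" using i by simp
  fix j
  note m = has_C1_grad_mult[OF has_C1_grad_cmult[OF has_C1_grad_mult[OF i i], of "-1"] has_C2_gradD2[OF f, of j]]
  show "\<exists>g'. has_C1_grad (\<lambda>x. ((- inverse ((f x)\<^sup>2)) *\<^sub>R g x) $ j) g'"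
    by (rule exI, rule has_C1_grad_cong[OF m]) (auto simp: power2_eq_square)
qed

lemma has_C2_grad_norm_ex: "\<exists>G. has_C2_grad norm (\<lambda>x. x /\<^sub>R norm x) G"
proof (rule has_C2_gradI[OF has_C1_grad_norm])
  fix j
  note m = has_C1_grad_mult[OF has_C1_grad_inverse[OF has_C1_grad_norm] has_C1_grad_component[of j]]
  show "\<exists>g'. has_C1_grad (\<lambda>x::real^'a. (x /\<^sub>R norm x) $ j) g'"
    by (rule exI, rule has_C1_grad_cong[OF m]) auto
qed

section \<open>Difference quotients with a step proportional to the norm\<close>

lemma shift_nonzero:
  fixes x :: "real^'n::finite"
  assumes "x \<noteq> 0" "\<bar>d\<bar> < 1"
  shows "x + (d * norm x) *\<^sub>R axis k 1 \<noteq> 0"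
proof
  assume "x + (d * norm x) *\<^sub>R axis k 1 = 0"
  then have "norm x = norm ((d * norm x) *\<^sub>R axis k 1 :: real^'n)"
    by (metis add_eq_0_iff norm_minus_cancel)
  then have "norm x = \<bar>d\<bar> * norm x" by (simp add: abs_mult)
  then show False using assms by simp
qed

lemma has_C1_grad_shift:
  assumes f: "has_C1_grad f g" and d: "\<bar>d\<bar> < 1"
  shows "has_C1_grad (\<lambda>x. f (x + (d * norm x) *\<^sub>R axis k 1))
    (\<lambda>x. g (x + (d * norm x) *\<^sub>R axis k 1) + (d * g (x + (d * norm x) *\<^sub>R axis k 1) $ k) *\<^sub>R (x /\<^sub>R norm x))"
proof (rule has_C1_gradI)
  let ?m = "\<lambda>x::real^'a. x + (d * norm x) *\<^sub>R axis k 1"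
  fix x :: "real^'a" assume x: "x \<noteq> 0"
  have "(?m has_derivative (\<lambda>v. v + (d * ((x /\<^sub>R norm x) \<bullet> v)) *\<^sub>R axis k 1)) (at x)"
    by (intro has_derivative_add has_derivative_ident has_derivative_scaleR_left has_derivative_mult_right
        has_C1_gradD[OF has_C1_grad_norm x])
  from has_derivative_compose[OF this has_C1_gradD[OF f shift_nonzero[OF x d]]]
  show "((\<lambda>x. f (?m x)) has_derivative (\<lambda>v. (g (?m x) + (d * g (?m x) $ k) *\<^sub>R (x /\<^sub>R norm x)) \<bullet> v)) (at x)"
    by (rule has_derivative_eq_rhs) (simp add: fun_eq_iff inner_add_left inner_add_right inner_axis mult_ac)
next
  let ?m = "\<lambda>x::real^'a. x + (d * norm x) *\<^sub>R axis k 1"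
  have "continuous_on (- {0}) (\<lambda>x. g (?m x))"
  proof (rule continuous_on_compose2[OF has_C1_grad_continuous_grad[OF f]])
    show "continuous_on (- {0}) ?m" by (intro continuous_intros)
    show "?m ` (- {0}) \<subseteq> - {0}"
      by (intro image_subsetI) (simp add: shift_nonzero[OF _ d])
  qed
  then show "continuous_on (- {0}) (\<lambda>x. g (?m x) + (d * g (?m x) $ k) *\<^sub>R (x /\<^sub>R norm x))"
    by (intro continuous_on_add continuous_on_scaleR continuous_on_mult continuous_on_const
        continuous_on_component continuous_on_normalize)
qed

text \<open>Witnesses: the difference quotients of \<open>h\<close>, with step proportional to \<open>\<bar>x\<bar>\<close> to keep homogeneity.\<close>

lemma partial_deriv_C2_approximation:
  fixes h :: "real^'n::finite \<Rightarrow> real"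
  assumes h: "has_C2_grad h X H" and hom: "homogeneous 1 h"
  obtains z gz B where "\<And>k m. \<exists>G. has_C2_grad (z k m) (gz k m) G"
    and "\<And>k m. homogeneous 0 (z k m)"
    and "\<And>k m x. norm x = 1 \<Longrightarrow> \<bar>z k m x\<bar> \<le> B" "\<And>k m x. norm x = 1 \<Longrightarrow> norm (gz k m x) \<le> B"
    and "\<And>k x. norm x = 1 \<Longrightarrow> (\<lambda>m. z k m x) \<longlonglongrightarrow> X x $ k"
    and "\<And>k x. norm x = 1 \<Longrightarrow> (\<lambda>m. gz k m x) \<longlonglongrightarrow> H x $ k"
proof -
  note h1 = has_C2_gradD1[OF h]
  note h2 = has_C2_gradD2[OF h]
  \<comment> \<open>Steps of at most 1/2 keep points of the unit sphere, once shifted, at a distance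
    from the origin.\<close>
  define d where "d m = 1 / real (m + 2)" for m :: nat
  have d: "0 < d m" "d m \<le> 1 / 2" for m by (auto simp: d_def field_simps)
  have d1: "\<bar>d m\<bar> < 1" for m using d[of m] by linarith
  define sh where "sh k m x = x + (d m * norm x) *\<^sub>R axis k 1" for k :: 'n and m and x :: "real^'n"
  define z where "z k m x = (h (sh k m x) - h x) * (inverse (d m) * inverse (norm x))" for k m x
  define gz where "gz k m x = (h (sh k m x) - h x) *\<^sub>R (inverse (d m) *\<^sub>R ((- inverse ((norm x)\<^sup>2)) *\<^sub>R (x /\<^sub>R norm x)))
    + (inverse (d m) * inverse (norm x)) *\<^sub>R (X (sh k m x) + (d m * X (sh k m x) $ k) *\<^sub>R (x /\<^sub>R norm x) - X x)" for k m x
  have sh1: "has_C1_grad (\<lambda>x. h (sh k m x)) (\<lambda>x. X (sh k m x) + (d m * X (sh k m x) $ k) *\<^sub>R (x /\<^sub>R norm x))" for k m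
    unfolding sh_def by (rule has_C1_grad_shift[OF h1 d1])
  have sh2: "\<exists>g'. has_C1_grad (\<lambda>x. X (sh k m x) $ j) g'" for k m j
    unfolding sh_def using has_C1_grad_shift[OF h2 d1] by blast
  obtain Gn where n2: "has_C2_grad norm (\<lambda>x::real^'n. x /\<^sub>R norm x) Gn" using has_C2_grad_norm_ex by blast
  have n2j: "has_C1_grad (\<lambda>x::real^'n. (x /\<^sub>R norm x) $ j) (\<lambda>x. Gn x $ j)" for j by (rule has_C2_gradD2[OF n2])
  obtain Gi where i2: "has_C2_grad (\<lambda>x::real^'n. inverse (norm x)) (\<lambda>x. (- inverse ((norm x)\<^sup>2)) *\<^sub>R (x /\<^sub>R norm x)) Gi"
    using has_C2_grad_inverse_ex[OF n2] by auto
  have shC2: "\<exists>G. has_C2_grad (\<lambda>x. h (sh k m x)) (\<lambda>x. X (sh k m x) + (d m * X (sh k m x) $ k) *\<^sub>R (x /\<^sub>R norm x)) G" for k m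
  proof (rule has_C2_gradI[OF sh1])
    fix j
    obtain g1 where g1: "has_C1_grad (\<lambda>x. X (sh k m x) $ j) g1" using sh2 by blast
    obtain g2 where g2: "has_C1_grad (\<lambda>x. X (sh k m x) $ k) g2" using sh2 by blast
    note c = has_C1_grad_add[OF g1 has_C1_grad_mult[OF has_C1_grad_cmult[OF g2, of "d m"] n2j[of j]]]
    show "\<exists>g'. has_C1_grad (\<lambda>x. (X (sh k m x) + (d m * X (sh k m x) $ k) *\<^sub>R (x /\<^sub>R norm x)) $ j) g'"
      by (rule exI, rule has_C1_grad_cong[OF c]) auto
  qed
  have C2: "\<exists>G. has_C2_grad (z k m) (gz k m) G" for k m
  proof -
    obtain G1 where "has_C2_grad (\<lambda>x. h (sh k m x)) (\<lambda>x. X (sh k m x) + (d m * X (sh k m x) $ k) *\<^sub>R (x /\<^sub>R norm x)) G1"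
      using shC2 by blast
    from has_C2_grad_mult[OF has_C2_grad_diff[OF this h] has_C2_grad_mult[OF has_C2_grad_const[of "inverse (d m)"] i2]]
    show ?thesis unfolding z_def gz_def by auto
  qed
  have hz: "homogeneous 0 (z k m)" for k m
    unfolding homogeneous_def
  proof (intro allI impI)
    fix x :: "real^'n" and t :: real assume x: "x \<noteq> 0" and t: "t > 0"
    have "sh k m (t *\<^sub>R x) = t *\<^sub>R sh k m x" using t by (simp add: sh_def algebra_simps)
    moreover have "sh k m x \<noteq> 0" unfolding sh_def by (rule shift_nonzero[OF x d1])
    ultimately have "h (sh k m (t *\<^sub>R x)) = t * h (sh k m x)" "h (t *\<^sub>R x) = t * h x"
      using homogeneousD[OF hom _ t] x t by auto
    then have "z k m (t *\<^sub>R x) = (t * (h (sh k m x) - h x)) * (inverse (d m) * (inverse t * inverse (norm x)))"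
      using t by (simp add: z_def right_diff_distrib)
    also have "\<dots> = z k m x" using t by (simp add: z_def)
    finally show "z k m (t *\<^sub>R x) = t powr 0 * z k m x" using t by simp
  qed
  have shS: "sh k m x = x + d m *\<^sub>R axis k 1" if "norm x = 1" for k m x using that by (simp add: sh_def)
  have zS: "z k m x = (h (x + d m *\<^sub>R axis k 1) - h x) / d m" if "norm x = 1" for k m x
    using that by (simp add: z_def shS divide_inverse)
  \<comment> \<open>On the sphere the gradient is the difference quotient of X plus a radial
    correction coming from the variable step. Its coefficient tends to X_k - X_k = 0, so the limit
    is column k of H, which by symmetry is row k.\<close>
  have gzS: "gz k m x = (X (x + d m *\<^sub>R axis k 1) - X x) /\<^sub>R d m + (X (x + d m *\<^sub>R axis k 1) $ k - z k m x) *\<^sub>R x"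
    if "norm x = 1" for k m x
    using that d(1)[of m] by (simp add: gz_def zS shS algebra_simps divide_inverse)
  have dlim: "d \<longlonglongrightarrow> 0" unfolding d_def
    using LIMSEQ_ignore_initial_segment[OF lim_inverse_n', of 2] by simp
  then have dlim0: "filterlim d (at 0) sequentially"
    using d(1) by (auto simp: filterlim_at less_imp_neq[symmetric] intro!: always_eventually)
  have quot: "(\<lambda>m. (f (x + d m *\<^sub>R axis k 1) - f x) / d m) \<longlonglongrightarrow> g x $ k"
    if f: "has_C1_grad f g" and "norm x = 1" for f :: "real^'n \<Rightarrow> real" and g x k
  proof -
    have x: "x \<noteq> 0" using that by auto
    have "((\<lambda>t::real. x + t *\<^sub>R axis k 1) has_derivative (\<lambda>t. t *\<^sub>R axis k 1)) (at 0)"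
      by (auto intro!: derivative_eq_intros)
    from has_derivative_compose[OF this, of f "\<lambda>v. g x \<bullet> v"] has_C1_gradD[OF f x]
    have "((\<lambda>t. f (x + t *\<^sub>R axis k 1)) has_real_derivative g x $ k) (at 0)"
      by (simp add: has_field_derivative_def inner_axis mult.commute[of _ "g x $ k"])
    then have "((\<lambda>t. (f (x + t *\<^sub>R axis k 1) - f x) / t) \<longlongrightarrow> g x $ k) (at 0)"
      by (simp add: DERIV_def)
    from filterlim_compose[OF this dlim0] show ?thesis .
  qed
  have zlim: "(\<lambda>m. z k m x) \<longlonglongrightarrow> X x $ k" if "norm x = 1" for k x
    using quot[OF h1 that, of k] by (simp add: zS[OF that])
  have contX: "isCont X x" if "x \<noteq> 0" for x
    using has_C1_grad_continuous_grad[OF h1] that by (subst (asm) continuous_on_eq_continuous_at) auto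
  have gzlim: "(\<lambda>m. gz k m x) \<longlonglongrightarrow> H x $ k" if x: "norm x = 1" for k x
  proof -
    have x0: "x \<noteq> 0" using x by auto
    have "(\<lambda>m. (X (x + d m *\<^sub>R axis k 1) - X x) /\<^sub>R d m) \<longlonglongrightarrow> H x $ k"
    proof (rule vec_tendstoI)
      fix j
      have "(\<lambda>m. (X (x + d m *\<^sub>R axis k 1) $ j - X x $ j) / d m) \<longlonglongrightarrow> H x $ j $ k"
        by (rule quot[OF h2 x])
      then show "(\<lambda>m. ((X (x + d m *\<^sub>R axis k 1) - X x) /\<^sub>R d m) $ j) \<longlonglongrightarrow> H x $ k $ j"
        using has_C2_grad_symmetric[OF h x0, of j k] by (simp add: divide_inverse mult.commute)
    qed
    moreover have "(\<lambda>m. X (x + d m *\<^sub>R axis k 1)) \<longlonglongrightarrow> X (x + 0 *\<^sub>R axis k 1)"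
    proof (rule isCont_tendsto_compose[of _ X])
      show "(\<lambda>m. x + d m *\<^sub>R axis k 1) \<longlonglongrightarrow> x + 0 *\<^sub>R axis k 1"
        by (intro tendsto_intros dlim)
    qed (use contX x0 in simp)
    ultimately have "(\<lambda>m. gz k m x) \<longlonglongrightarrow> H x $ k + (X (x + 0 *\<^sub>R axis k 1) $ k - X x $ k) *\<^sub>R x"
      unfolding gzS[OF x] using zlim[OF x] by (intro tendsto_intros)
    then show ?thesis by simp
  qed
  \<comment> \<open>This annulus contains the balls of radius 1/2 around all points of the sphere,
    so the bounds of X and H on it control every difference quotient uniformly.\<close>
  define A where "A = cball 0 (3/2) - ball (0::real^'n) (1/2)"
  have cA: "compact A" unfolding A_def by (intro compact_diff) auto
  have A0: "A \<subseteq> - {0}" by (auto simp: A_def)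
  have bddA: "\<exists>B. \<forall>y\<in>A. norm (f y) \<le> B" if "continuous_on (- {0}) f" for f :: "real^'n \<Rightarrow> real^'n"
    using compact_imp_bounded[OF compact_continuous_image[OF continuous_on_subset[OF that A0] cA]]
    unfolding bounded_iff by blast
  have quotbd: "\<bar>(f (x + d m *\<^sub>R axis k 1) - f x) / d m\<bar> \<le> B"
    if f: "has_C1_grad f g" and x: "norm x = 1" and B: "\<forall>y\<in>A. norm (g y) \<le> B"
    for f :: "real^'n \<Rightarrow> real" and g x k m B
  proof -
    have "x \<in> A" using x by (simp add: A_def)
    then have B0: "B \<ge> 0" using B norm_ge_zero order_trans by blast
    have sub: "cball x (1/2) \<subseteq> A"
    proof
      fix y assume "y \<in> cball x (1/2)"
      then have "norm (y - x) \<le> 1/2" by (simp add: dist_norm norm_minus_commute)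
      then show "y \<in> A" using x norm_triangle_ineq[of x "y - x"] norm_triangle_ineq2[of x "x - y"]
        by (simp add: A_def norm_minus_commute)
    qed
    have "norm (f (x + d m *\<^sub>R axis k 1) - f x) \<le> B * norm (x + d m *\<^sub>R axis k 1 - x)"
    proof (rule differentiable_bound[where S = "cball x (1/2)"])
      fix y assume "y \<in> cball x (1/2)"
      then have yA: "y \<in> A" using sub by blast
      then have "y \<noteq> 0" using A0 by auto
      then show "(f has_derivative (\<bullet>) (g y)) (at y within cball x (1/2))"
        using has_C1_gradD[OF f] has_derivative_at_withinI by blast
      have "norm (g y) \<le> B" using B yA by blast
      then show "onorm ((\<bullet>) (g y)) \<le> B"
      proof (intro onorm_bound B0)
        fix v
        have "\<bar>g y \<bullet> v\<bar> \<le> norm (g y) * norm v" by (rule Cauchy_Schwarz_ineq2)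
        also have "\<dots> \<le> B * norm v" using \<open>norm (g y) \<le> B\<close> by (intro mult_right_mono) auto
        finally show "norm (g y \<bullet> v) \<le> B * norm v" by simp
      qed
    qed (use d[of m] in \<open>auto simp: dist_norm\<close>)
    then show ?thesis using d(1)[of m] by (simp add: divide_simps abs_mult)
  qed
  obtain BX where BX: "\<forall>y\<in>A. norm (X y) \<le> BX" using bddA[OF has_C1_grad_continuous_grad[OF h1]] by blast
  have "\<exists>B. \<forall>y\<in>A. norm (H y $ j) \<le> B" for j
    by (rule bddA[OF has_C1_grad_continuous_grad[OF h2]])
  then obtain BH where BH: "\<And>j. \<forall>y\<in>A. norm (H y $ j) \<le> BH j" by metis
  have zbd: "\<bar>z k m x\<bar> \<le> BX" if "norm x = 1" for k m x
    unfolding zS[OF that] by (rule quotbd[OF h1 that BX])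
  have gzbd: "norm (gz k m x) \<le> (\<Sum>j\<in>UNIV. BH j) + 2 * BX" if x: "norm x = 1" for k m x
  proof -
    have "norm ((X (x + d m *\<^sub>R axis k 1) - X x) /\<^sub>R d m) \<le> (\<Sum>j\<in>UNIV. \<bar>((X (x + d m *\<^sub>R axis k 1) - X x) /\<^sub>R d m) $ j\<bar>)"
      by (rule norm_le_l1_cart)
    also have "\<dots> \<le> (\<Sum>j\<in>UNIV. BH j)"
      using quotbd[OF h2 x BH] by (intro sum_mono) (simp add: divide_inverse mult.commute)
    finally have 1: "norm ((X (x + d m *\<^sub>R axis k 1) - X x) /\<^sub>R d m) \<le> (\<Sum>j\<in>UNIV. BH j)" .
    have "x + d m *\<^sub>R axis k 1 \<in> A"
      using x d[of m] norm_triangle_ineq[of x "d m *\<^sub>R axis k 1"] norm_triangle_ineq2[of x "- (d m *\<^sub>R axis k 1)"]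
      by (simp add: A_def)
    then have "\<bar>X (x + d m *\<^sub>R axis k 1) $ k\<bar> \<le> BX" using BX component_le_norm_cart order_trans by blast
    then have "\<bar>X (x + d m *\<^sub>R axis k 1) $ k - z k m x\<bar> \<le> 2 * BX" using zbd[OF x, of k m] by linarith
    then have 2: "norm ((X (x + d m *\<^sub>R axis k 1) $ k - z k m x) *\<^sub>R x) \<le> 2 * BX" using x by simp
    show ?thesis unfolding gzS[OF x] using norm_triangle_le[OF add_mono[OF 1 2]] .
  qed
  define B where "B = max BX ((\<Sum>j\<in>UNIV. BH j) + 2 * BX)"
  show thesis
  proof (rule that[of z gz B])
    show "\<bar>z k m x\<bar> \<le> B" "norm (gz k m x) \<le> B" if "norm x = 1" for k m x
      using zbd[OF that, of k m] gzbd[OF that, of k m] by (auto simp: B_def)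
  qed (use C2 hz zlim gzlim in auto)
qed

section \<open>Determinant formulas and the divergence of homogeneous fields\<close>

lemma cofactor_eq_inverse:
  fixes M :: "real^'n::finite^'n"
  assumes "det M \<noteq> 0"
  shows "cofactor M i j = det M * matrix_inv M $ j $ i"
proof -
  have "M *v (\<chi> j. cofactor M i j) = det M *\<^sub>R axis i 1"
    by (simp add: vec_eq_iff matrix_vector_mult_def cofactor_expansion axis_def)
  then have "matrix_inv M *v (M *v (\<chi> j. cofactor M i j)) = matrix_inv M *v (det M *\<^sub>R axis i 1)" by simp
  then have "(\<chi> j. cofactor M i j) = det M *\<^sub>R (matrix_inv M *v axis i 1)"
    by (simp only: matrix_inv_mult_vec[OF assms] matrix_vector_mult_scaleR)
  then have "(\<chi> j. cofactor M i j) $ j = (det M *\<^sub>R (matrix_inv M *v axis i 1)) $ j" by simp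
  then show ?thesis by (simp add: matrix_vector_mul_component inner_axis)
qed

lemma det_scaleR: "det (c *\<^sub>R A :: real^'n::finite^'n) = c ^ CARD('n) * det A"
proof -
  have "det (\<chi> i. c *s (A $ i)) = (\<Prod>i\<in>(UNIV :: 'n set). c) * det (\<chi> i. A $ i)"
    using det_rows_mul[of "\<lambda>i. c" "\<lambda>i. A $ i"] .
  moreover have "(\<chi> i. c *s (A $ i)) = c *\<^sub>R A" by (simp add: vec_eq_iff)
  ultimately show ?thesis by simp
qed

text \<open>After rotating x onto a coordinate axis only one row of the identity is changed, and
  linearity of the determinant in that row gives the value.\<close>

lemma det_mat1_add_outer:
  fixes x y :: "real^'n::finite"
  assumes x: "norm x = 1"
  shows "det (mat 1 + outer x y) = 1 + x \<bullet> y"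
proof -
  obtain k :: 'n where True by blast
  obtain T :: "real^'n \<Rightarrow> real^'n" where T: "orthogonal_transformation T" "T (axis k 1) = x"
    using orthogonal_transformation_exists_1[of "axis k 1" x] x by auto
  define Q where "Q = matrix T"
  have Q: "orthogonal_matrix Q" and Tv: "T v = Q *v v" for v
    using T(1) by (auto simp: orthogonal_transformation_matrix Q_def matrix_works orthogonal_transformation_linear)
  define P where "P = transpose Q"
  have Q1: "P ** Q = mat 1" "Q ** P = mat 1" using Q by (auto simp: orthogonal_matrix_def P_def)
  have adj: "(Q *v v) \<bullet> u = v \<bullet> (P *v u)" for u v
    unfolding P_def by (metis dot_lmul_matrix vector_transpose_matrix transpose_transpose)
  define w where "w = P *v y"
  have xQ: "x = Q *v axis k 1" using T(2) Tv by simp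
  then have Px: "P *v x = axis k 1" using Q1 by (simp add: matrix_vector_mul_assoc)
  have "P ** (mat 1 + outer x y) ** Q = mat 1 + outer (axis k 1) w"
  proof (rule matrix_eq[THEN iffD2, rule_format])
    fix v
    have "y \<bullet> (Q *v v) = w \<bullet> v" unfolding w_def using adj[of v y] by (simp add: inner_commute)
    then have "(P ** (mat 1 + outer x y) ** Q) *v v = P *v (Q *v v) + (w \<bullet> v) *\<^sub>R (P *v x)"
      by (simp add: matrix_vector_mul_assoc[symmetric] matrix_vector_mult_add_rdistrib outer_mult_vec
          matrix_vector_right_distrib matrix_vector_mult_scaleR)
    then show "(P ** (mat 1 + outer x y) ** Q) *v v = (mat 1 + outer (axis k 1) w) *v v"
      unfolding matrix_vector_mul_assoc Q1(1) Px
      by (simp add: matrix_vector_mult_add_rdistrib outer_mult_vec)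
  qed
  then have "det P * det (mat 1 + outer x y) * det Q = det (mat 1 + outer (axis k 1) w)"
    by (metis det_mul)
  moreover have "det P * det Q = 1" using Q1(1) by (metis det_I det_mul)
  ultimately have "det (mat 1 + outer x y) = det (mat 1 + outer (axis k 1) w)"
    by (metis mult.assoc mult.commute mult.left_neutral)
  also have "mat 1 + outer (axis k 1) w = (\<chi> a. if a = k then axis k 1 + w else mat 1 $ a)"
    by (auto simp: vec_eq_iff mat_def outer_def axis_def)
  also have "det \<dots> = det (\<chi> a. if a = k then axis k 1 else mat 1 $ a) + det (\<chi> a. if a = k then w else (mat 1 :: real^'n^'n) $ a)"
    by (rule det_row_add)
  also have "(\<chi> a. if a = k then axis k 1 else mat 1 $ a) = (mat 1 :: real^'n^'n)"
    by (auto simp: vec_eq_iff mat_def axis_def)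
  also have "det (\<chi> a. if a = k then w else (mat 1 :: real^'n^'n) $ a) = (\<Sum>j\<in>UNIV. w $ j * cofactor (mat 1) k j)"
    unfolding cofactor_def by (rule det_row_expand)
  also have "\<dots> = w $ k"
  proof -
    have cof: "cofactor (mat 1 :: real^'n^'n) k j = (if j = k then 1 else 0)" for j
    proof -
      have "(\<Sum>i\<in>UNIV. (mat 1 :: real^'n^'n) $ j $ i * f i) = f j" for f
        by (simp add: mat_def mult_if_delta)
      then show ?thesis using cofactor_expansion[of "mat 1 :: real^'n^'n" j k] by (simp only: det_I)
    qed
    have "(\<Sum>j\<in>UNIV. w $ j * cofactor (mat 1 :: real^'n^'n) k j) = (\<Sum>j\<in>UNIV. if j = k then w $ j else 0)"
      unfolding cof by (intro sum.cong) auto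
    then show ?thesis by simp
  qed
  also have "w $ k = x \<bullet> y"
  proof -
    have "w $ k = axis k 1 \<bullet> w" by (simp add: inner_axis')
    then show ?thesis unfolding w_def xQ by (simp only: adj)
  qed
  finally show ?thesis by simp
qed

text \<open>In degree 1 - n Euler's relation gives x \<bullet> g x = (1 - n) f x, which cancels the
  curvature term of \<open>sph_int_divergence\<close>. Fields of this degree thus have a Euclidean
  divergence of vanishing spherical integral.\<close>

lemma sph_int_partial_homogeneous:
  fixes f :: "real^'n::finite \<Rightarrow> real"
  assumes f: "has_C1_grad f g" and hom: "homogeneous (1 - real CARD('n)) f"
  shows "sph_int (\<lambda>x. g x $ j) = 0"
proof -
  note c = has_C1_grad_continuous_sphere[OF f]
  have "sph_int (\<lambda>x. g x $ j - x $ j * (x \<bullet> g x)) = sph_int (\<lambda>x. g x $ j + (real CARD('n) - 1) * (x $ j * f x))"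
  proof (rule sph_int_cong)
    fix x :: "real^'n" assume "norm x = 1"
    then have "x \<bullet> g x = (1 - real CARD('n)) * f x" by (intro homogeneous_euler[OF f hom]) auto
    then show "g x $ j - x $ j * (x \<bullet> g x) = g x $ j + (real CARD('n) - 1) * (x $ j * f x)"
      by (simp only:) (simp add: algebra_simps)
  qed
  also have "\<dots> = sph_int (\<lambda>x. g x $ j) + (real CARD('n) - 1) * sph_int (\<lambda>x. x $ j * f x)"
    using c by (subst sph_int_add) (auto intro!: continuous_intros simp: sph_int_mult_left)
  finally show ?thesis using sph_int_divergence[OF f, of j] by simp
qed

section \<open>Weak form of the Hilbert-Brunn-Minkowski operator\<close>

lemma continuous_on_matrix_vector:
  fixes M :: "'a::topological_space \<Rightarrow> real^'n::finite^'m::finite"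
  assumes M: "continuous_on T M" and v: "continuous_on T v"
  shows "continuous_on T (\<lambda>x. M x *v v x)"
  unfolding matrix_vector_mult_def
  by (intro continuous_on_vec_lambda continuous_on_sum continuous_on_mult continuous_on_component M v)

lemma det_bound:
  fixes M :: "real^'n::finite^'n"
  assumes "\<And>i j. \<bar>M $ i $ j\<bar> \<le> B"
  shows "\<bar>det M\<bar> \<le> fact CARD('n) * B ^ CARD('n)"
proof -
  let ?P = "{p. p permutes (UNIV :: 'n set)}"
  have "\<bar>det M\<bar> \<le> (\<Sum>p\<in>?P. \<bar>of_int (sign p) * (\<Prod>i\<in>UNIV. M $ i $ p i)\<bar>)"
    unfolding det_def by (rule sum_abs)
  also have "\<dots> \<le> (\<Sum>p\<in>?P. B ^ CARD('n))"
  proof (rule sum_mono)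
    fix p
    have "\<bar>of_int (sign p) * (\<Prod>i\<in>UNIV. M $ i $ p i)\<bar> = (\<Prod>i\<in>UNIV. \<bar>M $ i $ p i\<bar>)"
      by (simp add: abs_mult abs_prod sign_def)
    also have "\<dots> \<le> (\<Prod>i\<in>(UNIV :: 'n set). B)" using assms by (intro prod_mono) auto
    finally show "\<bar>of_int (sign p) * (\<Prod>i\<in>UNIV. M $ i $ p i)\<bar> \<le> B ^ CARD('n)" by simp
  qed
  also have "\<dots> = fact CARD('n) * B ^ CARD('n)" by (simp add: card_permutations)
  finally show ?thesis .
qed

locale minkowski_solution =
  fixes h :: "real^'n::finite \<Rightarrow> real" and X :: "real^'n \<Rightarrow> real^'n" and H :: "real^'n \<Rightarrow> real^'n^'n" and p :: real
  assumes h2: "has_C2_grad h X H" and hom: "homogeneous 1 h" and pos: "\<And>x. x \<noteq> 0 \<Longrightarrow> h x > 0"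
    and eq: "\<And>x. norm x = 1 \<Longrightarrow> h x powr (1 - p) * det (H x + outer x x) = 1"
begin

lemma h1: "has_C1_grad h X"
  by (rule has_C2_gradD1[OF h2])

lemma X1: "has_C1_grad (\<lambda>x. X x $ j) (\<lambda>x. H x $ j)"
  by (rule has_C2_gradD2[OF h2])

lemma inner_X: "x \<noteq> 0 \<Longrightarrow> x \<bullet> X x = h x"
  using homogeneous_euler[OF h1 hom] by simp

lemma homX: "homogeneous 0 (\<lambda>x. X x $ j)"
  using homogeneous_grad[OF h1 hom] by simp

lemma H_sym: "x \<noteq> 0 \<Longrightarrow> H x $ i $ j = H x $ j $ i"
  by (rule has_C2_grad_symmetric[OF h2])

lemma H_radial: "x \<noteq> 0 \<Longrightarrow> H x *v x = 0"
  using homogeneous_euler[OF X1 homX]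
  by (simp add: vec_eq_iff matrix_vector_mul_component inner_commute)

lemma H_tangential:
  assumes "x \<noteq> 0"
  shows "x \<bullet> (H x *v v) = 0"
proof -
  have "transpose (H x) = H x" using H_sym[OF assms] by (simp add: vec_eq_iff transpose_def)
  then have "x \<bullet> (H x *v v) = (H x *v x) \<bullet> v" by (metis dot_lmul_matrix vector_transpose_matrix)
  then show ?thesis by (simp add: H_radial[OF assms])
qed

text \<open>The Hessian of \<open>h\<^sup>2 / 2\<close>: a positive homogeneous matrix field of degree 0 without
  the degenerate radial direction of \<open>H\<close>.\<close>

definition G :: "real^'n \<Rightarrow> real^'n^'n" where
  "G x = h x *\<^sub>R H x + outer (X x) (X x)"

abbreviation "Gi x \<equiv> matrix_inv (G x)"

lemma G_mult: "G x *v v = h x *\<^sub>R (H x *v v) + (X x \<bullet> v) *\<^sub>R X x"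
  by (simp add: G_def matrix_vector_mult_add_rdistrib outer_mult_vec scaleR_matrix_vector_assoc)

lemma G_row: "G x $ k = h x *\<^sub>R H x $ k + X x $ k *\<^sub>R X x"
  by (simp add: G_def outer_def vec_eq_iff)

lemma G_sym: "x \<noteq> 0 \<Longrightarrow> transpose (G x) = G x"
  using H_sym by (simp add: vec_eq_iff transpose_def G_def outer_def mult.commute)

lemma G_self_adjoint: "x \<noteq> 0 \<Longrightarrow> (G x *v u) \<bullet> v = u \<bullet> (G x *v v)"
  using G_sym by (metis dot_lmul_matrix vector_transpose_matrix)

text \<open>G is h times a congruence of \<open>H x + outer x x\<close> by M = I + x y^T. The vector
  y is chosen such that the transpose of M sends x to X / sqrt h, while H is left unchanged because
  it annihilates x. Since x \<bullet> y = sqrt h - 1, each factor M contributes sqrt h.\<close>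

lemma det_G_eq:
  assumes x: "norm x = 1"
  shows "det (G x) = h x ^ (CARD('n) + 1) * det (H x + outer x x)"
proof -
  have x0: "x \<noteq> 0" using x by auto
  define s where "s = sqrt (h x)"
  have s: "s > 0" "s * s = h x" using pos[OF x0] by (auto simp: s_def)
  define y where "y = X x /\<^sub>R s - x"
  define M where "M = mat 1 + outer x y"
  have xx: "x \<bullet> x = 1" using x by (simp add: norm_eq_1)
  have "x \<bullet> y = s - 1"
    using inner_X[OF x0] xx s by (simp add: y_def inner_diff_right) (metis mult.assoc left_inverse less_irrefl mult.left_neutral)
  then have dM: "det M = s" unfolding M_def using det_mat1_add_outer[OF x] by simp
  have tM: "transpose M = mat 1 + outer y x"
    by (simp add: M_def vec_eq_iff transpose_def outer_def mat_def mult.commute)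
  have "G x = h x *\<^sub>R (transpose M ** (H x + outer x x) ** M)"
  proof (rule matrix_eq[THEN iffD2, rule_format])
    fix v
    have Mv: "M *v v = v + (y \<bullet> v) *\<^sub>R x"
      by (simp add: M_def matrix_vector_mult_add_rdistrib outer_mult_vec)
    have xM: "x \<bullet> (M *v v) = inverse s * (X x \<bullet> v)"
      unfolding Mv by (simp add: inner_add_right xx y_def inner_diff_left)
    have HM: "H x *v (M *v v) = H x *v v"
      unfolding Mv by (simp add: matrix_vector_right_distrib matrix_vector_mult_scaleR H_radial[OF x0])
    have "(transpose M ** (H x + outer x x) ** M) *v v
        = transpose M *v (H x *v v + (inverse s * (X x \<bullet> v)) *\<^sub>R x)"
      by (simp only: matrix_vector_mul_assoc[symmetric] matrix_vector_mult_add_rdistrib outer_mult_vec HM xM)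
    also have "\<dots> = (H x *v v + (inverse s * (X x \<bullet> v)) *\<^sub>R x) + (inverse s * (X x \<bullet> v)) *\<^sub>R y"
      unfolding tM matrix_vector_mult_add_rdistrib outer_mult_vec by (simp add: inner_add_right H_tangential[OF x0] xx)
    also have "\<dots> = H x *v v + (inverse (h x) * (X x \<bullet> v)) *\<^sub>R X x"
      using s by (simp add: y_def algebra_simps flip: s(2))
    finally show "G x *v v = (h x *\<^sub>R (transpose M ** (H x + outer x x) ** M)) *v v"
      using pos[OF x0] by (simp only: scaleR_matrix_vector_assoc[symmetric] G_mult) (simp add: scaleR_right_distrib)
  qed
  then have "det (G x) = h x ^ CARD('n) * (s * det (H x + outer x x) * s)"
    by (simp add: det_scaleR det_mul dM)
  then show ?thesis using s by simp
qed

lemma det_A: "norm x = 1 \<Longrightarrow> det (H x + outer x x) = h x powr (p - 1)"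
  using eq[of x] pos[of x] by (simp add: powr_diff field_simps)

lemma det_G: "norm x = 1 \<Longrightarrow> det (G x) = h x powr (real CARD('n) + p)"
proof -
  assume x: "norm x = 1"
  then have "h x > 0" using pos[of x] by force
  then have "h x ^ (CARD('n) + 1) = h x powr (real CARD('n) + 1)" by (simp add: powr_add powr_realpow)
  then show ?thesis
    unfolding det_G_eq[OF x] det_A[OF x] by (simp only: powr_add[symmetric]) simp
qed

lemma det_G_pos: "norm x = 1 \<Longrightarrow> det (G x) > 0"
  using det_G[of x] pos[of x] by (cases "x = 0") auto

lemma det_G_nz: "norm x = 1 \<Longrightarrow> det (G x) \<noteq> 0"
  using det_G_pos[of x] by simp

lemma G_radial: "norm x = 1 \<Longrightarrow> G x *v x = h x *\<^sub>R X x"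
  using H_radial[of x] inner_X[of x] by (cases "x = 0") (auto simp: G_mult inner_commute)

lemma Gi_self_adjoint:
  assumes x: "norm x = 1"
  shows "(Gi x *v u) \<bullet> v = u \<bullet> (Gi x *v v)"
proof -
  have x0: "x \<noteq> 0" using x by auto
  have "(Gi x *v u) \<bullet> v = (Gi x *v u) \<bullet> (G x *v (Gi x *v v))"
    by (simp only: matrix_inv_mult_vec(1)[OF det_G_nz[OF x]])
  also have "\<dots> = (G x *v (Gi x *v u)) \<bullet> (Gi x *v v)" by (simp only: G_self_adjoint[OF x0])
  finally show ?thesis by (simp only: matrix_inv_mult_vec(1)[OF det_G_nz[OF x]])
qed

lemma Gi_X: 
  assumes x: "norm x = 1"
  shows "Gi x *v X x = x /\<^sub>R h x"
proof -
  have "h x > 0" using pos[of x] x by force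
  then have "X x = inverse (h x) *\<^sub>R (G x *v x)" by (simp add: G_radial[OF x])
  also have "Gi x *v \<dots> = x /\<^sub>R h x"
    by (simp only: matrix_vector_mult_scaleR matrix_inv_mult_vec(2)[OF det_G_nz[OF x]])
  finally show ?thesis .
qed

text \<open>Column k of G is h H_k + X_k X, and G x = h X; solving for H_k gives the preimage under
  G. This makes energies involving the gradient of X_k explicit.\<close>

lemma Gi_H:
  assumes x: "norm x = 1"
  shows "Gi x *v (H x $ k) = inverse (h x) *\<^sub>R (axis k 1 - (X x $ k / h x) *\<^sub>R x)"
proof -
  have x0: "x \<noteq> 0" using x by auto
  have h: "h x > 0" by (rule pos[OF x0])
  have "H x *v axis k 1 = H x $ k"
    using H_sym[OF x0] by (simp add: vec_eq_iff matrix_vector_mul_component inner_axis)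
  then have "G x *v (inverse (h x) *\<^sub>R (axis k 1 - (X x $ k / h x) *\<^sub>R x)) = H x $ k"
    using h by (simp add: matrix_vector_mult_scaleR matrix_vector_mult_diff_distrib G_radial[OF x])
      (simp add: G_mult inner_axis)
  then show ?thesis by (metis matrix_inv_mult_vec(2)[OF det_G_nz[OF x]])
qed

lemma continuous_sphere:
  "continuous_on (sphere 0 1) h" "continuous_on (sphere 0 1) X" "continuous_on (sphere 0 1) H"
  "continuous_on (sphere 0 1) Gi" "continuous_on (sphere 0 1) (\<lambda>x. h x powr a)"
proof -
  show c: "continuous_on (sphere 0 1) h" "continuous_on (sphere 0 1) X"
    using has_C1_grad_continuous_sphere[OF h1] by auto
  show cH: "continuous_on (sphere 0 1) H"
    by (rule continuous_on_subset[OF has_C2_grad_continuous_hess[OF h2] punctured_sphere_subset])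
  have pos': "h x \<noteq> 0" if "x \<in> sphere 0 1" for x using pos[of x] that by force
  then show "continuous_on (sphere 0 1) (\<lambda>x. h x powr a)"
    using c by (intro continuous_intros) auto
  have "continuous_on (sphere 0 1) G"
  proof (rule continuous_on_matrix)
    show "continuous_on (sphere 0 1) (\<lambda>x. G x $ i $ j)" for i j
      unfolding G_def outer_def using c cH by (auto intro!: continuous_intros)
  qed
  then show "continuous_on (sphere 0 1) Gi"
    by (rule continuous_on_matrix_inv) (use det_G_nz in auto)
qed

text \<open>On gradients of 0-homogeneous functions this is n (n - 1) times the Dirichlet form of
  the negative Hilbert-Brunn-Minkowski operator for the cone-volume measure. The weight equals
  h^(2-n) det G, by the equation.\<close>

definition energy :: "(real^'n \<Rightarrow> real^'n) \<Rightarrow> (real^'n \<Rightarrow> real^'n) \<Rightarrow> real" where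
  "energy u v = sph_int (\<lambda>x. h x powr (p + 2) * (u x \<bullet> (Gi x *v v x)))"

text \<open>This is the divergence theorem for the field w h^(2-n) cof(G) grad z, where cof(G) =
  det(G) G^(-1) should have divergence-free rows. The Piola identity applies to Jacobians of C^2
  maps, but G is the Jacobian of h X, which is only C^1. So the identity is derived with h times the
  difference quotients in place of h X, followed by a passage to the limit.\<close>

lemma weak_form:
  assumes z: "has_C2_grad z gz Gz" and z0: "homogeneous 0 z"
    and w: "has_C1_grad w gw" and w0: "homogeneous 0 w"
  shows "sph_int (\<lambda>x. w x * (h x powr (p + 2) * trace (Gi x ** Gz x))) = - energy gw gz"
proof -
  note z1 = has_C2_gradD1[OF z] and z2 = has_C2_gradD2[OF z]
  obtain q gq B where q2: "\<And>k m. \<exists>G. has_C2_grad (q k m) (gq k m) G"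
    and q0: "\<And>k m. homogeneous 0 (q k m)"
    and qB: "\<And>k m x. norm x = 1 \<Longrightarrow> \<bar>q k m x\<bar> \<le> B" "\<And>k m x. norm x = 1 \<Longrightarrow> norm (gq k m x) \<le> B"
    and qlim: "\<And>k x. norm x = 1 \<Longrightarrow> (\<lambda>m. q k m x) \<longlonglongrightarrow> X x $ k"
      "\<And>k x. norm x = 1 \<Longrightarrow> (\<lambda>m. gq k m x) \<longlonglongrightarrow> H x $ k"
    using partial_deriv_C2_approximation[OF h2 hom] by blast
  define dY where "dY m k x = h x *\<^sub>R gq k m x + q k m x *\<^sub>R X x" for m k x
  have "\<exists>ddY. \<forall>k. has_C2_grad (\<lambda>x. h x * q k m x) (dY m k) (ddY k)" for m
  proof -
    have "\<exists>D. has_C2_grad (\<lambda>x. h x * q k m x) (dY m k) D" for k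
      using q2[of k m] has_C2_grad_mult[OF h2] unfolding dY_def by blast
    then show ?thesis by metis
  qed
  then obtain ddY where Y: "\<And>m k. has_C2_grad (\<lambda>x. h x * q k m x) (dY m k) (ddY m k)" by metis
  define C where "C m i j x = cofactor (\<chi> k. dY m k x) i j" for m i j x
  have Ceq: "C m i j = (\<lambda>x. cofactor (\<chi> k. dY m k x) i j)" for m i j
    by (simp add: C_def fun_eq_iff)
  have "\<exists>gc. (\<forall>i j. has_C1_grad (C m i j) (gc i j)) \<and> (\<forall>x i. x \<noteq> 0 \<longrightarrow> (\<Sum>j\<in>UNIV. gc i j x $ j) = 0)" for m
  proof -
    obtain gc where "\<And>i j. has_C1_grad (\<lambda>x. cofactor (\<chi> k. dY m k x) i j) (gc i j)"
      "\<And>x i. x \<noteq> 0 \<Longrightarrow> (\<Sum>j\<in>UNIV. gc i j x $ j) = 0"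
      by (rule piola_identity[of "\<lambda>k x. h x * q k m x" "dY m" "ddY m", OF Y]) (rule that)
    then show ?thesis unfolding Ceq by blast
  qed
  from choice[OF allI[OF this]] obtain gc where
    gc: "\<forall>m. (\<forall>i j. has_C1_grad (C m i j) (gc m i j)) \<and> (\<forall>x i. x \<noteq> 0 \<longrightarrow> (\<Sum>j\<in>UNIV. gc m i j x $ j) = 0)" ..
  then have C1: "\<And>m i j. has_C1_grad (C m i j) (gc m i j)"
    and piola: "\<And>m x i. x \<noteq> 0 \<Longrightarrow> (\<Sum>j\<in>UNIV. gc m i j x $ j) = 0" by simp_all
  have dY0: "dY m k (t *\<^sub>R x) = dY m k x" if "x \<noteq> 0" "t > 0" for m k t x
  proof -
    have "homogeneous (1 + 0 - 1) (\<lambda>x. dY m k x $ j)" for j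
      by (rule homogeneous_grad[OF has_C2_gradD1[OF Y] homogeneous_mult[OF hom q0]])
    then show ?thesis using homogeneousD[of 0 "\<lambda>x. dY m k x $ _" x t] that by (simp add: vec_eq_iff)
  qed
  then have C0: "homogeneous 0 (C m i j)" for m i j
    unfolding homogeneous_def C_def by simp
  \<comment> \<open>The exponent gives the field \<open>U\<close> the degree 1 - n required by
    \<open>sph_int_partial_homogeneous\<close>, and it turns det G = h^(n+p) into h^(p+2). The
    gradient of this weight is a multiple of X and will drop out, because G^(-1) X is radial and z
    has degree 0.\<close>
  define e where "e x = h x powr (2 - real CARD('n))" for x
  define ge where "ge x = ((2 - real CARD('n)) * h x powr (2 - real CARD('n) - 1)) *\<^sub>R X x" for x
  have e1: "has_C1_grad e ge" unfolding e_def ge_def by (rule has_C1_grad_powr[OF h1 pos])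
  have e0: "homogeneous (2 - real CARD('n)) e"
    using homogeneous_powr[OF hom pos, of "2 - real CARD('n)"] unfolding e_def by simp
  define U where "U m j x = (w x * e x) * (\<Sum>i\<in>UNIV. C m i j x * gz x $ i)" for m j x
  define gU where "gU m j x = (w x * e x) *\<^sub>R (\<Sum>i\<in>UNIV. C m i j x *\<^sub>R Gz x $ i + gz x $ i *\<^sub>R gc m i j x)
      + (\<Sum>i\<in>UNIV. C m i j x * gz x $ i) *\<^sub>R (w x *\<^sub>R ge x + e x *\<^sub>R gw x)" for m j x
  have U1: "has_C1_grad (U m j) (gU m j)" for m j
    unfolding U_def gU_def
    by (intro has_C1_grad_mult has_C1_grad_sum w e1 C1 z2) auto
  have "homogeneous (0 + (2 - real CARD('n)) + (0 + (0 - 1))) (U m j)" for m j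
    unfolding U_def
    by (intro homogeneous_mult homogeneous_sum w0 e0 C0 homogeneous_grad[OF z1 z0])
  then have U0: "homogeneous (1 - real CARD('n)) (U m j)" for m j by simp
  \<comment> \<open>The divergence of \<open>U m\<close> once the Piola identity has removed the
    derivatives of the cofactors. Only first derivatives of the approximating maps are left, so C^1
    convergence is enough.\<close>
  define T where "T m x = (w x * e x) * (\<Sum>j\<in>UNIV. \<Sum>i\<in>UNIV. C m i j x * Gz x $ i $ j)
      + (\<Sum>j\<in>UNIV. (\<Sum>i\<in>UNIV. C m i j x * gz x $ i) * (w x * ge x $ j + e x * gw x $ j))" for m x
  have sU: "(\<Sum>j\<in>UNIV. gU m j x $ j) = T m x" if "x \<noteq> 0" for m x
  proof -
    have "(\<Sum>j\<in>UNIV. \<Sum>i\<in>UNIV. gz x $ i * gc m i j x $ j) = (\<Sum>i\<in>UNIV. gz x $ i * (\<Sum>j\<in>UNIV. gc m i j x $ j))"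
      by (subst sum.swap) (simp add: sum_distrib_left)
    also have "\<dots> = 0" using piola[OF that] by simp
    finally show ?thesis
      by (simp add: gU_def T_def sum.distrib sum_distrib_left[symmetric] distrib_left)
  qed
  have TI: "sph_int (T m) = 0" for m
  proof -
    have "sph_int (T m) = sph_int (\<lambda>x. \<Sum>j\<in>UNIV. gU m j x $ j)"
      by (rule sph_int_cong) (metis sU norm_zero zero_neq_one)
    also have "\<dots> = (\<Sum>j\<in>UNIV. sph_int (\<lambda>x. gU m j x $ j))"
      using has_C1_grad_continuous_sphere(2)[OF U1] by (intro sph_int_sum continuous_intros) auto
    also have "\<dots> = 0" using sph_int_partial_homogeneous[OF U1 U0] by simp
    finally show ?thesis .
  qed
  define CG where "CG i j x = cofactor (G x) i j" for i j x
  define TG where "TG x = (w x * e x) * (\<Sum>j\<in>UNIV. \<Sum>i\<in>UNIV. CG i j x * Gz x $ i $ j)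
      + (\<Sum>j\<in>UNIV. (\<Sum>i\<in>UNIV. CG i j x * gz x $ i) * (w x * ge x $ j + e x * gw x $ j))" for x
  have Clim: "(\<lambda>m. C m i j x) \<longlonglongrightarrow> CG i j x" if x: "norm x = 1" for i j x
  proof -
    have dlim: "(\<lambda>m. dY m k x $ l) \<longlonglongrightarrow> G x $ k $ l" for k l
      unfolding dY_def G_row using qlim[OF x] by (intro tendsto_intros)
    have "(\<lambda>m. (if a = i then axis j 1 else (\<chi> k. dY m k x) $ a) $ l) \<longlonglongrightarrow> (if a = i then axis j 1 else G x $ a) $ l" for a l
      using dlim by (cases "a = i") auto
    then show ?thesis unfolding C_def CG_def cofactor_def det_def vec_lambda_beta
      by (intro tendsto_sum tendsto_mult tendsto_const tendsto_prod)
  qed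
  obtain BX where BX: "\<And>x. norm x = 1 \<Longrightarrow> norm (X x) \<le> BX" using continuous_sphere_bounded[OF continuous_sphere(2)] by blast
  obtain Bh where Bh: "\<And>x. norm x = 1 \<Longrightarrow> norm (h x) \<le> Bh" using continuous_sphere_bounded[OF continuous_sphere(1)] by blast
  obtain x1 :: "real^'n" where x1: "norm x1 = 1" using vector_choose_size[of 1] by auto
  have BX0: "BX \<ge> 0" "Bh \<ge> 0" "B \<ge> 0"
    using order_trans[OF norm_ge_zero BX[OF x1]] order_trans[OF norm_ge_zero Bh[OF x1]]
      order_trans[OF norm_ge_zero qB(2)[OF x1]] by simp_all
  have CB: "\<exists>BC. \<forall>m i j x. norm x = 1 \<longrightarrow> \<bar>C m i j x\<bar> \<le> BC"
  proof (intro exI allI impI)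
    fix m i j and x :: "real^'n" assume x: "norm x = 1"
    show "\<bar>C m i j x\<bar> \<le> fact CARD('n) * (Bh * B + B * BX + 1) ^ CARD('n)"
      unfolding C_def cofactor_def
    proof (rule det_bound)
      fix a b
      have "\<bar>dY m a x $ b\<bar> \<le> \<bar>h x\<bar> * \<bar>gq a m x $ b\<bar> + \<bar>q a m x\<bar> * \<bar>X x $ b\<bar>"
        unfolding dY_def by (simp add: abs_mult[symmetric])
      also have "\<dots> \<le> Bh * B + B * BX"
        using Bh[OF x] qB[OF x] BX[OF x] BX0 component_le_norm_cart[of "gq a m x" b] component_le_norm_cart[of "X x" b]
        by (intro add_mono mult_mono) (auto intro: order_trans)
      finally have "\<bar>dY m a x $ b\<bar> \<le> Bh * B + B * BX" .
      moreover have "0 \<le> Bh * B + B * BX" using BX0 by simp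
      ultimately show "\<bar>(\<chi> a. if a = i then axis j 1 else (\<chi> k. dY m k x) $ a) $ a $ b\<bar> \<le> Bh * B + B * BX + 1"
        by (auto simp: axis_def)
    qed
  qed
  then obtain BC where BC: "\<And>m i j x. norm x = 1 \<Longrightarrow> \<bar>C m i j x\<bar> \<le> BC" by blast
  have cs: "continuous_on (sphere 0 1) w" "continuous_on (sphere 0 1) gw" "continuous_on (sphere 0 1) e"
    "continuous_on (sphere 0 1) ge" "continuous_on (sphere 0 1) gz" "continuous_on (sphere 0 1) Gz"
    using has_C1_grad_continuous_sphere[OF w] has_C1_grad_continuous_sphere[OF e1]
      has_C1_grad_continuous_sphere[OF z1]
      continuous_on_subset[OF has_C2_grad_continuous_hess[OF z] punctured_sphere_subset] by simp_all
  \<comment> \<open>The coefficient of \<open>C m i j\<close> in \<open>T m\<close> does not depend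
    on m; dominated convergence therefore reduces to bounding the cofactors and to their pointwise
    limit.\<close>
  define a where "a i j x = w x * e x * Gz x $ i $ j + gz x $ i * (w x * ge x $ j + e x * gw x $ j)" for i j x
  have Ta: "T m x = (\<Sum>j\<in>UNIV. \<Sum>i\<in>UNIV. C m i j x * a i j x)" for m x
    by (simp add: T_def a_def sum_distrib_left sum_distrib_right sum.distrib[symmetric] algebra_simps)
  have ca: "continuous_on (sphere 0 1) (a i j)" for i j
    unfolding a_def using cs by (intro continuous_intros)
  have "\<exists>b. \<forall>x. norm x = 1 \<longrightarrow> norm (a i j x) \<le> b" for i j
    using continuous_sphere_bounded[OF ca[of i j]] by blast
  then obtain b where b: "\<And>i j x. norm x = 1 \<Longrightarrow> \<bar>a i j x\<bar> \<le> b i j" unfolding real_norm_def by metis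
  have "(\<lambda>m. sph_int (T m)) \<longlonglongrightarrow> sph_int TG"
  proof (rule sph_int_tendsto)
    show "continuous_on (sphere 0 1) (T m)" for m
      unfolding T_def using cs has_C1_grad_continuous_sphere(1)[OF C1] by (intro continuous_intros) auto
    fix x :: "real^'n" assume x: "norm x = 1"
    have BC0: "0 \<le> BC" using BC[OF x] abs_ge_zero order_trans by blast
    show "\<bar>T m x\<bar> \<le> (\<Sum>j\<in>UNIV. \<Sum>i\<in>UNIV. BC * b i j)" for m
      unfolding Ta
      by (intro order_trans[OF sum_abs] sum_mono) (auto simp: abs_mult intro!: mult_mono BC[OF x] b[OF x] BC0)
    show "(\<lambda>m. T m x) \<longlonglongrightarrow> TG x"
      unfolding T_def TG_def by (intro tendsto_intros Clim[OF x])
  qed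
  then have "sph_int TG = 0" unfolding TI by (simp add: LIMSEQ_const_iff)
  also have "sph_int TG = sph_int (\<lambda>x. w x * (h x powr (p + 2) * trace (Gi x ** Gz x)) + h x powr (p + 2) * (gw x \<bullet> (Gi x *v gz x)))"
  proof (rule sph_int_cong)
    fix x :: "real^'n" assume x: "norm x = 1"
    then have x0: "x \<noteq> 0" by auto
    have CGx: "CG i j x = det (G x) * Gi x $ j $ i" for i j
      unfolding CG_def by (rule cofactor_eq_inverse[OF det_G_nz[OF x]])
    have ed: "e x * det (G x) = h x powr (p + 2)"
      unfolding e_def det_G[OF x] powr_add[symmetric] by (simp add: add.commute)
    have 1: "(\<Sum>j\<in>UNIV. \<Sum>i\<in>UNIV. CG i j x * Gz x $ i $ j) = det (G x) * trace (Gi x ** Gz x)"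
      by (simp add: CGx trace_def matrix_matrix_mult_def sum_distrib_left mult.assoc)
    have 2: "(\<Sum>i\<in>UNIV. CG i j x * gz x $ i) = det (G x) * (Gi x *v gz x) $ j" for j
      by (simp add: CGx matrix_vector_mult_def sum_distrib_left mult.assoc)
    have "(\<Sum>j\<in>UNIV. (\<Sum>i\<in>UNIV. CG i j x * gz x $ i) * (w x * ge x $ j + e x * gw x $ j)) =
       det (G x) * ((w x *\<^sub>R ge x + e x *\<^sub>R gw x) \<bullet> (Gi x *v gz x))"
      unfolding 2 by (simp add: inner_vec_def sum_distrib_left mult_ac)
    also have "\<dots> = det (G x) * e x * (gw x \<bullet> (Gi x *v gz x))"
    proof -
      have "X x \<bullet> (Gi x *v gz x) = (x /\<^sub>R h x) \<bullet> gz x"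
        using Gi_self_adjoint[OF x, of "X x" "gz x"] Gi_X[OF x] by simp
      also have "\<dots> = 0" using homogeneous_euler[OF z1 z0 x0] by simp
      finally show ?thesis by (simp add: ge_def inner_add_left)
    qed
    finally have 3: "(\<Sum>j\<in>UNIV. (\<Sum>i\<in>UNIV. CG i j x * gz x $ i) * (w x * ge x $ j + e x * gw x $ j)) = det (G x) * e x * (gw x \<bullet> (Gi x *v gz x))" .
    show "TG x = w x * (h x powr (p + 2) * trace (Gi x ** Gz x)) + h x powr (p + 2) * (gw x \<bullet> (Gi x *v gz x))"
      unfolding TG_def 1 3 ed[symmetric] by (simp add: mult_ac)
  qed
  also have "\<dots> = sph_int (\<lambda>x. w x * (h x powr (p + 2) * trace (Gi x ** Gz x))) + energy gw gz"
    unfolding energy_def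
  proof (rule sph_int_add)
    show "continuous_on (sphere 0 1) (\<lambda>x. w x * (h x powr (p + 2) * trace (Gi x ** Gz x)))"
      unfolding trace_def matrix_matrix_mult_def vec_lambda_beta
      by (intro continuous_on_mult continuous_on_sum continuous_on_component cs continuous_sphere)
    show "continuous_on (sphere 0 1) (\<lambda>x. h x powr (p + 2) * (gw x \<bullet> (Gi x *v gz x)))"
      by (intro continuous_on_mult continuous_on_inner continuous_on_matrix_vector cs continuous_sphere)
  qed
  finally show ?thesis by simp
qed

end

section \<open>Trace formulas and integral identities for h and X\<close>

lemma trace_mult_outer: "trace (M ** outer u v) = v \<bullet> (M *v u)"
  by (simp add: trace_def matrix_matrix_mult_def outer_def inner_vec_def matrix_vector_mult_def
      sum_distrib_left mult_ac)

lemma trace_scaleR: "trace (c *\<^sub>R M) = c * trace M"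
  by (simp add: trace_def sum_distrib_left)

lemma matrix_add_distrib: "(A :: real^'n::finite^'m::finite) ** (B + C) = A ** B + A ** C"
  by (simp add: vec_eq_iff matrix_matrix_mult_def sum.distrib distrib_left)

lemma matrix_mult_scaleR_right: "(A :: real^'n::finite^'m::finite) ** (c *\<^sub>R B) = c *\<^sub>R (A ** B)"
  by (simp add: vec_eq_iff matrix_matrix_mult_def sum_distrib_left mult_ac)

lemma bilinear_form_bound:
  fixes M :: "real^'n::finite^'n"
  assumes "norm u \<le> B" "norm v \<le> B"
  shows "\<bar>u \<bullet> (M *v v)\<bar> \<le> (\<Sum>i\<in>UNIV. \<Sum>j\<in>UNIV. \<bar>M $ i $ j\<bar>) * B\<^sup>2"
proof -
  have B: "0 \<le> B" using assms(1) norm_ge_zero order_trans by blast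
  have "u \<bullet> (M *v v) = (\<Sum>i\<in>UNIV. \<Sum>j\<in>UNIV. M $ i $ j * (u $ i * v $ j))"
    by (simp add: inner_vec_def matrix_vector_mult_def sum_distrib_left mult_ac)
  also have "\<bar>\<dots>\<bar> \<le> (\<Sum>i\<in>UNIV. \<Sum>j\<in>UNIV. \<bar>M $ i $ j\<bar> * B\<^sup>2)"
  proof (intro order_trans[OF sum_abs] sum_mono)
    fix i j
    have "\<bar>u $ i\<bar> * \<bar>v $ j\<bar> \<le> B * B"
      using assms component_le_norm_cart[of u i] component_le_norm_cart[of v j] B
      by (intro mult_mono) auto
    then show "\<bar>M $ i $ j * (u $ i * v $ j)\<bar> \<le> \<bar>M $ i $ j\<bar> * B\<^sup>2"
      by (simp add: abs_mult power2_eq_square mult_left_mono)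
  qed
  finally show ?thesis by (simp add: sum_distrib_right)
qed

context minkowski_solution
begin

lemma hpos: "norm x = 1 \<Longrightarrow> h x > 0"
  using pos[of x] by force

lemma h_powr: "norm x = 1 \<Longrightarrow> h x powr (p + 2) = h x powr p * (h x)\<^sup>2"
    "norm x = 1 \<Longrightarrow> h x powr (p + 1) = h x powr p * h x"
    "norm x = 1 \<Longrightarrow> h x powr (p - 2) = h x powr p * inverse ((h x)\<^sup>2)"
  using hpos[of x] by (simp_all add: powr_add powr_diff powr_numeral divide_inverse)

text \<open>Up to the factor \<open>n\<close>, integration against the cone volume measure.\<close>

definition wint :: "(real^'n \<Rightarrow> real) \<Rightarrow> real" where
  "wint f = sph_int (\<lambda>x. h x powr p * f x)"

lemma wint_cong: "(\<And>x. norm x = 1 \<Longrightarrow> f x = g x) \<Longrightarrow> wint f = wint g"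
  unfolding wint_def by (rule sph_int_cong) simp

lemma wint_add:
  "continuous_on (sphere 0 1) f \<Longrightarrow> continuous_on (sphere 0 1) g \<Longrightarrow> wint (\<lambda>x. f x + g x) = wint f + wint g"
  unfolding wint_def distrib_left by (intro sph_int_add continuous_on_mult continuous_sphere)

lemma wint_diff:
  "continuous_on (sphere 0 1) f \<Longrightarrow> continuous_on (sphere 0 1) g \<Longrightarrow> wint (\<lambda>x. f x - g x) = wint f - wint g"
  unfolding wint_def right_diff_distrib by (intro sph_int_diff continuous_on_mult continuous_sphere)

lemma wint_cmult: "wint (\<lambda>x. c * f x) = c * wint f"
  unfolding wint_def using sph_int_mult_left[of c] by (simp add: mult.left_commute)

lemma wint_sum:
  assumes "finite I" "\<And>i. i \<in> I \<Longrightarrow> continuous_on (sphere 0 1) (f i)"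
  shows "wint (\<lambda>x. \<Sum>i\<in>I. f i x) = (\<Sum>i\<in>I. wint (f i))"
  unfolding wint_def sum_distrib_left
  by (intro sph_int_sum continuous_on_mult continuous_sphere assms)

lemma wint_nonneg:
  "continuous_on (sphere 0 1) f \<Longrightarrow> (\<And>x. norm x = 1 \<Longrightarrow> f x \<ge> 0) \<Longrightarrow> wint f \<ge> 0"
  unfolding wint_def by (intro sph_int_nonneg continuous_on_mult continuous_sphere) auto

lemma wint_eq_0_imp:
  assumes "continuous_on (sphere 0 1) f" "\<And>x. norm x = 1 \<Longrightarrow> f x \<ge> 0" "wint f = 0" "norm u = 1"
  shows "f u = 0"
proof -
  have "h u powr p * f u = 0"
    by (rule sph_int_eq_0_imp[where f = "\<lambda>x. h x powr p * f x"])
       (use assms in \<open>auto simp: wint_def intro!: continuous_on_mult continuous_sphere\<close>)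
  then show ?thesis using hpos[OF assms(4)] by simp
qed

lemma wint_pos:
  assumes "continuous_on (sphere 0 1) f" "\<And>x. norm x = 1 \<Longrightarrow> f x > 0"
  shows "wint f > 0"
proof -
  obtain u :: "real^'n" where u: "norm u = 1" using vector_choose_size[of 1] by auto
  have "wint f \<ge> 0" using assms by (intro wint_nonneg) (auto intro: less_imp_le)
  moreover have "wint f \<noteq> 0"
    using wint_eq_0_imp[OF assms(1) _ _ u] assms(2) u by (metis less_irrefl less_imp_le)
  ultimately show ?thesis by simp
qed

lemma wint_tendsto:
  assumes "\<And>m. continuous_on (sphere 0 1) (f m)" "\<And>m x. norm x = 1 \<Longrightarrow> \<bar>f m x\<bar> \<le> B"
    and "\<And>x. norm x = 1 \<Longrightarrow> (\<lambda>m. f m x) \<longlonglongrightarrow> g x"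
  shows "(\<lambda>m. wint (f m)) \<longlonglongrightarrow> wint g"
proof -
  obtain C where C: "\<And>x. norm x = 1 \<Longrightarrow> norm (h x powr p) \<le> C"
    using continuous_sphere_bounded[OF continuous_sphere(5)[of p]] by blast
  show ?thesis unfolding wint_def
  proof (rule sph_int_tendsto)
    fix m and x :: "real^'n" assume x: "norm x = 1"
    have "norm (h x powr p) \<le> C" by (rule C[OF x])
    moreover from this have "0 \<le> C" using norm_ge_zero order_trans by blast
    ultimately show "\<bar>h x powr p * f m x\<bar> \<le> C * B"
      using assms(2)[OF x, of m] by (simp add: abs_mult mult_mono)
  qed (use assms in \<open>auto intro!: continuous_on_mult continuous_sphere tendsto_intros\<close>)
qed

text \<open>When h is the support function of K, V is n times the volume of K and S the total mass
  of its L_2-surface-area measure, both with the equation inserted.\<close>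

definition V :: real where "V = wint (\<lambda>x. 1)"
definition S :: real where "S = wint (\<lambda>x. inverse ((h x)\<^sup>2))"

lemma continuous_inverse_h: "continuous_on (sphere 0 1) (\<lambda>x. inverse (h x))"
  using hpos by (intro continuous_intros continuous_sphere) force

lemma V_pos: "V > 0"
  unfolding V_def by (rule wint_pos) auto

lemma S_pos: "S > 0"
  unfolding S_def power_inverse[symmetric]
  using hpos by (intro wint_pos continuous_on_power continuous_inverse_h) force

lemma continuous_energy:
  assumes "continuous_on (sphere 0 1) u" "continuous_on (sphere 0 1) v"
  shows "continuous_on (sphere 0 1) (\<lambda>x. h x powr (p + 2) * (u x \<bullet> (Gi x *v v x)))"
  by (intro continuous_on_mult continuous_on_inner continuous_on_matrix_vector continuous_sphere assms)

lemma energy_sym: "energy u v = energy v u"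
  unfolding energy_def by (rule sph_int_cong) (metis Gi_self_adjoint inner_commute)

lemma energy_diff_left:
  assumes "continuous_on (sphere 0 1) u" "continuous_on (sphere 0 1) u'" "continuous_on (sphere 0 1) v"
  shows "energy (\<lambda>x. u x - u' x) v = energy u v - energy u' v"
  unfolding energy_def inner_diff_left right_diff_distrib
  by (intro sph_int_diff continuous_energy assms)

lemma energy_diff:
  assumes "continuous_on (sphere 0 1) u" "continuous_on (sphere 0 1) v"
  shows "energy (\<lambda>x. u x - v x) (\<lambda>x. u x - v x) = energy u u - 2 * energy u v + energy v v"
proof -
  have c: "continuous_on (sphere 0 1) (\<lambda>x. u x - v x)" using assms by (intro continuous_on_diff)
  have "energy (\<lambda>x. u x - v x) (\<lambda>x. u x - v x) = energy (\<lambda>x. u x - v x) u - energy (\<lambda>x. u x - v x) v"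
    using energy_diff_left[OF assms c] by (metis energy_sym)
  then show ?thesis
    by (simp add: energy_diff_left assms energy_sym[of v u])
qed

text \<open>The extension of \<open>ell\<close> to a function that is homogeneous of degree
  0.\<close>

definition L :: "real^'n \<Rightarrow> real^'n \<Rightarrow> real" where
  "L v x = (x \<bullet> v) * inverse (h x)"

definition gL :: "real^'n \<Rightarrow> real^'n \<Rightarrow> real^'n" where
  "gL v x = (x \<bullet> v) *\<^sub>R ((- inverse ((h x)\<^sup>2)) *\<^sub>R X x) + inverse (h x) *\<^sub>R v"

lemma L_C2: "\<exists>GL. has_C2_grad (L v) (gL v) GL"
proof -
  obtain G' where "has_C2_grad (\<lambda>x. inverse (h x)) (\<lambda>x. (- inverse ((h x)\<^sup>2)) *\<^sub>R X x) G'"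
    using has_C2_grad_inverse_ex[OF h2 pos] by blast
  from has_C2_grad_mult[OF has_C2_grad_inner[of v] this]
  show ?thesis unfolding L_def[abs_def] gL_def[abs_def] by blast
qed

lemma L_C1: "has_C1_grad (L v) (gL v)"
  using L_C2 has_C2_gradD1 by blast

lemma continuous_L: "continuous_on (sphere 0 1) (L v)" "continuous_on (sphere 0 1) (gL v)"
  using has_C1_grad_continuous_sphere[OF L_C1] by auto

lemma L_hom: "homogeneous 0 (L v)"
  unfolding homogeneous_def L_def using homogeneousD[OF hom] by auto

lemma trace_Gi_H:
  assumes x: "norm x = 1"
  shows "trace (Gi x ** H x) = (real CARD('n) - 1) / h x"
proof -
  have x0: "x \<noteq> 0" using x by auto
  have "trace (Gi x ** H x) = (\<Sum>k\<in>UNIV. (Gi x *v (H x $ k)) $ k)"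
    using H_sym[OF x0] by (simp add: trace_def matrix_matrix_mult_def matrix_vector_mult_def)
  also have "\<dots> = (\<Sum>k\<in>UNIV. inverse (h x) * (1 - inverse (h x) * (x $ k * X x $ k)))"
    unfolding Gi_H[OF x] by (intro sum.cong) (auto simp: divide_inverse mult_ac)
  also have "\<dots> = inverse (h x) * (real CARD('n) - inverse (h x) * (x \<bullet> X x))"
    by (simp add: sum_distrib_left[symmetric] sum_subtractf inner_vec_def)
  finally show ?thesis using inner_X[OF x0] hpos[OF x] by (simp add: divide_inverse mult.commute)
qed

text \<open>The product rule for the Hessian of z h. The mixed terms contract to the inner product
  of grad z with G^(-1) X, a multiple of x, and vanish by Euler's relation. The right-hand side is n
  - 1 times the Hilbert-Brunn-Minkowski operator applied to z.\<close>

lemma trace_Gi_hess: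
  assumes z: "has_C2_grad z gz Gz" and z0: "homogeneous 0 z"
    and zh: "has_C2_grad (\<lambda>x. z x * h x) gf Gf" and x: "norm x = 1"
  shows "(h x)\<^sup>2 * trace (Gi x ** Gz x) = h x * trace (Gi x ** Gf x) - (real CARD('n) - 1) * z x"
proof -
  have x0: "x \<noteq> 0" using x by auto
  have Gf: "Gf x = z x *\<^sub>R H x + outer (X x) (gz x) + (h x *\<^sub>R Gz x + outer (gz x) (X x))"
    using hess_eq[OF zh x0] hess_eq[OF has_C2_grad_mult[OF z h2] x0] by simp
  have 0: "gz x \<bullet> (Gi x *v X x) = 0" "X x \<bullet> (Gi x *v gz x) = 0"
    using homogeneous_euler[OF has_C2_gradD1[OF z] z0 x0] Gi_self_adjoint[OF x, of "X x" "gz x"] Gi_X[OF x]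
    by (simp_all add: inner_commute)
  have "trace (Gi x ** Gf x) = z x * ((real CARD('n) - 1) / h x) + h x * trace (Gi x ** Gz x)"
    unfolding Gf matrix_add_distrib matrix_mult_scaleR_right trace_add trace_scaleR trace_mult_outer 0 trace_Gi_H[OF x]
    by simp
  then show ?thesis using hpos[OF x] by (simp add: field_simps power2_eq_square)
qed

text \<open>The inverse of \<open>H x + outer x x\<close> differs from h G^(-1) only by outer
  products having x as one factor, and these have trace zero against a symmetric matrix that
  annihilates x.\<close>

lemma trace_inverse_A:
  assumes x: "norm x = 1" and \<Phi>: "transpose \<Phi> = \<Phi>" "\<Phi> *v x = 0"
  shows "trace (matrix_inv (H x + outer x x) ** \<Phi>) = h x * trace (Gi x ** \<Phi>)"
proof -
  let ?A = "H x + outer x x"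
  have x0: "x \<noteq> 0" using x by auto
  have xx: "x \<bullet> x = 1" using x by (simp add: norm_eq_1)
  have dA: "det ?A \<noteq> 0" using det_A[OF x] hpos[OF x] by simp
  let ?Ai = "matrix_inv ?A"
  define a where "a = transpose ?Ai *v X x"
  have "?Ai = h x *\<^sub>R Gi x + (- h x) *\<^sub>R outer (Gi x *v x) x + outer (x /\<^sub>R h x) a"
  proof (rule matrix_eq[THEN iffD2, rule_format])
    fix v
    define u where "u = ?Ai *v v"
    have v: "v = H x *v u + (x \<bullet> u) *\<^sub>R x"
      using matrix_inv_mult_vec(1)[OF dA, of v] by (simp only: u_def[symmetric] matrix_vector_mult_add_rdistrib outer_mult_vec)
    have xv: "x \<bullet> v = x \<bullet> u" by (subst v) (simp add: inner_add_right H_tangential[OF x0] xx)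
    have au: "a \<bullet> v = X x \<bullet> u"
      unfolding a_def u_def by (metis dot_lmul_matrix vector_transpose_matrix transpose_transpose)
    have "G x *v u = h x *\<^sub>R (v - (x \<bullet> v) *\<^sub>R x) + (a \<bullet> v) *\<^sub>R X x"
      unfolding G_mult au xv by (subst v) simp
    then have "Gi x *v (G x *v u) = Gi x *v (h x *\<^sub>R (v - (x \<bullet> v) *\<^sub>R x) + (a \<bullet> v) *\<^sub>R X x)" by simp
    then have "u = h x *\<^sub>R (Gi x *v v - (x \<bullet> v) *\<^sub>R (Gi x *v x)) + (a \<bullet> v) *\<^sub>R (x /\<^sub>R h x)"
      by (simp only: matrix_inv_mult_vec(2)[OF det_G_nz[OF x]] matrix_vector_right_distrib
          matrix_vector_mult_scaleR matrix_vector_mult_diff_distrib Gi_X[OF x])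
    then show "?Ai *v v = (h x *\<^sub>R Gi x + (- h x) *\<^sub>R outer (Gi x *v x) x + outer (x /\<^sub>R h x) a) *v v"
      unfolding u_def[symmetric] matrix_vector_mult_add_rdistrib outer_mult_vec scaleR_matrix_vector_assoc[symmetric]
      by (simp add: scaleR_right_diff_distrib)
  qed
  then have "trace (\<Phi> ** ?Ai) = h x * trace (\<Phi> ** Gi x) + (- h x) * (x \<bullet> (\<Phi> *v (Gi x *v x))) + a \<bullet> (\<Phi> *v (x /\<^sub>R h x))"
    by (simp only: matrix_add_distrib matrix_mult_scaleR_right trace_add trace_scaleR trace_mult_outer)
  also have "x \<bullet> (\<Phi> *v (Gi x *v x)) = (\<Phi> *v x) \<bullet> (Gi x *v x)"
    using \<Phi>(1) by (metis dot_lmul_matrix vector_transpose_matrix)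
  finally show ?thesis
    using \<Phi>(2) by (simp add: matrix_vector_mult_scaleR trace_mul_sym[of _ \<Phi>])
qed

text \<open>The product of \<open>L v\<close> and h is linear and has Hessian zero, so
  \<open>L v\<close> is an eigenfunction; the eigenvalue 1 appears as n - 1 because
  \<open>energy\<close> is not divided by n - 1.\<close>

lemma weak_form_L:
  assumes w: "has_C1_grad w gw" and w0: "homogeneous 0 w"
  shows "energy gw (gL v) = (real CARD('n) - 1) * wint (\<lambda>x. w x * L v x)"
proof -
  obtain GL where GL: "has_C2_grad (L v) (gL v) GL" using L_C2 by blast
  have f: "has_C2_grad (\<lambda>x. L v x * h x) (\<lambda>_. v) (\<lambda>_. 0)"
    by (rule has_C2_grad_cong[OF has_C2_grad_inner]) (simp add: L_def less_imp_neq[OF pos, symmetric])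
  have "- energy gw (gL v) = sph_int (\<lambda>x. w x * (h x powr (p + 2) * trace (Gi x ** GL x)))"
    by (rule weak_form[OF GL L_hom w w0, symmetric])
  also have "\<dots> = sph_int (\<lambda>x. - (real CARD('n) - 1) * (h x powr p * (w x * L v x)))"
  proof (rule sph_int_cong)
    fix x :: "real^'n" assume x: "norm x = 1"
    have "(h x)\<^sup>2 * trace (Gi x ** GL x) = - (real CARD('n) - 1) * L v x"
      using trace_Gi_hess[OF GL L_hom f x] by (simp add: trace_def matrix_matrix_mult_def algebra_simps)
    then show "w x * (h x powr (p + 2) * trace (Gi x ** GL x)) = - (real CARD('n) - 1) * (h x powr p * (w x * L v x))"
      unfolding h_powr(1)[OF x] by (metis (no_types, opaque_lifting) mult.assoc mult.left_commute)
  qed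
  also have "\<dots> = - (real CARD('n) - 1) * wint (\<lambda>x. w x * L v x)"
    unfolding wint_def by (rule sph_int_mult_left)
  finally show ?thesis by (simp only: mult_minus_left neg_equal_iff_equal)
qed

text \<open>Tested against the constant 1, whose gradient vanishes. As h^(p-1) is the density of the
  surface area measure, this is the classical fact that this measure is centered at the
  origin.\<close>

lemma wint_L:
  assumes "CARD('n) \<ge> 2"
  shows "wint (L v) = 0"
proof -
  have "energy (\<lambda>x. 0) (gL v) = (real CARD('n) - 1) * wint (\<lambda>x. 1 * L v x)"
    by (rule weak_form_L[OF has_C1_grad_const homogeneous_const])
  moreover have "energy (\<lambda>x. 0) (gL v) = 0" by (simp add: energy_def)
  ultimately show ?thesis using assms by simp
qed

text \<open>By \<open>Gi_H\<close> the energy density of X_k is h^(p+1) H_kk. The divergence theorem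
  for h^(p+1) X_k, whose degree p + 1 enters through Euler's relation, removes the second
  derivatives.\<close>

lemma sum_energy_X:
  "(\<Sum>k\<in>UNIV. energy (\<lambda>x. H x $ k) (\<lambda>x. H x $ k)) =
    - (p + 1) * wint (\<lambda>x. X x \<bullet> X x) + (p + real CARD('n)) * wint (\<lambda>x. (h x)\<^sup>2)"
proof -
  let ?f = "\<lambda>k x. h x powr (p + 1) * X x $ k"
  let ?g = "\<lambda>k x. h x powr (p + 1) *\<^sub>R (H x $ k) + X x $ k *\<^sub>R (((p + 1) * h x powr (p + 1 - 1)) *\<^sub>R X x)"
  have f1: "has_C1_grad (?f k) (?g k)" for k
    by (rule has_C1_grad_mult[OF has_C1_grad_powr[OF h1 pos] X1])
  have f0: "homogeneous (p + 1) (?f k)" for k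
    using homogeneous_mult[OF homogeneous_powr[OF hom pos, of "p + 1"] homX, of k] by simp
  have cX: "continuous_on (sphere 0 1) (\<lambda>x. X x $ k)" for k
    using continuous_sphere(2) by (rule continuous_on_component)
  have cH: "continuous_on (sphere 0 1) (\<lambda>x. H x $ k)" for k
    using continuous_sphere(3) by (rule continuous_on_component)
  have e: "energy (\<lambda>x. H x $ k) (\<lambda>x. H x $ k) = sph_int (\<lambda>x. h x powr (p + 1) * H x $ k $ k)" for k
    unfolding energy_def
  proof (rule sph_int_cong)
    fix x :: "real^'n" assume x: "norm x = 1"
    then have x0: "x \<noteq> 0" by auto
    have "H x $ k \<bullet> x = 0"
      using H_radial[OF x0] by (metis matrix_vector_mul_component zero_index)
    then have "H x $ k \<bullet> (Gi x *v (H x $ k)) = inverse (h x) * H x $ k $ k"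
      unfolding Gi_H[OF x] by (simp add: inner_diff_right inner_axis)
    then show "h x powr (p + 2) * (H x $ k \<bullet> (Gi x *v (H x $ k))) = h x powr (p + 1) * H x $ k $ k"
      unfolding h_powr(1,2)[OF x] using hpos[OF x] by (simp add: power2_eq_square)
  qed
  have d: "sph_int (\<lambda>x. ?g k x $ k - x $ k * (x \<bullet> ?g k x)) = (real CARD('n) - 1) * sph_int (\<lambda>x. x $ k * ?f k x)" for k
    by (rule sph_int_divergence[OF f1])
  have "sph_int (\<lambda>x. h x powr (p + 1) * H x $ k $ k) =
      - (p + 1) * wint (\<lambda>x. X x $ k * X x $ k) + (p + real CARD('n)) * wint (\<lambda>x. h x * (x $ k * X x $ k))" for k
  proof -
    have "(real CARD('n) - 1) * wint (\<lambda>x. h x * (x $ k * X x $ k)) =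
       sph_int (\<lambda>x. ?g k x $ k - x $ k * (x \<bullet> ?g k x))"
      unfolding d wint_def
      by (rule arg_cong[where f = "\<lambda>t. (real CARD('n) - 1) * t"], rule sph_int_cong) (simp add: h_powr(2) mult_ac)
    also have "\<dots> = sph_int (\<lambda>x. h x powr (p + 1) * H x $ k $ k + ((p + 1) * (h x powr p * (X x $ k * X x $ k)) - (p + 1) * (h x powr p * (h x * (x $ k * X x $ k)))))"
    proof (rule sph_int_cong)
      fix x :: "real^'n" assume x: "norm x = 1"
      then have x0: "x \<noteq> 0" by auto
      have "x \<bullet> ?g k x = (p + 1) * ?f k x" by (rule homogeneous_euler[OF f1 f0 x0])
      then show "?g k x $ k - x $ k * (x \<bullet> ?g k x) = h x powr (p + 1) * H x $ k $ k + ((p + 1) * (h x powr p * (X x $ k * X x $ k)) - (p + 1) * (h x powr p * (h x * (x $ k * X x $ k))))"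
        by (simp only:) (simp add: h_powr(2)[OF x] mult_ac)
    qed
    also have "\<dots> = sph_int (\<lambda>x. h x powr (p + 1) * H x $ k $ k) + ((p + 1) * wint (\<lambda>x. X x $ k * X x $ k) - (p + 1) * wint (\<lambda>x. h x * (x $ k * X x $ k)))"
      unfolding wint_def sph_int_mult_left[symmetric]
      using cX cH by (subst sph_int_add sph_int_diff, auto intro!: continuous_intros continuous_sphere)+
    finally show ?thesis by (simp add: algebra_simps)
  qed
  then have "(\<Sum>k\<in>UNIV. energy (\<lambda>x. H x $ k) (\<lambda>x. H x $ k)) =
     (\<Sum>k\<in>UNIV. - (p + 1) * wint (\<lambda>x. X x $ k * X x $ k) + (p + real CARD('n)) * wint (\<lambda>x. h x * (x $ k * X x $ k)))"
    unfolding e by simp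
  also have "\<dots> = - (p + 1) * (\<Sum>k\<in>UNIV. wint (\<lambda>x. X x $ k * X x $ k)) + (p + real CARD('n)) * (\<Sum>k\<in>UNIV. wint (\<lambda>x. h x * (x $ k * X x $ k)))"
    by (simp only: sum.distrib sum_distrib_left)
  also have "(\<Sum>k\<in>UNIV. wint (\<lambda>x. X x $ k * X x $ k)) = wint (\<lambda>x. X x \<bullet> X x)"
    unfolding inner_vec_def inner_real_def using cX by (intro wint_sum[symmetric] continuous_on_mult) auto
  also have "(\<Sum>k\<in>UNIV. wint (\<lambda>x. h x * (x $ k * X x $ k))) = wint (\<lambda>x. \<Sum>k\<in>UNIV. h x * (x $ k * X x $ k))"
    using cX by (intro wint_sum[symmetric] continuous_on_mult continuous_sphere continuous_on_component continuous_on_id) auto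
  also have "\<dots> = wint (\<lambda>x. (h x)\<^sup>2)"
  proof (rule wint_cong)
    fix x :: "real^'n" assume "norm x = 1"
    then have "x \<bullet> X x = h x" by (intro inner_X) auto
    then show "(\<Sum>k\<in>UNIV. h x * (x $ k * X x $ k)) = (h x)\<^sup>2"
      by (simp add: sum_distrib_left[symmetric] inner_vec_def power2_eq_square)
  qed
  finally show ?thesis .
qed

text \<open>The energy of X_k against the function of the j-th axis is evaluated twice: the
  eigenvalue relation gives n - 1 times the integral, and the closed form of G^(-1) H_k gives the
  Kronecker term minus the integral.\<close>

lemma wint_X_L:
  "real CARD('n) * wint (\<lambda>x. X x $ k * L (axis j 1) x) = (if j = k then V else 0)"
proof -
  have cX: "continuous_on (sphere 0 1) (\<lambda>x. X x $ k)"
    using continuous_sphere(2) by (rule continuous_on_component)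
  have "(real CARD('n) - 1) * wint (\<lambda>x. X x $ k * L (axis j 1) x) = energy (\<lambda>x. H x $ k) (gL (axis j 1))"
    by (rule weak_form_L[OF X1 homX, symmetric])
  also have "\<dots> = wint (\<lambda>x. (if j = k then 1 else 0) - X x $ k * L (axis j 1) x)"
    unfolding energy_def wint_def
  proof (rule sph_int_cong)
    fix x :: "real^'n" assume x: "norm x = 1"
    then have x0: "x \<noteq> 0" by auto
    have "x \<bullet> gL (axis j 1) x = 0" using homogeneous_euler[OF L_C1 L_hom x0] by simp
    then have "H x $ k \<bullet> (Gi x *v gL (axis j 1) x) = inverse (h x) * gL (axis j 1) x $ k"
      using Gi_self_adjoint[OF x, of "H x $ k" "gL (axis j 1) x"]
      by (simp add: Gi_H[OF x] inner_diff_left inner_axis')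
    also have "\<dots> = inverse (h x) * (inverse (h x) * ((if j = k then 1 else 0) - X x $ k * L (axis j 1) x))"
      by (simp add: gL_def L_def inner_axis axis_def power2_eq_square algebra_simps)
    finally show "h x powr (p + 2) * (H x $ k \<bullet> (Gi x *v gL (axis j 1) x)) = h x powr p * ((if j = k then 1 else 0) - X x $ k * L (axis j 1) x)"
      unfolding h_powr(1)[OF x] using hpos[OF x] by (simp only:) (simp add: power2_eq_square field_simps)
  qed
  also have "\<dots> = wint (\<lambda>x. if j = k then 1 else 0) - wint (\<lambda>x. X x $ k * L (axis j 1) x)"
    by (intro wint_diff continuous_on_mult cX continuous_L continuous_on_const)
  also have "wint (\<lambda>x. if j = k then 1 else 0) = (if j = k then V else 0)"
    by (simp add: V_def wint_def)
  finally show ?thesis by (simp add: algebra_simps)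
qed

text \<open>The divergence theorem for h^(p+1). It links the integral of X to that of its tangential
  part X - h x.\<close>

lemma wint_X:
  "(p + 1) * wint (\<lambda>x. X x $ k) = (p + real CARD('n)) * wint (\<lambda>x. h x * x $ k)"
proof -
  let ?f = "\<lambda>x. h x powr (p + 1)"
  let ?g = "\<lambda>x. ((p + 1) * h x powr (p + 1 - 1)) *\<^sub>R X x"
  have f1: "has_C1_grad ?f ?g" by (rule has_C1_grad_powr[OF h1 pos])
  have f0: "homogeneous (p + 1) ?f" using homogeneous_powr[OF hom pos, of "p + 1"] by simp
  have cX: "continuous_on (sphere 0 1) (\<lambda>x. X x $ k)"
    using continuous_sphere(2) by (rule continuous_on_component)
  have "(real CARD('n) - 1) * wint (\<lambda>x. h x * x $ k) = (real CARD('n) - 1) * sph_int (\<lambda>x. x $ k * ?f x)"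
    unfolding wint_def
    by (rule arg_cong[where f = "\<lambda>t. (real CARD('n) - 1) * t"], rule sph_int_cong) (simp add: h_powr(2) mult_ac)
  also have "\<dots> = sph_int (\<lambda>x. ?g x $ k - x $ k * (x \<bullet> ?g x))"
    by (rule sph_int_divergence[OF f1, symmetric])
  also have "\<dots> = wint (\<lambda>x. (p + 1) * X x $ k - (p + 1) * (h x * x $ k))"
    unfolding wint_def
  proof (rule sph_int_cong)
    fix x :: "real^'n" assume x: "norm x = 1"
    then have x0: "x \<noteq> 0" by auto
    have "x \<bullet> ?g x = (p + 1) * ?f x" by (rule homogeneous_euler[OF f1 f0 x0])
    then show "?g x $ k - x $ k * (x \<bullet> ?g x) = h x powr p * ((p + 1) * X x $ k - (p + 1) * (h x * x $ k))"
      by (simp only: h_powr(2)[OF x]) (simp add: algebra_simps)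
  qed
  also have "\<dots> = (p + 1) * wint (\<lambda>x. X x $ k) - (p + 1) * wint (\<lambda>x. h x * x $ k)"
    unfolding wint_cmult[symmetric]
    by (intro wint_diff continuous_on_mult continuous_on_const cX continuous_sphere continuous_on_component continuous_on_id)
  finally show ?thesis by (simp add: algebra_simps)
qed

end

section \<open>The spectral inequality\<close>

text \<open>\<open>\<Lambda>\<close> stands for n - 1 times a lower bound of the second nonzero
  eigenvalue, in accordance with the normalization of \<open>energy\<close>. Isotropy is assumed in
  polarized form.\<close>

locale spectral_gap = minkowski_solution h X H p
  for h :: "real^'n::finite \<Rightarrow> real" and X :: "real^'n \<Rightarrow> real^'n" and H :: "real^'n \<Rightarrow> real^'n^'n" and p :: real +
  fixes \<Lambda> :: real
  assumes dim: "CARD('n) \<ge> 2"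
    and iso: "\<And>u v. wint (\<lambda>x. L u x * L v x) = S / real CARD('n) * (u \<bullet> v)"
    and gap: "\<And>z gz Gz. has_C2_grad z gz Gz \<Longrightarrow> homogeneous 0 z \<Longrightarrow> wint z = 0 \<Longrightarrow>
       (\<And>v. wint (\<lambda>x. z x * L v x) = 0) \<Longrightarrow> \<Lambda> * wint (\<lambda>x. (z x)\<^sup>2) \<le> energy gz gz"
begin

text \<open>The test function is f - c - L a. By isotropy the Gram matrix of the functions
  \<open>L (axis j 1)\<close> is S/n times the identity, whence a = (n/S) b. As \<open>L a\<close>
  is an eigenfunction, subtracting it lowers the energy by n - 1 times its squared norm.\<close>

lemma spectral_inequality_C2:
  assumes f: "has_C2_grad f gf Gf" and f0: "homogeneous 0 f"
  shows "\<Lambda> * (wint (\<lambda>x. (f x)\<^sup>2) - (wint f)\<^sup>2 / V - real CARD('n) / S * (\<Sum>j\<in>UNIV. (wint (\<lambda>x. f x * L (axis j 1) x))\<^sup>2))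
     \<le> energy gf gf - (real CARD('n) - 1) * (real CARD('n) / S * (\<Sum>j\<in>UNIV. (wint (\<lambda>x. f x * L (axis j 1) x))\<^sup>2))"
proof -
  note f1 = has_C2_gradD1[OF f]
  note cf = has_C1_grad_continuous_sphere[OF f1]
  define b where "b = (\<chi> j. wint (\<lambda>x. f x * L (axis j 1) x))"
  define a where "a = (real CARD('n) / S) *\<^sub>R b"
  define c where "c = wint f / V"
  have n0: "real CARD('n) > 0" by simp
  have bb: "(\<Sum>j\<in>UNIV. (wint (\<lambda>x. f x * L (axis j 1) x))\<^sup>2) = b \<bullet> b"
    by (simp add: b_def inner_vec_def power2_eq_square)
  have fL: "wint (\<lambda>x. f x * L v x) = b \<bullet> v" for v
  proof -
    have "wint (\<lambda>x. f x * L v x) = wint (\<lambda>x. \<Sum>j\<in>UNIV. v $ j * (f x * L (axis j 1) x))"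
    proof (rule wint_cong)
      fix x
      have "L v x = (\<Sum>j\<in>UNIV. v $ j * L (axis j 1) x)"
        unfolding L_def inner_axis by (simp add: inner_vec_def[of x v] sum_distrib_left mult_ac)
      then show "f x * L v x = (\<Sum>j\<in>UNIV. v $ j * (f x * L (axis j 1) x))"
        by (simp add: sum_distrib_left mult_ac)
    qed
    also have "\<dots> = (\<Sum>j\<in>UNIV. wint (\<lambda>x. v $ j * (f x * L (axis j 1) x)))"
      using cf by (intro wint_sum continuous_on_mult continuous_on_const continuous_L) auto
    also have "\<dots> = b \<bullet> v"
      by (simp add: wint_cmult b_def inner_vec_def mult.commute)
    finally show ?thesis .
  qed
  obtain GL where GL: "has_C2_grad (L a) (gL a) GL" using L_C2 by blast
  define z where "z x = (f x - c) - L a x" for x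
  define gz where "gz x = gf x - gL a x" for x
  have z2: "has_C2_grad z gz (\<lambda>x. Gf x - 0 - GL x)"
    using has_C2_grad_diff[OF has_C2_grad_diff[OF f has_C2_grad_const] GL] by (simp add: z_def[abs_def] gz_def[abs_def])
  have z0: "homogeneous 0 z"
    using f0 L_hom[of a] by (simp add: homogeneous_def z_def)
  have cz: "continuous_on (sphere 0 1) z"
    using has_C1_grad_continuous_sphere(1)[OF has_C2_gradD1[OF z2]] .
  have wfc: "wint (\<lambda>x. f x - c) = 0"
    using cf V_pos wint_cmult[of c "\<lambda>x. 1"]
    by (subst wint_diff) (auto simp: c_def V_def)
  have wz: "wint z = 0"
    unfolding z_def using cf continuous_L wfc wint_L[OF dim]
    by (subst wint_diff) (auto intro!: continuous_intros)
  have wzL: "wint (\<lambda>x. z x * L v x) = 0" for v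
  proof -
    have "wint (\<lambda>x. z x * L v x) = wint (\<lambda>x. (f x * L v x - c * L v x) - L a x * L v x)"
      by (rule wint_cong) (simp add: z_def algebra_simps)
    also have "\<dots> = (wint (\<lambda>x. f x * L v x) - wint (\<lambda>x. c * L v x)) - wint (\<lambda>x. L a x * L v x)"
      using cf(1) continuous_L by (simp add: wint_diff continuous_on_mult continuous_on_diff)
    also have "\<dots> = 0" using S_pos n0
      by (simp add: fL wint_cmult wint_L[OF dim] iso a_def)
    finally show ?thesis .
  qed
  have aa: "b \<bullet> a = real CARD('n) / S * (b \<bullet> b)" "S / real CARD('n) * (a \<bullet> a) = real CARD('n) / S * (b \<bullet> b)"
    using S_pos n0 by (simp_all add: a_def)
  have zz: "wint (\<lambda>x. (z x)\<^sup>2) = wint (\<lambda>x. (f x)\<^sup>2) - (wint f)\<^sup>2 / V - real CARD('n) / S * (b \<bullet> b)"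
  proof -
    have "wint (\<lambda>x. (z x)\<^sup>2) = wint (\<lambda>x. ((f x)\<^sup>2 - c * f x - f x * L a x) - (c * z x + z x * L a x))"
      by (rule wint_cong) (simp add: z_def power2_eq_square algebra_simps)
    also have "\<dots> = (wint (\<lambda>x. (f x)\<^sup>2) - wint (\<lambda>x. c * f x) - wint (\<lambda>x. f x * L a x)) - (wint (\<lambda>x. c * z x) + wint (\<lambda>x. z x * L a x))"
      using cf(1) cz continuous_L
      by (simp add: wint_diff wint_add continuous_on_mult continuous_on_diff continuous_on_add continuous_on_power)
    also have "\<dots> = wint (\<lambda>x. (f x)\<^sup>2) - (wint f)\<^sup>2 / V - real CARD('n) / S * (b \<bullet> b)"
      unfolding wint_cmult wz wzL fL aa by (simp add: c_def power2_eq_square)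
    finally show ?thesis .
  qed
  have "energy gz gz = energy gf gf - 2 * energy gf (gL a) + energy (gL a) (gL a)"
    unfolding gz_def by (rule energy_diff[OF cf(2) continuous_L(2)])
  also have "energy gf (gL a) = (real CARD('n) - 1) * (b \<bullet> a)"
    unfolding weak_form_L[OF f1 f0] fL ..
  also have "energy (gL a) (gL a) = (real CARD('n) - 1) * (real CARD('n) / S * (b \<bullet> b))"
    unfolding weak_form_L[OF L_C1 L_hom] iso aa ..
  finally have "energy gz gz = energy gf gf - (real CARD('n) - 1) * (real CARD('n) / S * (b \<bullet> b))"
    unfolding aa by simp
  with gap[OF z2 z0 wz wzL] show ?thesis unfolding zz bb by simp
qed

text \<open>All terms depend only on values and gradients on the sphere, which for the difference
  quotients are bounded and converge pointwise; the inequality therefore survives the limit although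
  X_k is only C^1.\<close>

lemma spectral_inequality_X:
  "\<Lambda> * (wint (\<lambda>x. (X x $ k)\<^sup>2) - (wint (\<lambda>x. X x $ k))\<^sup>2 / V - real CARD('n) / S * (\<Sum>j\<in>UNIV. (wint (\<lambda>x. X x $ k * L (axis j 1) x))\<^sup>2))
     \<le> energy (\<lambda>x. H x $ k) (\<lambda>x. H x $ k) - (real CARD('n) - 1) * (real CARD('n) / S * (\<Sum>j\<in>UNIV. (wint (\<lambda>x. X x $ k * L (axis j 1) x))\<^sup>2))"
proof -
  obtain q gq B where q2: "\<And>k m. \<exists>G. has_C2_grad (q k m) (gq k m) G"
    and q0: "\<And>k m. homogeneous 0 (q k m)"
    and qB: "\<And>k m x. norm x = 1 \<Longrightarrow> \<bar>q k m x\<bar> \<le> B" "\<And>k m x. norm x = 1 \<Longrightarrow> norm (gq k m x) \<le> B"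
    and qlim: "\<And>k x. norm x = 1 \<Longrightarrow> (\<lambda>m. q k m x) \<longlonglongrightarrow> X x $ k"
      "\<And>k x. norm x = 1 \<Longrightarrow> (\<lambda>m. gq k m x) \<longlonglongrightarrow> H x $ k"
    using partial_deriv_C2_approximation[OF h2 hom] by blast
  have cq: "continuous_on (sphere 0 1) (q k m)" "continuous_on (sphere 0 1) (gq k m)" for m
  proof -
    obtain G' where "has_C2_grad (q k m) (gq k m) G'" using q2 by blast
    from has_C1_grad_continuous_sphere[OF has_C2_gradD1[OF this]]
    show "continuous_on (sphere 0 1) (q k m)" "continuous_on (sphere 0 1) (gq k m)" by auto
  qed
  have 1: "(\<lambda>m. wint (\<lambda>x. (q k m x)\<^sup>2)) \<longlonglongrightarrow> wint (\<lambda>x. (X x $ k)\<^sup>2)"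
  proof (rule wint_tendsto)
    show "\<bar>(q k m x)\<^sup>2\<bar> \<le> B\<^sup>2" if "norm x = 1" for m x
      using power_mono[OF qB(1)[OF that, of k m] abs_ge_zero, of 2] by simp
  qed (auto intro!: continuous_on_power cq tendsto_power qlim)
  have 2: "(\<lambda>m. wint (q k m)) \<longlonglongrightarrow> wint (\<lambda>x. X x $ k)"
    by (rule wint_tendsto[OF cq(1) qB(1) qlim(1)])
  have 3: "(\<lambda>m. wint (\<lambda>x. q k m x * L (axis j 1) x)) \<longlonglongrightarrow> wint (\<lambda>x. X x $ k * L (axis j 1) x)" for j
  proof -
    obtain C where C: "\<And>x. norm x = 1 \<Longrightarrow> norm (L (axis j 1) x) \<le> C"
      using continuous_sphere_bounded[OF continuous_L(1)[of "axis j 1"]] by blast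
    show ?thesis
    proof (rule wint_tendsto)
      fix m and x :: "real^'n" assume x: "norm x = 1"
      have "0 \<le> B" using qB(1)[OF x] abs_ge_zero order_trans by blast
      then show "\<bar>q k m x * L (axis j 1) x\<bar> \<le> B * C"
        using qB(1)[OF x] C[OF x] by (simp add: abs_mult mult_mono)
    qed (auto intro!: continuous_on_mult cq continuous_L tendsto_intros qlim)
  qed
  have 4: "(\<lambda>m. energy (gq k m) (gq k m)) \<longlonglongrightarrow> energy (\<lambda>x. H x $ k) (\<lambda>x. H x $ k)"
  proof -
    have "continuous_on (sphere 0 1) (\<lambda>x. h x powr (p + 2) * ((\<Sum>i\<in>UNIV. \<Sum>j\<in>UNIV. \<bar>Gi x $ i $ j\<bar>) * B\<^sup>2))"
      by (intro continuous_on_mult continuous_on_sum continuous_on_rabs continuous_on_component continuous_on_const continuous_sphere)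
    from continuous_sphere_bounded[OF this] obtain C where
      C: "\<And>x. norm x = 1 \<Longrightarrow> norm (h x powr (p + 2) * ((\<Sum>i\<in>UNIV. \<Sum>j\<in>UNIV. \<bar>Gi x $ i $ j\<bar>) * B\<^sup>2)) \<le> C" by blast
    show ?thesis unfolding energy_def
    proof (rule sph_int_tendsto)
      fix m and x :: "real^'n" assume x: "norm x = 1"
      have "\<bar>h x powr (p + 2) * (gq k m x \<bullet> (Gi x *v gq k m x))\<bar> \<le> h x powr (p + 2) * ((\<Sum>i\<in>UNIV. \<Sum>j\<in>UNIV. \<bar>Gi x $ i $ j\<bar>) * B\<^sup>2)"
        using bilinear_form_bound[OF qB(2)[OF x, of k m] qB(2)[OF x, of k m], of "Gi x"]
        by (simp add: abs_mult mult_left_mono)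
      also have "\<dots> \<le> C" using C[OF x] by (simp only: real_norm_def abs_le_iff)
      finally show "\<bar>h x powr (p + 2) * (gq k m x \<bullet> (Gi x *v gq k m x))\<bar> \<le> C" .
      show "(\<lambda>m. h x powr (p + 2) * (gq k m x \<bullet> (Gi x *v gq k m x))) \<longlonglongrightarrow> h x powr (p + 2) * (H x $ k \<bullet> (Gi x *v (H x $ k)))"
        using qlim(2)[OF x]
        by (intro tendsto_mult tendsto_const tendsto_inner
            bounded_linear.tendsto[OF matrix_vector_mul_bounded_linear]) auto
    qed (rule continuous_energy[OF cq(2) cq(2)])
  qed
  let ?s = "\<lambda>m. \<Sum>j\<in>UNIV. (wint (\<lambda>x. q k m x * L (axis j 1) x))\<^sup>2"
  let ?s' = "\<Sum>j\<in>UNIV. (wint (\<lambda>x. X x $ k * L (axis j 1) x))\<^sup>2"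
  have s: "?s \<longlonglongrightarrow> ?s'" by (intro tendsto_sum tendsto_power 3)
  have l1: "(\<lambda>m. \<Lambda> * (wint (\<lambda>x. (q k m x)\<^sup>2) - (wint (q k m))\<^sup>2 / V - real CARD('n) / S * ?s m))
      \<longlonglongrightarrow> \<Lambda> * (wint (\<lambda>x. (X x $ k)\<^sup>2) - (wint (\<lambda>x. X x $ k))\<^sup>2 / V - real CARD('n) / S * ?s')"
    using V_pos by (intro tendsto_intros 1 2 s) auto
  have l2: "(\<lambda>m. energy (gq k m) (gq k m) - (real CARD('n) - 1) * (real CARD('n) / S * ?s m))
      \<longlonglongrightarrow> energy (\<lambda>x. H x $ k) (\<lambda>x. H x $ k) - (real CARD('n) - 1) * (real CARD('n) / S * ?s')"
    by (intro tendsto_intros 4 s)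
  have "\<Lambda> * (wint (\<lambda>x. (q k m x)\<^sup>2) - (wint (q k m))\<^sup>2 / V - real CARD('n) / S * ?s m)
      \<le> energy (gq k m) (gq k m) - (real CARD('n) - 1) * (real CARD('n) / S * ?s m)" for m
    using q2[of k m] spectral_inequality_C2[OF _ q0] by blast
  then show ?thesis by (intro LIMSEQ_le[OF l1 l2]) blast
qed

text \<open>By \<open>wint_X_L\<close> each coordinate of X meets only the function of its own axis,
  with coefficient V/n, so the n projection terms (n/S) (V/n)^2 add up to V^2/S.\<close>

lemma spectral_inequality_sum:
  "\<Lambda> * (wint (\<lambda>x. X x \<bullet> X x) - (\<Sum>k\<in>UNIV. (wint (\<lambda>x. X x $ k))\<^sup>2) / V - V\<^sup>2 / S)
    \<le> - (p + 1) * wint (\<lambda>x. X x \<bullet> X x) + (p + real CARD('n)) * wint (\<lambda>x. (h x)\<^sup>2) - (real CARD('n) - 1) * (V\<^sup>2 / S)"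
proof -
  have n0: "real CARD('n) > 0" by simp
  have cX: "continuous_on (sphere 0 1) (\<lambda>x. X x $ k)" for k
    using continuous_sphere(2) by (rule continuous_on_component)
  have b: "wint (\<lambda>x. X x $ k * L (axis j 1) x) = (if j = k then V / real CARD('n) else 0)" for k j
    using wint_X_L[of k j] n0 by (auto simp: field_simps split: if_splits)
  have bs: "(\<Sum>j\<in>UNIV. (wint (\<lambda>x. X x $ k * L (axis j 1) x))\<^sup>2) = (V / real CARD('n))\<^sup>2" for k
    unfolding b by (simp add: if_distrib[of "\<lambda>t. t\<^sup>2"] cong: if_cong)
  have XX: "wint (\<lambda>x. X x \<bullet> X x) = (\<Sum>k\<in>UNIV. wint (\<lambda>x. (X x $ k)\<^sup>2))"
    unfolding inner_vec_def inner_real_def power2_eq_square using cX by (intro wint_sum continuous_on_mult) auto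
  have t: "real CARD('n) * (real CARD('n) / S * (V / real CARD('n))\<^sup>2) = V\<^sup>2 / S"
    using n0 by (simp add: power2_eq_square)
  have "(\<Sum>k\<in>UNIV. \<Lambda> * (wint (\<lambda>x. (X x $ k)\<^sup>2) - (wint (\<lambda>x. X x $ k))\<^sup>2 / V - real CARD('n) / S * (V / real CARD('n))\<^sup>2))
     \<le> (\<Sum>k\<in>UNIV. energy (\<lambda>x. H x $ k) (\<lambda>x. H x $ k) - (real CARD('n) - 1) * (real CARD('n) / S * (V / real CARD('n))\<^sup>2))"
    using spectral_inequality_X unfolding bs by (intro sum_mono)
  also have "(\<Sum>k\<in>UNIV. energy (\<lambda>x. H x $ k) (\<lambda>x. H x $ k) - (real CARD('n) - 1) * (real CARD('n) / S * (V / real CARD('n))\<^sup>2))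
     = (\<Sum>k\<in>UNIV. energy (\<lambda>x. H x $ k) (\<lambda>x. H x $ k)) - (real CARD('n) - 1) * (real CARD('n) * (real CARD('n) / S * (V / real CARD('n))\<^sup>2))"
    by (simp only: sum_subtractf sum_constant) (simp add: mult_ac)
  also have "(\<Sum>k\<in>UNIV. \<Lambda> * (wint (\<lambda>x. (X x $ k)\<^sup>2) - (wint (\<lambda>x. X x $ k))\<^sup>2 / V - real CARD('n) / S * (V / real CARD('n))\<^sup>2))
     = \<Lambda> * (wint (\<lambda>x. X x \<bullet> X x) - (\<Sum>k\<in>UNIV. (wint (\<lambda>x. X x $ k))\<^sup>2) / V - real CARD('n) * (real CARD('n) / S * (V / real CARD('n))\<^sup>2))"
    unfolding sum_distrib_left[symmetric] XX sum_divide_distrib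
    by (simp only: sum_subtractf sum_constant)
  finally show ?thesis unfolding t sum_energy_X by simp
qed

text \<open>Cauchy-Schwarz for h and 1/h, whose product integrates to V; t = V/S minimizes the
  integral of (h - t/h)^2.\<close>

lemma V2_le: "V\<^sup>2 / S \<le> wint (\<lambda>x. (h x)\<^sup>2)"
proof -
  define t where "t = V / S"
  have ci: "continuous_on (sphere 0 1) (\<lambda>x. inverse ((h x)\<^sup>2))"
    unfolding power_inverse[symmetric] by (intro continuous_on_power continuous_inverse_h)
  have "0 \<le> wint (\<lambda>x. (h x - t * inverse (h x))\<^sup>2)"
    by (intro wint_nonneg continuous_on_power continuous_on_diff continuous_on_mult continuous_on_const
        continuous_inverse_h continuous_sphere) simp
  also have "\<dots> = wint (\<lambda>x. ((h x)\<^sup>2 - (2 * t) * 1) + t\<^sup>2 * inverse ((h x)\<^sup>2))"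
  proof (rule wint_cong)
    fix x :: "real^'n" assume "norm x = 1"
    then have "h x > 0" by (rule hpos)
    then show "(h x - t * inverse (h x))\<^sup>2 = ((h x)\<^sup>2 - (2 * t) * 1) + t\<^sup>2 * inverse ((h x)\<^sup>2)"
      by (simp add: power2_eq_square field_simps)
  qed
  also have "\<dots> = (wint (\<lambda>x. (h x)\<^sup>2) - wint (\<lambda>x. (2 * t) * 1)) + wint (\<lambda>x. t\<^sup>2 * inverse ((h x)\<^sup>2))"
    using ci continuous_sphere(1)
    by (subst wint_add wint_diff, auto intro!: continuous_on_diff continuous_on_power continuous_on_mult continuous_on_const)+
  also have "\<dots> = wint (\<lambda>x. (h x)\<^sup>2) - 2 * t * V + t\<^sup>2 * S"
    unfolding wint_cmult V_def S_def by simp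
  also have "\<dots> = wint (\<lambda>x. (h x)\<^sup>2) - V\<^sup>2 / S"
    using S_pos by (simp add: t_def power2_eq_square field_simps)
  finally show ?thesis by simp
qed

text \<open>The spectral gap inequality for the coordinates of \<open>X\<close> is the reverse of the Cauchy-Schwarz
  inequality for the tangential part \<open>X - h x\<close>, which is therefore constant, hence zero.\<close>

lemma tangential_gradient_zero:
  assumes p: "p < - real CARD('n)" and s: "2 * real CARD('n) - 1 + p > 0"
    and \<Lambda>: "\<Lambda> = (real CARD('n) - 1)\<^sup>2 / (2 * real CARD('n) - 1 + p)" and x: "norm x = 1"
  shows "X x = h x *\<^sub>R x"
proof -
  let ?n = "real CARD('n)"
  let ?s = "2 * ?n - 1 + p"
  define A where "A = wint (\<lambda>x. X x \<bullet> X x)"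
  define D where "D = wint (\<lambda>x. (h x)\<^sup>2)"
  define Q where "Q = (\<Sum>k\<in>UNIV. (wint (\<lambda>x. X x $ k))\<^sup>2)"
  define T where "T x = X x - h x *\<^sub>R x" for x
  define t where "t = (\<chi> k. wint (\<lambda>x. T x $ k))"
  have n2: "?n \<ge> 2" using dim by simp
  have cX: "continuous_on (sphere 0 1) (\<lambda>x. X x $ k)" for k
    using continuous_sphere(2) by (rule continuous_on_component)
  have cT: "continuous_on (sphere 0 1) T"
    unfolding T_def by (intro continuous_on_diff continuous_on_scaleR continuous_sphere continuous_on_id)
  have \<Lambda>_ge: "\<Lambda> \<ge> ?n - 1"
  proof -
    have "(?n - 1) * ?s \<le> (?n - 1) * (?n - 1)" using p n2 by (intro mult_left_mono) auto
    then show ?thesis unfolding \<Lambda> using s by (simp add: le_divide_eq power2_eq_square)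
  qed
  have "\<Lambda> * (A - Q / V - V\<^sup>2 / S) \<le> - (p + 1) * A + (p + ?n) * D - (?n - 1) * (V\<^sup>2 / S)"
    unfolding A_def D_def Q_def by (rule spectral_inequality_sum)
  moreover have "(\<Lambda> - (?n - 1)) * (V\<^sup>2 / S) \<le> (\<Lambda> - (?n - 1)) * D"
    unfolding D_def using \<Lambda>_ge by (intro mult_left_mono V2_le) simp
  \<comment> \<open>Replacing V^2/S by its upper bound D brings the coefficient of D to (p + n) +
    \<Lambda> - (n - 1), the same as that of A.\<close>
  ultimately have 1: "(p + 1 + \<Lambda>) * (A - D) \<le> \<Lambda> * (Q / V)"
    by (simp only: left_diff_distrib right_diff_distrib distrib_right) (simp add: algebra_simps)
  have \<Lambda>s: "\<Lambda> * ?s = (?n - 1)\<^sup>2" using s by (simp add: \<Lambda>)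
  then have "(p + 1 + \<Lambda>) * ?s = (p + ?n)\<^sup>2" by (simp add: distrib_right power2_eq_square algebra_simps)
  moreover have "((p + 1 + \<Lambda>) * (A - D)) * ?s \<le> (\<Lambda> * (Q / V)) * ?s"
    using 1 s by (intro mult_right_mono) auto
  ultimately have 2: "(p + ?n)\<^sup>2 * (A - D) \<le> (?n - 1)\<^sup>2 * (Q / V)"
    using \<Lambda>s by (metis mult.assoc mult.commute)
  have tk: "(p + ?n) * t $ k = (?n - 1) * wint (\<lambda>x. X x $ k)" for k
  proof -
    have "t $ k = wint (\<lambda>x. X x $ k) - wint (\<lambda>x. h x * x $ k)"
      unfolding t_def T_def vec_lambda_beta vector_minus_component vector_scaleR_component real_scaleR_def
      by (intro wint_diff cX continuous_on_mult continuous_sphere continuous_on_component continuous_on_id)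
    then have "(p + ?n) * t $ k = (p + ?n) * wint (\<lambda>x. X x $ k) - (p + ?n) * wint (\<lambda>x. h x * x $ k)"
      by (simp only: right_diff_distrib)
    also have "\<dots> = (p + ?n) * wint (\<lambda>x. X x $ k) - (p + 1) * wint (\<lambda>x. X x $ k)"
      by (simp only: wint_X)
    also have "\<dots> = (?n - 1) * wint (\<lambda>x. X x $ k)" by (simp add: algebra_simps)
    finally show ?thesis .
  qed
  have "(p + ?n)\<^sup>2 * (t \<bullet> t) = (\<Sum>k\<in>UNIV. ((p + ?n) * t $ k)\<^sup>2)"
    by (simp add: inner_vec_def sum_distrib_left power2_eq_square mult_ac)
  also have "\<dots> = (?n - 1)\<^sup>2 * Q"
    unfolding tk by (simp add: Q_def sum_distrib_left power_mult_distrib)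
  finally have 3: "(p + ?n)\<^sup>2 * ((t \<bullet> t) / V) = (?n - 1)\<^sup>2 * (Q / V)" by simp
  have pn: "(p + ?n)\<^sup>2 > 0" using p by simp
  have 4: "A - D \<le> (t \<bullet> t) / V" using 2 unfolding 3[symmetric] mult_le_cancel_left_pos[OF pn] .
  have TT: "wint (\<lambda>x. T x \<bullet> T x) = A - D"
  proof -
    have "wint (\<lambda>x. T x \<bullet> T x) = wint (\<lambda>x. X x \<bullet> X x - (h x)\<^sup>2)"
    proof (rule wint_cong)
      fix x :: "real^'n" assume x: "norm x = 1"
      then have "x \<noteq> 0" by auto
      then have "x \<bullet> X x = h x" "x \<bullet> x = 1" using inner_X[of x] x by (auto simp: norm_eq_1)
      then show "T x \<bullet> T x = X x \<bullet> X x - (h x)\<^sup>2"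
        by (simp add: T_def inner_diff_left inner_diff_right inner_commute[of "X x" x] power2_eq_square)
    qed
    also have "\<dots> = A - D"
      unfolding A_def D_def by (intro wint_diff continuous_on_inner continuous_on_power continuous_sphere)
    finally show ?thesis .
  qed
  define \<tau> where "\<tau> = t /\<^sub>R V"
  have wT: "wint (\<lambda>x. T x \<bullet> \<tau>) = t \<bullet> \<tau>"
  proof -
    have "wint (\<lambda>x. T x \<bullet> \<tau>) = (\<Sum>k\<in>UNIV. wint (\<lambda>x. T x $ k * \<tau> $ k))"
      unfolding inner_vec_def inner_real_def
      by (intro wint_sum continuous_on_mult continuous_on_component cT continuous_on_const) simp
    also have "\<dots> = t \<bullet> \<tau>"
      unfolding inner_vec_def t_def using wint_cmult by (simp add: mult.commute[of _ "\<tau> $ _"])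
    finally show ?thesis .
  qed
  have c1: "continuous_on (sphere 0 1) (\<lambda>x. (T x - \<tau>) \<bullet> (T x - \<tau>))"
    by (intro continuous_on_inner continuous_on_diff cT continuous_on_const)
  have "wint (\<lambda>x. (T x - \<tau>) \<bullet> (T x - \<tau>)) = wint (\<lambda>x. (T x \<bullet> T x - 2 * (T x \<bullet> \<tau>)) + (\<tau> \<bullet> \<tau>) * 1)"
    by (rule wint_cong) (simp add: inner_diff_left inner_diff_right inner_commute)
  also have "\<dots> = (wint (\<lambda>x. T x \<bullet> T x) - wint (\<lambda>x. 2 * (T x \<bullet> \<tau>))) + wint (\<lambda>x. (\<tau> \<bullet> \<tau>) * 1)"
    using cT by (subst wint_add wint_diff, auto intro!: continuous_on_diff continuous_on_inner continuous_on_mult continuous_on_const)+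
  also have "\<dots> = (A - D) - 2 * (t \<bullet> \<tau>) + (\<tau> \<bullet> \<tau>) * V"
    unfolding wint_cmult TT wT V_def by simp
  also have "\<dots> = (A - D) - (t \<bullet> t) / V"
    using V_pos by (simp add: \<tau>_def field_simps)
  also have "\<dots> \<le> 0" using 4 by simp
  finally have "wint (\<lambda>x. (T x - \<tau>) \<bullet> (T x - \<tau>)) \<le> 0" .
  moreover have "wint (\<lambda>x. (T x - \<tau>) \<bullet> (T x - \<tau>)) \<ge> 0" by (rule wint_nonneg[OF c1]) simp
  ultimately have 0: "wint (\<lambda>x. (T x - \<tau>) \<bullet> (T x - \<tau>)) = 0" by simp
  have T\<tau>: "T u = \<tau>" if "norm u = 1" for u
    using wint_eq_0_imp[OF c1 _ 0 that] by simp
  \<comment> \<open>T is tangential, so its constant value is orthogonal to every unit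
    vector.\<close>
  have xT: "u \<bullet> \<tau> = 0" if "norm u = 1" for u
  proof -
    have "u \<noteq> 0" using that by auto
    then have "u \<bullet> T u = 0"
      using inner_X[of u] that by (simp add: T_def inner_diff_right norm_eq_1)
    then show ?thesis using T\<tau>[OF that] by simp
  qed
  have "\<tau> = 0"
  proof (rule ccontr)
    assume "\<tau> \<noteq> 0"
    then have "(\<tau> /\<^sub>R norm \<tau>) \<bullet> \<tau> = 0" by (intro xT) simp
    then show False using \<open>\<tau> \<noteq> 0\<close> by simp
  qed
  then show ?thesis using T\<tau>[OF x] by (simp add: T_def)
qed

text \<open>X = h x on the sphere says that h / |x| has zero gradient, so h = r |x| on the connected
  punctured space. Comparing two values of det G then gives r^(2n) = r^(n+p), and since p differs
  from n this leaves r = 1.\<close>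

lemma h_eq_norm:
  assumes p: "p < - real CARD('n)" and s: "2 * real CARD('n) - 1 + p > 0"
    and \<Lambda>: "\<Lambda> = (real CARD('n) - 1)\<^sup>2 / (2 * real CARD('n) - 1 + p)" and x: "x \<noteq> 0"
  shows "h x = norm x"
proof -
  let ?f = "\<lambda>x. h x * inverse (norm x)"
  have f: "has_C1_grad ?f (\<lambda>x. h x *\<^sub>R ((- inverse ((norm x)\<^sup>2)) *\<^sub>R (x /\<^sub>R norm x)) + inverse (norm x) *\<^sub>R X x)"
    by (rule has_C1_grad_mult[OF h1 has_C1_grad_inverse[OF has_C1_grad_norm]]) simp
  have X0: "X (t *\<^sub>R v) = X v" if "v \<noteq> 0" "t > 0" for t v
    using homogeneousD[OF homX that] that(2) by (intro vec_eq_iff[THEN iffD2] allI) simp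
  have X: "X y = (h y * inverse (norm y)) *\<^sub>R (y /\<^sub>R norm y)" if y: "y \<noteq> 0" for y
  proof -
    have "y = norm y *\<^sub>R (y /\<^sub>R norm y)" using y by simp
    moreover have "X (norm y *\<^sub>R (y /\<^sub>R norm y)) = X (y /\<^sub>R norm y)"
      using y by (intro X0) auto
    moreover have "X (y /\<^sub>R norm y) = h (y /\<^sub>R norm y) *\<^sub>R (y /\<^sub>R norm y)"
      using y by (intro tangential_gradient_zero[OF p s \<Lambda>]) simp
    moreover have "h (y /\<^sub>R norm y) = h y * inverse (norm y)"
      using homogeneousD[OF hom y, of "inverse (norm y)"] y by simp
    ultimately show ?thesis by metis
  qed
  have f0: "(?f has_derivative (\<lambda>v. 0)) (at y)" if y: "y \<noteq> 0" for y
  proof -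
    have "h y *\<^sub>R ((- inverse ((norm y)\<^sup>2)) *\<^sub>R (y /\<^sub>R norm y)) + inverse (norm y) *\<^sub>R X y = 0"
      unfolding X[OF y] by (simp add: power2_eq_square)
    then show ?thesis using has_C1_gradD[OF f y] by simp
  qed
  have "connected (- {0 :: real^'n})"
    by (rule connected_punctured_universe) (use dim in simp)
  then have "?f constant_on (- {0})"
    by (rule has_derivative_zero_connected_constant_on[where K = "{}"])
       (use f0 has_C1_grad_continuous[OF f] in \<open>auto intro: has_derivative_at_withinI\<close>)
  then obtain r where r: "\<And>y. y \<noteq> 0 \<Longrightarrow> ?f y = r" by (auto simp: constant_on_def)
  have hr: "h y = r * norm y" if "y \<noteq> 0" for y
    using r[OF that] that by (simp add: field_simps)
  obtain u :: "real^'n" where u: "norm u = 1" using vector_choose_size[of 1] by auto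
  have u0: "u \<noteq> 0" using u by auto
  have r0: "r > 0" using hr[OF u0] hpos[OF u] u by simp
  \<comment> \<open>The Hessian of h^2 is 2 G by the product rule and 2 r^2 times the identity by
    the formula for h; passing through the square avoids differentiating the norm twice.\<close>
  have hh: "has_C2_grad (\<lambda>y. h y * h y) (\<lambda>y. h y *\<^sub>R X y + h y *\<^sub>R X y) (\<lambda>y. G y + G y)"
    using has_C2_grad_mult[OF h2 h2] unfolding G_def .
  have "has_C2_grad (\<lambda>y::real^'n. r\<^sup>2 * (y \<bullet> y)) (\<lambda>y. r\<^sup>2 *\<^sub>R (2 *\<^sub>R y)) (\<lambda>y. r\<^sup>2 *\<^sub>R (2 *\<^sub>R mat 1))"
    unfolding has_C2_grad_def
  proof (intro conjI allI)
    have "has_C1_grad (\<lambda>y::real^'n. y \<bullet> y) (\<lambda>y. 2 *\<^sub>R y)"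
      by (rule has_C1_gradI) (auto intro!: derivative_eq_intros continuous_intros simp: inner_commute)
    then show "has_C1_grad (\<lambda>y::real^'n. r\<^sup>2 * (y \<bullet> y)) (\<lambda>y. r\<^sup>2 *\<^sub>R (2 *\<^sub>R y))" by (rule has_C1_grad_cmult)
    fix j
    have e: "(r\<^sup>2 *\<^sub>R (2 *\<^sub>R mat 1) :: real^'n^'n) $ j = (r\<^sup>2 * 2) *\<^sub>R axis j 1"
      by (auto simp: vec_eq_iff mat_def axis_def)
    show "has_C1_grad (\<lambda>y::real^'n. (r\<^sup>2 *\<^sub>R (2 *\<^sub>R y)) $ j) (\<lambda>y. (r\<^sup>2 *\<^sub>R (2 *\<^sub>R mat 1)) $ j)"
      unfolding e using has_C1_grad_cmult[OF has_C1_grad_component[of j], of "r\<^sup>2 * 2"] by (simp add: mult.assoc)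
  qed
  then have "has_C2_grad (\<lambda>y. h y * h y) (\<lambda>y. r\<^sup>2 *\<^sub>R (2 *\<^sub>R y)) (\<lambda>y. r\<^sup>2 *\<^sub>R (2 *\<^sub>R mat 1))"
    by (rule has_C2_grad_cong) (simp add: hr dot_square_norm power2_eq_square)
  from hess_eq[OF this u0] hess_eq[OF hh u0] have "G u + G u = r\<^sup>2 *\<^sub>R (2 *\<^sub>R mat 1)" by (simp only:)
  then have "2 *\<^sub>R G u = 2 *\<^sub>R (r\<^sup>2 *\<^sub>R mat 1)"
    unfolding scaleR_2[of "G u"] by (simp only: scaleR_left_commute)
  then have "G u = r\<^sup>2 *\<^sub>R mat 1" by (simp only: scaleR_cancel_left) simp
  then have "det (G u) = (r\<^sup>2) ^ CARD('n)" by (simp add: det_scaleR)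
  moreover have "(r\<^sup>2) ^ CARD('n) = r powr (2 * real CARD('n))"
    using powr_realpow[OF r0, of "2 * CARD('n)"] by (simp add: power_mult)
  ultimately have "r powr (2 * real CARD('n)) = r powr (real CARD('n) + p)"
    using det_G[OF u] hr[OF u0] u by simp
  then have "2 * real CARD('n) * ln r = (real CARD('n) + p) * ln r"
    using r0 by (metis ln_powr less_irrefl)
  then have "(real CARD('n) - p) * ln r = 0" by (simp add: algebra_simps)
  then have "ln r = 0" using p by simp
  then have "r = 1" using r0 by simp
  then show ?thesis using hr[OF x] by simp
qed

end

section \<open>Return to the operator, the eigenvalue and the body\<close>

context minkowski_solution
begin

text \<open>Both \<open>D2\<close> matrices contain \<open>outer x x\<close>. As x is an eigenvector
  of the inverse with eigenvalue 1, this part contributes exactly the 1 that \<open>HBM_op\<close>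
  subtracts; on the rest the inverse may be replaced by h G^(-1) through
  \<open>trace_inverse_A\<close>.\<close>

lemma HBM_op_eq:
  assumes dim: "CARD('n) \<ge> 2" and K: "support_fun K = h" and z: "has_C2_grad z gz Gz" and z0: "homogeneous 0 z" and x: "norm x = 1"
  shows "HBM_op K z x = (h x)\<^sup>2 * trace (Gi x ** Gz x) / (real CARD('n) - 1)"
proof -
  have x0: "x \<noteq> 0" using x by auto
  have xx: "x \<bullet> x = 1" using x by (simp add: norm_eq_1)
  obtain gf Gf where f: "has_C2_grad (\<lambda>x. z x * h x) gf Gf"
    using has_C2_grad_mult[OF z h2] by blast
  have zn: "z (y /\<^sub>R norm y) = z y" and hn: "norm y * h (y /\<^sub>R norm y) = h y" if y: "y \<noteq> 0" for y
    using homogeneousD[OF z0 y, of "inverse (norm y)"] homogeneousD[OF hom y, of "inverse (norm y)"] y by simp_all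
  have "has_C2_grad (ext1 h) X H"
    using h2 by (rule has_C2_grad_cong) (simp add: ext1_def hn)
  then have D2h: "D2 (support_fun K) x = H x + outer x x"
    unfolding D2_def K using hess_eq x0 by metis
  have "has_C2_grad (ext1 (\<lambda>y. z y * h y)) gf Gf"
    using f by (rule has_C2_grad_cong) (simp add: ext1_def zn hn mult.left_commute[of "norm _"])
  then have D2f: "D2 (\<lambda>y. z y * support_fun K y) x = Gf x + outer x x"
    unfolding D2_def K using hess_eq x0 by metis
  have "homogeneous (0 + 1 - 1) (\<lambda>x. gf x $ j)" for j
    by (rule homogeneous_grad[OF has_C2_gradD1[OF f] homogeneous_mult[OF z0 hom]])
  then have "x \<bullet> Gf x $ j = 0" for j
    using homogeneous_euler[OF has_C2_gradD2[OF f], of 0 j] x0 by simp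
  then have fx: "Gf x *v x = 0"
    by (simp add: vec_eq_iff matrix_vector_mul_component inner_commute)
  have ft: "transpose (Gf x) = Gf x"
    using has_C2_grad_symmetric[OF f x0] by (simp add: vec_eq_iff transpose_def)
  let ?A = "H x + outer x x"
  have dA: "det ?A \<noteq> 0" using det_A[OF x] hpos[OF x] by simp
  have "?A *v x = x" by (simp add: matrix_vector_mult_add_rdistrib outer_mult_vec H_radial[OF x0] xx)
  then have Ax: "matrix_inv ?A *v x = x" using matrix_inv_mult_vec(2)[OF dA, of x] by simp
  have "trace (matrix_inv ?A ** (Gf x + outer x x)) = h x * trace (Gi x ** Gf x) + 1"
    unfolding matrix_add_distrib trace_add trace_mult_outer Ax xx trace_inverse_A[OF x ft fx] ..
  then have "HBM_op K z x = h x * trace (Gi x ** Gf x) / (real CARD('n) - 1) - z x"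
    unfolding HBM_op_def D2h D2f by simp
  then show ?thesis
    unfolding trace_Gi_hess[OF z z0 f x] using dim by (simp add: diff_divide_distrib)
qed

end

text \<open>A point of the ball outside K would be strictly separated from K by a hyperplane with
  normal a, contradicting the value |a| of the support function at -a.\<close>

lemma convex_body0_eq_cball:
  fixes K :: "(real^'n::finite) set"
  assumes K: "convex_body0 K" and h: "\<And>x. x \<noteq> 0 \<Longrightarrow> support_fun K x = norm x"
  shows "K = cball 0 1"
proof
  have le: "x \<bullet> y \<le> norm x" if "y \<in> K" for x y
    using support_pt_max[OF K that, of x] h[of x] by (cases "x = 0") (auto simp: support_fun_eq[OF K])
  show "K \<subseteq> cball 0 1"
  proof
    fix y assume "y \<in> K"
    then have "norm y * norm y \<le> norm y * 1" using le[of y y] by (simp add: dot_square_norm power2_eq_square)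
    then show "y \<in> cball 0 1" by (cases "y = 0") (auto simp: mult_le_cancel_left)
  qed
  show "cball 0 1 \<subseteq> K"
  proof
    fix y :: "real^'n" assume y: "y \<in> cball 0 1"
    show "y \<in> K"
    proof (rule ccontr)
      assume "y \<notin> K"
      moreover have "convex K" "closed K" using K by (auto simp: convex_body0_def compact_imp_closed)
      ultimately obtain a b where ab: "a \<bullet> y < b" "\<forall>x\<in>K. a \<bullet> x > b"
        using separating_hyperplane_closed_point[of K y] by blast
      have in_K: "support_pt K (- a) \<in> K" by (rule support_pt_in[OF K])
      have a0: "a \<noteq> 0" using ab in_K by force
      have "norm a = (- a) \<bullet> support_pt K (- a)"
        using h[of "- a"] a0 support_fun_eq[OF K, of "- a"] by simp
      also have "\<dots> < - b" using ab(2) in_K by simp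
      also have "\<dots> < (- a) \<bullet> y" using ab(1) by simp
      also have "\<dots> \<le> norm (- a) * norm y" by (rule norm_cauchy_schwarz)
      also have "\<dots> \<le> norm a * 1" using y by (intro mult_mono) auto
      finally show False by simp
    qed
  qed
qed

lemma support_fun_homogeneous:
  assumes K: "convex_body0 K"
  shows "homogeneous 1 (support_fun K)"
  unfolding homogeneous_def
proof (intro allI impI)
  fix x :: "real^'a" and t :: real assume t: "t > 0"
  have "t *\<^sub>R x \<bullet> support_pt K (t *\<^sub>R x) = t * (x \<bullet> support_pt K x)"
  proof (rule antisym)
    have "x \<bullet> support_pt K (t *\<^sub>R x) \<le> x \<bullet> support_pt K x"
      by (intro support_pt_max[OF K] support_pt_in[OF K])
    then show "t *\<^sub>R x \<bullet> support_pt K (t *\<^sub>R x) \<le> t * (x \<bullet> support_pt K x)"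
      using t by simp
    have "t *\<^sub>R x \<bullet> support_pt K x \<le> t *\<^sub>R x \<bullet> support_pt K (t *\<^sub>R x)"
      by (intro support_pt_max[OF K] support_pt_in[OF K])
    then show "t * (x \<bullet> support_pt K x) \<le> t *\<^sub>R x \<bullet> support_pt K (t *\<^sub>R x)" by simp
  qed
  then show "support_fun K (t *\<^sub>R x) = t powr 1 * support_fun K x"
    using t by (simp add: support_fun_eq[OF K])
qed

lemma support_fun_pos:
  assumes K: "convex_body0 K" and x: "x \<noteq> 0"
  shows "support_fun K x > 0"
proof -
  obtain e where e: "e > 0" "ball 0 e \<subseteq> K"
    using K by (auto simp: convex_body0_def mem_interior)
  define y where "y = (e / (2 * norm x)) *\<^sub>R x"
  have "norm y < e" using e x by (simp add: y_def)
  then have "y \<in> K" using e by auto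
  then have "x \<bullet> y \<le> support_fun K x" using support_pt_max[OF K] by (simp add: support_fun_eq[OF K])
  moreover have "x \<bullet> y > 0" using e x by (simp add: y_def)
  ultimately show ?thesis by simp
qed

theorem theorem1p2:
  fixes K :: "(real ^ 'n) set" and p :: real
  assumes "CARD('n) \<ge> 3"
    and "(1 - 3 * (real CARD('n))\<^sup>2) / (2 * real CARD('n)) \<le> p"
    and "p < - real CARD('n)"
    and "K2plus K"
    and "S2_isotropic K"
    and "\<forall>x\<in>sphere 0 1. support_fun K x powr (1 - p) * det (D2 (support_fun K) x) = 1"
    and "lambda2 K \<ge> ereal ((real CARD('n) - 1) / (2 * real CARD('n) - 1 + p))"
  shows "K = cball 0 1"
proof -
  let ?n = "real CARD('n)"
  define s where "s = 2 * ?n - 1 + p"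
  have K: "convex_body0 K" using assms(4) by (simp add: K2plus_def)
  have n3: "?n \<ge> 3" using assms(1) by simp
  have s: "s > 0"
  proof -
    have "1 - 3 * ?n\<^sup>2 \<le> p * (2 * ?n)" using assms(2) n3 by (simp add: divide_le_eq)
    then have "(?n - 1)\<^sup>2 \<le> s * (2 * ?n)" by (simp add: s_def power2_eq_square algebra_simps)
    moreover have "(?n - 1)\<^sup>2 > 0" using n3 by simp
    ultimately have "s * (2 * ?n) > 0" by linarith
    then show ?thesis using n3 by (simp add: zero_less_mult_iff)
  qed
  obtain H where h2: "has_C2_grad (support_fun K) (support_pt K) H"
    using support_fun_C2[OF assms(4)] .
  have hom: "homogeneous 1 (support_fun K)" by (rule support_fun_homogeneous[OF K])
  have D2: "D2 (support_fun K) x = H x + outer x x" if x: "norm x = 1" for x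
  proof -
    have "has_C2_grad (ext1 (support_fun K)) (support_pt K) H"
      using h2
    proof (rule has_C2_grad_cong)
      show "ext1 (support_fun K) y = support_fun K y" if "y \<noteq> 0" for y
        using homogeneousD[OF hom that, of "inverse (norm y)"] that by (simp add: ext1_def)
    qed
    moreover have "x \<noteq> 0" using x by auto
    ultimately have "hess (ext1 (support_fun K)) x = H x" by (rule hess_eq)
    then show ?thesis by (simp add: D2_def)
  qed
  interpret minkowski_solution "support_fun K" "support_pt K" H p
  proof
    show "support_fun K x powr (1 - p) * det (H x + outer x x) = 1" if "norm x = 1" for x
    proof -
      have "x \<in> sphere 0 1" using that by simp
      from bspec[OF assms(6) this] show ?thesis unfolding D2[OF that] .
    qed
  qed (use h2 hom support_fun_pos[OF K] in auto)
  have det: "det (D2 (support_fun K) x) = support_fun K x powr (p - 1)" if "norm x = 1" for x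
    using det_A[OF that] D2[OF that] by simp
  \<comment> \<open>The equation gives det D^2 h = h^(p-1), so the cone-volume density is h^p / n
    and \<open>wint\<close> is n times the integral against the cone-volume measure.\<close>
  have dens: "cone_vol_dens K x = support_fun K x powr p / ?n" if x: "norm x = 1" for x
    using hpos[OF x] by (simp add: cone_vol_dens_def det[OF x] powr_diff)
  have sph_dens: "sph_int (\<lambda>x. f x * cone_vol_dens K x) = wint f / ?n" for f
  proof -
    have "sph_int (\<lambda>x. f x * cone_vol_dens K x) = sph_int (\<lambda>x. (support_fun K x powr p * f x) * (1 / ?n))"
      by (rule sph_int_cong) (simp add: dens)
    then show ?thesis unfolding sph_int_mult_right wint_def by simp
  qed
  have S2: "sph_int (\<lambda>x. f x * S2_dens K x) = wint (\<lambda>x. f x * inverse ((support_fun K x)\<^sup>2))" for f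
    unfolding wint_def
  proof (rule sph_int_cong)
    fix x :: "real^'n" assume x: "norm x = 1"
    show "f x * S2_dens K x = support_fun K x powr p * (f x * inverse ((support_fun K x)\<^sup>2))"
      using hpos[OF x] by (simp add: S2_dens_def det[OF x] powr_diff power2_eq_square divide_inverse)
  qed
  have iso1: "wint (\<lambda>x. (L w x)\<^sup>2) = S / ?n * (norm w)\<^sup>2" for w
  proof -
    have "sph_int (S2_dens K) = S" using S2[of "\<lambda>x. 1"] by (simp add: S_def)
    moreover have "sph_int (\<lambda>x. (x \<bullet> w)\<^sup>2 * S2_dens K x) = wint (\<lambda>x. (L w x)\<^sup>2)"
      unfolding S2 by (rule wint_cong) (simp add: L_def power_mult_distrib power_inverse)
    ultimately show ?thesis
      using assms(5) unfolding S2_isotropic_def isotropic_dens_def by metis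
  qed
  \<comment> \<open>Polarization of the isotropy condition, which is stated for squares
    only.\<close>
  have iso: "wint (\<lambda>x. L u x * L v x) = S / ?n * (u \<bullet> v)" for u v
  proof -
    have "S / ?n * (norm (u + v))\<^sup>2 = wint (\<lambda>x. (L (u + v) x)\<^sup>2)" by (rule iso1[symmetric])
    also have "\<dots> = wint (\<lambda>x. ((L u x)\<^sup>2 + (L v x)\<^sup>2) + 2 * (L u x * L v x))"
      by (rule wint_cong) (simp add: L_def inner_add_right power2_eq_square algebra_simps)
    also have "\<dots> = (wint (\<lambda>x. (L u x)\<^sup>2) + wint (\<lambda>x. (L v x)\<^sup>2)) + wint (\<lambda>x. 2 * (L u x * L v x))"
      using continuous_L(1) by (subst wint_add wint_add, auto intro!: continuous_on_add continuous_on_power continuous_on_mult continuous_on_const)+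
    finally have "S / ?n * (norm (u + v))\<^sup>2 = S / ?n * (norm u)\<^sup>2 + S / ?n * (norm v)\<^sup>2 + 2 * wint (\<lambda>x. L u x * L v x)"
      unfolding iso1 wint_cmult .
    moreover have "(norm (u + v))\<^sup>2 = (norm u)\<^sup>2 + (norm v)\<^sup>2 + 2 * (u \<bullet> v)"
      by (simp add: power2_norm_eq_inner inner_add_left inner_add_right inner_commute)
    ultimately have "S * (2 * (u \<bullet> v)) / ?n = 2 * wint (\<lambda>x. L u x * L v x)" by (simp add: distrib_left)
    moreover have "S * (2 * (u \<bullet> v)) / ?n = 2 * (S / ?n * (u \<bullet> v))" by simp
    ultimately show ?thesis by linarith
  qed
  \<comment> \<open>\<open>\<mu>\<close> is the bound assumed for \<open>lambda2 K\<close>;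
    \<open>\<Lambda>\<close> is n - 1 times it.\<close>
  define \<mu> where "\<mu> = (?n - 1) / s"
  have \<mu>: "\<mu> > 0" using n3 s by (simp add: \<mu>_def)
  define \<Lambda> where "\<Lambda> = (?n - 1)\<^sup>2 / s"
  have \<Lambda>: "\<Lambda> = (?n - 1) * \<mu>" by (simp add: \<Lambda>_def \<mu>_def power2_eq_square)
  have gap: "\<Lambda> * wint (\<lambda>x. (z x)\<^sup>2) \<le> energy gz gz"
    if z: "has_C2_grad z gz Gz" and z0: "homogeneous 0 z" and wz: "wint z = 0"
      and wzL: "\<And>v. wint (\<lambda>x. z x * L v x) = 0" for z gz Gz
  proof (cases "\<exists>x\<in>sphere 0 1. z x \<noteq> 0")
    \<comment> \<open>A function vanishing on the sphere is not admissible for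
      \<open>lambda2\<close>, but then both sides are zero.\<close>
    case False
    then have z_zero: "z x = 0" if "x \<noteq> 0" for x
      using homogeneousD[OF z0 that, of "inverse (norm x)"] that by simp
    have "has_C1_grad z (\<lambda>x. 0)"
      by (rule has_C1_grad_cong[OF has_C1_grad_const[of 0]]) (use z_zero in auto)
    then have "gz x = 0" if "norm x = 1" for x
      using has_C1_grad_unique[OF has_C2_gradD1[OF z], of z "\<lambda>x. 0" x] that by force
    then have "energy gz gz = 0"
      unfolding energy_def by (subst sph_int_cong[where g = "\<lambda>x. 0"]) auto
    moreover have "wint (\<lambda>x. (z x)\<^sup>2) = 0"
      unfolding wint_def by (subst sph_int_cong[where g = "\<lambda>x. 0"]) (use False in auto)
    ultimately show ?thesis by simp
  next
    case True
    obtain Gn where n2: "has_C2_grad norm (\<lambda>x::real^'n. x /\<^sub>R norm x) Gn" using has_C2_grad_norm_ex by blast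
    have "C2_sphere z"
      unfolding C2_sphere_def
    proof (rule has_C2_grad_imp_C2_on, rule has_C2_grad_cong[OF has_C2_grad_mult[OF n2 z]])
      show "ext1 z x = norm x * z x" if "x \<noteq> 0" for x
        using homogeneousD[OF z0 that, of "inverse (norm x)"] that by (simp add: ext1_def)
    qed
    moreover have "sph_int (\<lambda>x. z x * cone_vol_dens K x) = 0" unfolding sph_dens wz by simp
    moreover have "sph_int (\<lambda>x. z x * ell K v x * cone_vol_dens K x) = 0" for v
      unfolding sph_dens using wzL[of v] by (simp add: ell_def L_def divide_inverse)
    ultimately have "lambda2_admissible K z" using True by (simp add: lambda2_admissible_def)
    then have "lambda2 K \<le> ereal (sph_int (\<lambda>x. z x * (- HBM_op K z x) * cone_vol_dens K x) /
             sph_int (\<lambda>x. (z x)\<^sup>2 * cone_vol_dens K x))"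
      unfolding lambda2_def by (intro INF_lower) simp
    also have "sph_int (\<lambda>x. z x * (- HBM_op K z x) * cone_vol_dens K x) = energy gz gz / (?n * (?n - 1))"
    proof -
      have "sph_int (\<lambda>x. z x * (- HBM_op K z x) * cone_vol_dens K x) =
        sph_int (\<lambda>x. (z x * (support_fun K x powr (p + 2) * trace (Gi x ** Gz x))) * (- 1 / (?n * (?n - 1))))"
      proof (rule sph_int_cong)
        fix x :: "real^'n" assume x: "norm x = 1"
        show "z x * (- HBM_op K z x) * cone_vol_dens K x = (z x * (support_fun K x powr (p + 2) * trace (Gi x ** Gz x))) * (- 1 / (?n * (?n - 1)))"
          using n3 by (simp add: HBM_op_eq[OF _ refl z z0 x] dens[OF x] h_powr(1)[OF x] mult_ac)
      qed
      also have "\<dots> = (- energy gz gz) * (- 1 / (?n * (?n - 1)))"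
        unfolding sph_int_mult_right weak_form[OF z z0 has_C2_gradD1[OF z] z0] ..
      finally show ?thesis by simp
    qed
    also have "sph_int (\<lambda>x. (z x)\<^sup>2 * cone_vol_dens K x) = wint (\<lambda>x. (z x)\<^sup>2) / ?n" by (rule sph_dens)
    finally have "ereal \<mu> \<le> ereal (energy gz gz / (?n * (?n - 1)) / (wint (\<lambda>x. (z x)\<^sup>2) / ?n))"
      using assms(7) order_trans unfolding \<mu>_def s_def by blast
    then have le: "\<mu> \<le> energy gz gz / (?n * (?n - 1)) / (wint (\<lambda>x. (z x)\<^sup>2) / ?n)" by simp
    \<comment> \<open>Division by zero yields 0, so a vanishing denominator would turn
      \<open>le\<close> into \<mu> \<le> 0.\<close>
    have "wint (\<lambda>x. (z x)\<^sup>2) \<noteq> 0" using le \<mu> by auto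
    moreover have "wint (\<lambda>x. (z x)\<^sup>2) \<ge> 0"
      using has_C1_grad_continuous_sphere(1)[OF has_C2_gradD1[OF z]]
      by (intro wint_nonneg continuous_on_power) auto
    ultimately have W: "wint (\<lambda>x. (z x)\<^sup>2) > 0" by simp
    have "energy gz gz / (?n * (?n - 1)) / (wint (\<lambda>x. (z x)\<^sup>2) / ?n) = energy gz gz / ((?n - 1) * wint (\<lambda>x. (z x)\<^sup>2))"
      using n3 by simp
    then have "\<mu> * ((?n - 1) * wint (\<lambda>x. (z x)\<^sup>2)) \<le> energy gz gz"
      using le W n3 by (simp add: pos_le_divide_eq)
    then show ?thesis by (simp add: \<Lambda> mult_ac)
  qed
  interpret spectral_gap "support_fun K" "support_pt K" H p \<Lambda>
  proof
    show "CARD('n) \<ge> 2" using assms(1) by simp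
  qed (fact iso, fact gap)
  show ?thesis
  proof (rule convex_body0_eq_cball[OF K])
    show "support_fun K x = norm x" if "x \<noteq> 0" for x
      by (rule h_eq_norm[OF assms(3) _ _ that]) (use s in \<open>auto simp: \<Lambda>_def s_def\<close>)
  qed
qed

end
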